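(* Let $0<R<1$ and $\zeta_1,\zeta_2,\chi,\kappa,\nu>0$. Consider the stochastic differential equation on $N=\mathbb{R}^2\times\mathbb{R}/(2\pi\mathbb{Z})\times\mathbb{R}$ for $U(t)=(v_1(t),v_2(t),u_1(t),u_2(t))$: $$\begin{aligned} dv_1&=v_2\,dt,\\ dv_2&=\frac{-2\zeta_1v_2-\chi^2v_1+Ru_2^2\cos u_1-2R\zeta_2u_2\sin u_1-R\kappa^2\sin^2u_1}{1-R\sin^2u_1}\,dt+\frac{\nu}{1-R\sin^2u_1}\,dW(t),\\ du_1&=u_2\,dt,\\ du_2&=\frac{-2\zeta_2u_2-\kappa^2\sin u_1-2\zeta_1v_2\sin u_1-\chi^2v_1\sin u_1+Ru_2^2\sin u_1\cos u_1}{1-R\sin^2u_1}\,dt+\frac{\nu\sin u_1}{1-R\sin^2u_1}\,dW(t). \end{aligned}$$ (i) For every initial condition $U(0)\in N$ the system has a unique solution $\{U(t):t\ge0\}$ valid for all $t\ge0$. (ii) There exists $b>0$ such that for every initial $U(0)\in N$, almost surely, $\|U(t)\|\le b$ for infinitely many $t$ as $t\to\infty$ (that is, the set of times $t$ with $\|U(t)\|\le b$ is unbounded). (iii) There exist $\beta>0$ and $K$ such that every invariant probability $\pi$ for the system satisfies $\int_N\exp(\beta\|U\|^2)\,d\pi(U)\le K$. (iv) There exist $0<\beta\le\beta_1$ and $K_1$, and for every $\gamma>0$ there exists $K_2$, such that $$\mathbb{E}\exp\bigl(\beta\|U(t)\|^2\bigr)\le K_1e^{-\gamma t}\exp\bigl(\beta_1\|U(0)\|^2\bigr)+K_2$$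 for all initial conditions $U(0)\in N$ and all $t\ge0$.
   Context: $W$ is a standard one-dimensional Wiener process; the It\^o and Stratonovich interpretations of the system coincide. For $U=(v_1,v_2,u_1,u_2)\in N$ we write, by abuse of notation, $\|U\|=\sqrt{v_1^2+v_2^2+u_2^2}$ (the angle $u_1$ is omitted). Initial conditions are deterministic. *)

theory Defs
  imports "HOL-Probability.Probability"
begin

section \<open>The circle and the phase space\<close>

quotient_type angle = real / "\<lambda>x y. \<exists>k::int. x - y = 2 * pi * of_int k"
proof (rule equivpI)
  show "reflp (\<lambda>x y::real. \<exists>k::int. x - y = 2 * pi * of_int k)"
    by (auto intro!: reflpI exI[of _ 0])
  show "symp (\<lambda>x y::real. \<exists>k::int. x - y = 2 * pi * of_int k)"
  proof (rule sympI)
    fix x y :: real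
    assume "\<exists>k::int. x - y = 2 * pi * of_int k"
    then obtain k :: int where "x - y = 2 * pi * of_int k" by blast
    then have "y - x = 2 * pi * of_int (- k)" by simp
    then show "\<exists>k::int. y - x = 2 * pi * of_int k" by blast
  qed
  show "transp (\<lambda>x y::real. \<exists>k::int. x - y = 2 * pi * of_int k)"
  proof (rule transpI)
    fix x y z :: real
    assume "\<exists>k::int. x - y = 2 * pi * of_int k" "\<exists>k::int. y - z = 2 * pi * of_int k"
    then obtain k l :: int
      where "x - y = 2 * pi * of_int k" "y - z = 2 * pi * of_int l" by blast
    then have "x - z = 2 * pi * of_int (k + l)" by (simp add: algebra_simps)
    then show "\<exists>k::int. x - z = 2 * pi * of_int k" by blast
  qed
qed

lift_definition to_angle :: "real \<Rightarrow> angle" is "\<lambda>x. x" .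

lift_definition angle_sin :: "angle \<Rightarrow> real" is sin
proof -
  fix x y :: real
  assume "\<exists>k::int. x - y = 2 * pi * of_int k"
  then obtain k :: int where "x = y + 2 * pi * of_int k" by (auto simp: algebra_simps)
  then show "sin x = sin y" by (simp add: sin_add sin_int_2pin cos_int_2pin)
qed

lift_definition angle_cos :: "angle \<Rightarrow> real" is cos
proof -
  fix x y :: real
  assume "\<exists>k::int. x - y = 2 * pi * of_int k"
  then obtain k :: int where "x = y + 2 * pi * of_int k" by (auto simp: algebra_simps)
  then show "cos x = cos y" by (simp add: cos_add sin_int_2pin cos_int_2pin)
qed

instantiation angle :: plus
begin

lift_definition plus_angle :: "angle \<Rightarrow> angle \<Rightarrow> angle" is "(+)"
proof -
  fix x y z w :: real
  assume "\<exists>k::int. x - y = 2 * pi * of_int k" "\<exists>k::int. z - w = 2 * pi * of_int k"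
  then obtain k l :: int
    where "x - y = 2 * pi * of_int k" "z - w = 2 * pi * of_int l" by blast
  then have "(x + z) - (y + w) = 2 * pi * of_int (k + l)" by (simp add: algebra_simps)
  then show "\<exists>k::int. (x + z) - (y + w) = 2 * pi * of_int k" by blast
qed

instance ..

end

text \<open>The circle carries the quotient topology.\<close>

instantiation angle :: topological_space
begin

definition open_angle :: "angle set \<Rightarrow> bool" where
  "open_angle S \<longleftrightarrow> open (to_angle -` S)"

instance
  by standard (auto simp: open_angle_def vimage_Int vimage_Union)

end

type_synonym state = "real \<times> real \<times> angle \<times> real"

fun v1 :: "state \<Rightarrow> real" where "v1 (a, b, c, d) = a"
fun v2 :: "state \<Rightarrow> real" where "v2 (a, b, c, d) = b"
fun u1 :: "state \<Rightarrow> angle" where "u1 (a, b, c, d) = c"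
fun u2 :: "state \<Rightarrow> real" where "u2 (a, b, c, d) = d"

definition state_norm :: "state \<Rightarrow> real" where
  "state_norm x = sqrt ((v1 x)\<^sup>2 + (v2 x)\<^sup>2 + (u2 x)\<^sup>2)"


section \<open>Wiener processes and the Ito integral\<close>

text \<open>Only the times \<open>t \<ge> 0\<close> matter: a filtration on \<open>[0, \<infinity>)\<close> is extended to negative times
  by \<open>F 0\<close>. No completeness or right-continuity of the filtration is required.\<close>

locale wiener_process = prob_space M + filtration "space M" F
  for M :: "'a measure" and F :: "real \<Rightarrow> 'a measure" +
  fixes W :: "real \<Rightarrow> 'a \<Rightarrow> real"
  assumes sets_F_subset: "\<And>t. sets (F t) \<subseteq> sets M"
    and W_adapted: "\<And>t. 0 \<le> t \<Longrightarrow> W t \<in> borel_measurable (F t)"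
    and W_continuous: "\<And>\<omega>. \<omega> \<in> space M \<Longrightarrow> continuous_on {0..} (\<lambda>t. W t \<omega>)"
    and W_zero: "AE \<omega> in M. W 0 \<omega> = 0"
    and W_increment_normal: "\<And>s t. 0 \<le> s \<Longrightarrow> s < t \<Longrightarrow>
      distributed M lborel (\<lambda>\<omega>. W t \<omega> - W s \<omega>) (\<lambda>x. ennreal (normal_density 0 (sqrt (t - s)) x))"
    and W_increment_indep: "\<And>s t. 0 \<le> s \<Longrightarrow> s < t \<Longrightarrow>
      indep_set (sets (F s)) {(\<lambda>\<omega>. W t \<omega> - W s \<omega>) -` A \<inter> space M | A. A \<in> sets borel}"

text \<open>A bounded simple adapted process on \<open>[0, t]\<close> takes the value \<open>\<xi> i\<close> on
  \<open>(\<tau> i, \<tau> (i + 1)]\<close> for \<open>i < n\<close>.\<close>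

definition simple_process ::
  "'a measure \<Rightarrow> (real \<Rightarrow> 'a measure) \<Rightarrow> real \<Rightarrow> nat \<Rightarrow> (nat \<Rightarrow> real) \<Rightarrow> (nat \<Rightarrow> 'a \<Rightarrow> real) \<Rightarrow> bool"
where
  "simple_process M F t n \<tau> \<xi> \<longleftrightarrow>
     \<tau> 0 = 0 \<and> \<tau> n = t \<and> (\<forall>i<n. \<tau> i \<le> \<tau> (Suc i)) \<and>
     (\<forall>i<n. \<xi> i \<in> borel_measurable (F (\<tau> i))) \<and>
     (\<exists>C. \<forall>i<n. \<forall>\<omega>\<in>space M. \<bar>\<xi> i \<omega>\<bar> \<le> C)"

definition simple_value ::
  "nat \<Rightarrow> (nat \<Rightarrow> real) \<Rightarrow> (nat \<Rightarrow> 'a \<Rightarrow> real) \<Rightarrow> real \<Rightarrow> 'a \<Rightarrow> real" where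
  "simple_value n \<tau> \<xi> s \<omega> = (\<Sum>i<n. \<xi> i \<omega> * indicator {\<tau> i<..\<tau> (Suc i)} s)"

definition simple_integral ::
  "(real \<Rightarrow> 'a \<Rightarrow> real) \<Rightarrow> nat \<Rightarrow> (nat \<Rightarrow> real) \<Rightarrow> (nat \<Rightarrow> 'a \<Rightarrow> real) \<Rightarrow> 'a \<Rightarrow> real" where
  "simple_integral W n \<tau> \<xi> \<omega> = (\<Sum>i<n. \<xi> i \<omega> * (W (\<tau> (Suc i)) \<omega> - W (\<tau> i) \<omega>))"

definition progressive_upto ::
  "(real \<Rightarrow> 'a measure) \<Rightarrow> real \<Rightarrow> (real \<Rightarrow> 'a \<Rightarrow> real) \<Rightarrow> bool" where
  "progressive_upto F t H \<longleftrightarrow>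
     (\<forall>T\<in>{0..t}. (\<lambda>(s, \<omega>). H s \<omega>) \<in> borel_measurable (restrict_space borel {0..T} \<Otimes>\<^sub>M F T))"

definition tends_to_zero_in_prob :: "'a measure \<Rightarrow> (nat \<Rightarrow> 'a \<Rightarrow> ennreal) \<Rightarrow> bool" where
  "tends_to_zero_in_prob M X \<longleftrightarrow>
     (\<forall>\<epsilon>>0. (\<lambda>k. measure M {\<omega>\<in>space M. ennreal \<epsilon> < X k \<omega>}) \<longlonglongrightarrow> 0)"

text \<open>\<open>I\<close> is a version of the Ito integral of \<open>H\<close> against \<open>W\<close> over \<open>[0, t]\<close>: it is the limit in
  probability of the integrals of simple adapted processes \<open>G\<^sub>k\<close> for which
  \<open>\<integral>\<^sub>0\<^sup>t (G\<^sub>k - H)\<^sup>2 ds\<close> tends to \<open>0\<close> in probability. Such \<open>G\<^sub>k\<close> exist exactly for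
  progressively measurable \<open>H\<close> with \<open>\<integral>\<^sub>0\<^sup>t H\<^sup>2 ds < \<infinity>\<close> almost surely.\<close>

definition has_ito_integral ::
  "'a measure \<Rightarrow> (real \<Rightarrow> 'a measure) \<Rightarrow> (real \<Rightarrow> 'a \<Rightarrow> real) \<Rightarrow> (real \<Rightarrow> 'a \<Rightarrow> real) \<Rightarrow>
   real \<Rightarrow> ('a \<Rightarrow> real) \<Rightarrow> bool"
where
  "has_ito_integral M F W H t I \<longleftrightarrow>
     progressive_upto F t H \<and> I \<in> borel_measurable M \<and>
     (\<exists>n \<tau> \<xi>. (\<forall>k. simple_process M F t (n k) (\<tau> k) (\<xi> k)) \<and>
        tends_to_zero_in_prob M (\<lambda>k \<omega>.
          \<integral>\<^sup>+ s\<in>{0..t}. ennreal ((simple_value (n k) (\<tau> k) (\<xi> k) s \<omega> - H s \<omega>)\<^sup>2) \<partial>lborel) \<and>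
        tends_to_zero_in_prob M (\<lambda>k \<omega>.
          ennreal \<bar>simple_integral W (n k) (\<tau> k) (\<xi> k) \<omega> - I \<omega>\<bar>))"

text \<open>\<open>dX = a dt + b dW\<close> for continuous \<open>a\<close>.\<close>

definition ito_process ::
  "'a measure \<Rightarrow> (real \<Rightarrow> 'a measure) \<Rightarrow> (real \<Rightarrow> 'a \<Rightarrow> real) \<Rightarrow> (real \<Rightarrow> 'a \<Rightarrow> real) \<Rightarrow>
   (real \<Rightarrow> 'a \<Rightarrow> real) \<Rightarrow> (real \<Rightarrow> 'a \<Rightarrow> real) \<Rightarrow> bool"
where
  "ito_process M F W X a b \<longleftrightarrow>
     (\<forall>t\<ge>0. \<exists>I. has_ito_integral M F W b t I \<and>
        (AE \<omega> in M. X t \<omega> = X 0 \<omega> + integral {0..t} (\<lambda>s. a s \<omega>) + I \<omega>))"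


section \<open>The system\<close>

definition drift_v2 :: "real \<Rightarrow> real \<Rightarrow> real \<Rightarrow> real \<Rightarrow> real \<Rightarrow> state \<Rightarrow> real" where
  "drift_v2 R \<zeta>1 \<zeta>2 chi \<kappa> x =
     (- 2 * \<zeta>1 * v2 x - chi\<^sup>2 * v1 x + R * (u2 x)\<^sup>2 * angle_cos (u1 x)
        - 2 * R * \<zeta>2 * u2 x * angle_sin (u1 x) - R * \<kappa>\<^sup>2 * (angle_sin (u1 x))\<^sup>2)
     / (1 - R * (angle_sin (u1 x))\<^sup>2)"

definition noise_v2 :: "real \<Rightarrow> real \<Rightarrow> state \<Rightarrow> real" where
  "noise_v2 R \<nu> x = \<nu> / (1 - R * (angle_sin (u1 x))\<^sup>2)"

definition drift_u2 :: "real \<Rightarrow> real \<Rightarrow> real \<Rightarrow> real \<Rightarrow> real \<Rightarrow> state \<Rightarrow> real" where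
  "drift_u2 R \<zeta>1 \<zeta>2 chi \<kappa> x =
     (- 2 * \<zeta>2 * u2 x - \<kappa>\<^sup>2 * angle_sin (u1 x) - 2 * \<zeta>1 * v2 x * angle_sin (u1 x)
        - chi\<^sup>2 * v1 x * angle_sin (u1 x) + R * (u2 x)\<^sup>2 * angle_sin (u1 x) * angle_cos (u1 x))
     / (1 - R * (angle_sin (u1 x))\<^sup>2)"

definition noise_u2 :: "real \<Rightarrow> real \<Rightarrow> state \<Rightarrow> real" where
  "noise_u2 R \<nu> x = \<nu> * angle_sin (u1 x) / (1 - R * (angle_sin (u1 x))\<^sup>2)"

text \<open>A (strong, global) solution started at the deterministic point \<open>x\<close>. The equation for the angle
  is read in the group \<open>\<real>/2\<pi>\<int>\<close>.\<close>

definition solution ::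
  "real \<Rightarrow> real \<Rightarrow> real \<Rightarrow> real \<Rightarrow> real \<Rightarrow> real \<Rightarrow>
   'a measure \<Rightarrow> (real \<Rightarrow> 'a measure) \<Rightarrow> (real \<Rightarrow> 'a \<Rightarrow> real) \<Rightarrow>
   state \<Rightarrow> (real \<Rightarrow> 'a \<Rightarrow> state) \<Rightarrow> bool"
where
  "solution R \<zeta>1 \<zeta>2 chi \<kappa> \<nu> M F W x U \<longleftrightarrow>
     (\<forall>t\<ge>0. U t \<in> F t \<rightarrow>\<^sub>M borel) \<and>
     (\<forall>\<omega>\<in>space M. continuous_on {0..} (\<lambda>t. U t \<omega>)) \<and>
     (AE \<omega> in M. U 0 \<omega> = x) \<and>
     (\<forall>t\<ge>0. AE \<omega> in M. v1 (U t \<omega>) = v1 (U 0 \<omega>) + integral {0..t} (\<lambda>s. v2 (U s \<omega>))) \<and>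
     ito_process M F W (\<lambda>t \<omega>. v2 (U t \<omega>))
       (\<lambda>t \<omega>. drift_v2 R \<zeta>1 \<zeta>2 chi \<kappa> (U t \<omega>)) (\<lambda>t \<omega>. noise_v2 R \<nu> (U t \<omega>)) \<and>
     (\<forall>t\<ge>0. AE \<omega> in M.
        u1 (U t \<omega>) = u1 (U 0 \<omega>) + to_angle (integral {0..t} (\<lambda>s. u2 (U s \<omega>)))) \<and>
     ito_process M F W (\<lambda>t \<omega>. u2 (U t \<omega>))
       (\<lambda>t \<omega>. drift_u2 R \<zeta>1 \<zeta>2 chi \<kappa> (U t \<omega>)) (\<lambda>t \<omega>. noise_u2 R \<nu> (U t \<omega>))"

text \<open>The transition probability \<open>P\<^sub>t(x, \<cdot>)\<close>, i.e. the law at time \<open>t\<close> of the solution started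
  at \<open>x\<close>. The description is meaningful because solutions are unique up to indistinguishability.\<close>

definition transition_law ::
  "real \<Rightarrow> real \<Rightarrow> real \<Rightarrow> real \<Rightarrow> real \<Rightarrow> real \<Rightarrow>
   'a measure \<Rightarrow> (real \<Rightarrow> 'a measure) \<Rightarrow> (real \<Rightarrow> 'a \<Rightarrow> real) \<Rightarrow> real \<Rightarrow> state \<Rightarrow> state measure"
where
  "transition_law R \<zeta>1 \<zeta>2 chi \<kappa> \<nu> M F W t x =
     (THE \<mu>. \<exists>U. solution R \<zeta>1 \<zeta>2 chi \<kappa> \<nu> M F W x U \<and> \<mu> = distr M borel (U t))"

definition invariant_probability ::
  "real \<Rightarrow> real \<Rightarrow> real \<Rightarrow> real \<Rightarrow> real \<Rightarrow> real \<Rightarrow>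
   'a measure \<Rightarrow> (real \<Rightarrow> 'a measure) \<Rightarrow> (real \<Rightarrow> 'a \<Rightarrow> real) \<Rightarrow> state measure \<Rightarrow> bool"
where
  "invariant_probability R \<zeta>1 \<zeta>2 chi \<kappa> \<nu> M F W p \<longleftrightarrow>
     prob_space p \<and> sets p = sets borel \<and>
     (\<forall>t\<ge>0. \<forall>A\<in>sets borel.
        emeasure p A = (\<integral>\<^sup>+ x. emeasure (transition_law R \<zeta>1 \<zeta>2 chi \<kappa> \<nu> M F W t x) A \<partial>p))"

end

theory Submission
  imports Defs
begin

text \<open>
  In the momenta \<open>m = v\<^sub>2 - R u\<^sub>2 sin u\<^sub>1\<close> and \<open>q = u\<^sub>2 - v\<^sub>2 sin u\<^sub>1\<close> the noise becomes additive: \<open>q\<close> has no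
  noise and \<open>dm = (- 2 \<zeta>\<^sub>1 v\<^sub>2 - \<chi>\<^sup>2 v\<^sub>1) dt + \<nu> dW\<close>. Hence \<open>(v\<^sub>1, m - \<nu> W, u\<^sub>1, q)\<close> solves, path by path, an
  ordinary differential equation with random coefficients, whose solution is unique by Gronwall's lemma
  and global because the energy grows at most exponentially. The noise coefficients of the original system
  depend only on \<open>u\<^sub>1\<close>, which is continuously differentiable in time, so their Ito integrals are given by
  partial integration and both formulations agree.

  A small multiple of \<open>v\<^sub>1 m\<close> added to the energy gives a Lyapunov function \<open>V\<close>, comparable to the square
  of the norm, whose drift is at most \<open>K - c V\<close> and which is quadratic in \<open>m\<close>. Gaussian integrals over a
  partition and Fatou's lemma bound \<open>E exp (\<beta> e\<^bsup>lT\<^esup> V\<^sub>T - \<beta> e\<^bsup>ls\<^esup> V\<^sub>s - \<integral> \<dots> dt)\<close> by 1. The weight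
  \<open>l = c\<close> gives \<open>E exp (\<beta> V\<^sub>T) \<le> exp (\<beta> e\<^bsup>-cT\<^esup> V\<^sub>0 + C)\<close>, from which the moment bounds (iv) and, letting
  \<open>T \<rightarrow> \<infinity>\<close>, (iii) follow; \<open>l = 0\<close> shows that \<open>V\<close> cannot stay above a fixed level forever, which is (ii).
\<close>


section \<open>Angles\<close>

text \<open>\<open>m\<close> and \<open>R q\<close> are the derivatives of the kinetic energy
  \<open>(v^2 - 2 R u v sin \<theta> + R u^2) / 2\<close> in \<open>v\<close> and \<open>u\<close>,
  that is, the conjugate momenta; the random force acts on the first coordinate only. The definition
  of the Ito integral offers just one approximating sequence, in probability and with arbitrary
  partitions, so identifying its limit for a C1 integrand is the stochastic core of uniqueness. This
  rests on the same Gaussian identity as the moment bounds: \<open>exp (a D + b D^2)\<close>,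
  divided by its mean, integrates to 1. The identity wants a deterministic \<open>b\<close>, whereas
  the energy is quadratic in the noise with a coefficient depending on the angle; that coefficient
  is replaced by its maximum. Friction acts on the velocities alone, so the energy by itself does
  not dissipate \<open>v1\<close>; the product \<open>v1 m\<close> carries part of the dissipation
  there. The exponential adds half the square of the energy gradient in the noise direction, and
  \<beta> is small so that the dissipation absorbs it. A weight that grows like
  \<open>exp (c t)\<close> and reaches \<beta> exactly at time \<open>T\<close> turns dissipation
  into decay of the initial energy.\<close>

lemma to_angle_surj: "\<exists>\<theta>. to_angle \<theta> = c"
  by (induct c) (metis to_angle.abs_eq)

lemma angle_sin_to_angle [simp]: "angle_sin (to_angle x) = sin x"
  by transfer simp

lemma angle_cos_to_angle [simp]: "angle_cos (to_angle x) = cos x"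
  by transfer simp

lemma to_angle_add: "to_angle x + to_angle y = to_angle (x + y)"
  by transfer (auto intro!: exI[of _ 0])

text \<open>Sine and cosine together separate the points of the circle, so an identity between
  angle-valued processes can be checked on two real-valued ones.\<close>

lemma angle_eq_iff: "a = b \<longleftrightarrow> angle_sin a = angle_sin b \<and> angle_cos a = angle_cos b"
proof
  assume eq: "angle_sin a = angle_sin b \<and> angle_cos a = angle_cos b"
  obtain x y where xy: "to_angle x = a" "to_angle y = b"
    using to_angle_surj by blast
  have "sin x = sin y \<and> cos x = cos y"
    using eq by (simp flip: xy)
  then obtain n :: int where "x = y + 2 * pi * n"
    unfolding sin_cos_eq_iff by blast
  then have "to_angle x = to_angle y"
    by transfer auto
  with xy show "a = b" by simp
qed simp

lemma continuous_on_to_angle: "continuous_on UNIV to_angle"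
  by (auto simp: continuous_on_open_vimage open_angle_def)

lemma continuous_on_angle_sin: "continuous_on UNIV angle_sin"
proof -
  have "to_angle -` angle_sin -` B = sin -` B" for B
    by auto
  moreover have "open (sin -` B :: real set)" if "open B" for B :: "real set"
    using that by (intro open_vimage continuous_intros)
  ultimately show ?thesis
    by (auto simp: continuous_on_open_vimage open_angle_def)
qed

lemma continuous_on_angle_cos: "continuous_on UNIV angle_cos"
proof -
  have "to_angle -` angle_cos -` B = cos -` B" for B
    by auto
  moreover have "open (cos -` B :: real set)" if "open B" for B :: "real set"
    using that by (intro open_vimage continuous_intros)
  ultimately show ?thesis
    by (auto simp: continuous_on_open_vimage open_angle_def)
qed

lemma state_proj: "v1 x = fst x" "v2 x = fst (snd x)" "u1 x = fst (snd (snd x))" "u2 x = snd (snd (snd x))"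
  by (cases x; simp)+

lemma continuous_on_state:
  "continuous_on UNIV v1" "continuous_on UNIV v2" "continuous_on UNIV u2"
  "continuous_on UNIV (\<lambda>x. angle_sin (u1 x))" "continuous_on UNIV (\<lambda>x. angle_cos (u1 x))"
  unfolding state_proj
  by (intro continuous_intros continuous_on_compose2[OF continuous_on_angle_sin]
        continuous_on_compose2[OF continuous_on_angle_cos]; simp)+

lemma state_measurable [measurable]:
  "v1 \<in> borel_measurable borel" "v2 \<in> borel_measurable borel" "u2 \<in> borel_measurable borel"
  "(\<lambda>x. angle_sin (u1 x)) \<in> borel_measurable borel"
  "(\<lambda>x. angle_cos (u1 x)) \<in> borel_measurable borel"
  by (intro borel_measurable_continuous_onI continuous_on_state)+

section \<open>Riemann sums\<close>

lemma sum_integral_partition: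
  fixes f :: "real \<Rightarrow> 'b::banach"
  assumes "f integrable_on {\<tau> 0..\<tau> n}" "\<And>i. i < n \<Longrightarrow> \<tau> i \<le> \<tau> (Suc i)"
  shows "(\<Sum>i<n. integral {\<tau> i..\<tau> (Suc i)} f) = integral {\<tau> 0..\<tau> n} f"
  using assms
proof (induction n)
  case (Suc n)
  have le: "\<tau> 0 \<le> \<tau> n"
    using Suc.prems(2) lift_Suc_mono_le[of \<tau>]
    by (induction n) (auto intro: order_trans)
  have "f integrable_on {\<tau> 0..\<tau> n}"
    by (rule integrable_on_subinterval[OF Suc.prems(1)]) (use Suc.prems(2)[of n] in auto)
  then have "(\<Sum>i<n. integral {\<tau> i..\<tau> (Suc i)} f) = integral {\<tau> 0..\<tau> n} f"
    using Suc by auto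
  then show ?case
    using Henstock_Kurzweil_Integration.integral_combine[of "\<tau> 0" "\<tau> n" "\<tau> (Suc n)" f] Suc.prems le by auto
qed simp

lemma partition_mono:
  fixes \<tau> :: "nat \<Rightarrow> real"
  assumes "\<And>i. i < n \<Longrightarrow> \<tau> i \<le> \<tau> (Suc i)" "i \<le> j" "j \<le> n"
  shows "\<tau> i \<le> \<tau> j"
  using assms(2,3)
proof (induction j)
  case (Suc j)
  then show ?case using assms(1)[of j] by (cases "i = Suc j") auto
qed auto

text \<open>Uniform continuity on the square bounds the error on each cell by \<open>e'\<close>
  times its length. Two arguments are used so that one may run through the cell while the other is
  frozen at a tag; this covers Riemann sums, Stieltjes sums and energies with frozen noise alike.
  The admissible mesh \<open>d\<close> depends on \<open>g\<close> and \<open>e\<close>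
  only.\<close>

lemma tagged_integral_close:
  fixes g :: "real \<Rightarrow> real \<Rightarrow> 'b::banach"
  assumes g: "continuous_on ({a..b} \<times> {a..b}) (\<lambda>(s, r). g s r)" and "a \<le> b" "0 < e"
  obtains d where "0 < d"
    "\<And>n \<tau> p. \<tau> 0 = a \<Longrightarrow> \<tau> n = b \<Longrightarrow> (\<And>i. i < n \<Longrightarrow> \<tau> i \<le> \<tau> (Suc i)) \<Longrightarrow>
       (\<And>i. i < n \<Longrightarrow> p i \<in> {\<tau> i..\<tau> (Suc i)}) \<Longrightarrow> (\<And>i. i < n \<Longrightarrow> \<tau> (Suc i) - \<tau> i < d) \<Longrightarrow>
       norm ((\<Sum>i<n. integral {\<tau> i..\<tau> (Suc i)} (\<lambda>s. g s (p i))) - integral {a..b} (\<lambda>s. g s s)) \<le> e"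
proof -
  \<comment> \<open>The summand 1 keeps the quotient meaningful when \<open>a = b\<close>.\<close>
  define e' where "e' = e / (b - a + 1)"
  have e': "0 < e'" "e' * (b - a) \<le> e"
    using assms by (auto simp: e'_def field_simps)
  have "uniformly_continuous_on ({a..b} \<times> {a..b}) (\<lambda>(s, r). g s r)"
    by (intro compact_uniformly_continuous g compact_Times compact_Icc)
  then obtain d where d: "0 < d" "\<And>x y. x \<in> {a..b} \<times> {a..b} \<Longrightarrow> y \<in> {a..b} \<times> {a..b} \<Longrightarrow> dist y x < d \<Longrightarrow>
      dist (case y of (s, r) \<Rightarrow> g s r) (case x of (s, r) \<Rightarrow> g s r) < e'"
    unfolding uniformly_continuous_on_def using e' by metis
  show ?thesis
  proof (rule that[OF d(1)])
    fix n :: nat and \<tau> p :: "nat \<Rightarrow> real"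
    assume \<tau>: "\<tau> 0 = a" "\<tau> n = b" and mono: "\<And>i. i < n \<Longrightarrow> \<tau> i \<le> \<tau> (Suc i)"
      and p: "\<And>i. i < n \<Longrightarrow> p i \<in> {\<tau> i..\<tau> (Suc i)}" and mesh: "\<And>i. i < n \<Longrightarrow> \<tau> (Suc i) - \<tau> i < d"
    have sub: "{\<tau> i..\<tau> (Suc i)} \<subseteq> {a..b}" if "i < n" for i
      using partition_mono[of n \<tau> 0 i] partition_mono[of n \<tau> "Suc i" n] mono that \<tau> by auto
    have diag: "continuous_on {a..b} (\<lambda>s. g s s)"
      using continuous_on_compose2[OF g, of "{a..b}" "\<lambda>s. (s, s)"] by (force intro!: continuous_intros)
    have row: "continuous_on {a..b} (\<lambda>s. g s r)" if "r \<in> {a..b}" for r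
      using continuous_on_compose2[OF g, of "{a..b}" "\<lambda>s. (s, r)"] that by (force intro!: continuous_intros)
    have "integral {a..b} (\<lambda>s. g s s) = (\<Sum>i<n. integral {\<tau> i..\<tau> (Suc i)} (\<lambda>s. g s s))"
      using sum_integral_partition[of "\<lambda>s. g s s" \<tau> n] \<tau> mono integrable_continuous_real[OF diag]
      by simp
    then have "norm ((\<Sum>i<n. integral {\<tau> i..\<tau> (Suc i)} (\<lambda>s. g s (p i))) - integral {a..b} (\<lambda>s. g s s))
      = norm (\<Sum>i<n. integral {\<tau> i..\<tau> (Suc i)} (\<lambda>s. g s (p i)) - integral {\<tau> i..\<tau> (Suc i)} (\<lambda>s. g s s))"
      by (simp add: sum_subtractf)
    also have "\<dots> \<le> (\<Sum>i<n. e' * (\<tau> (Suc i) - \<tau> i))"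
    proof (rule order_trans[OF norm_sum], rule sum_mono)
      fix i assume "i \<in> {..<n}"
      then have i: "i < n" by simp
      have pi: "p i \<in> {a..b}" using p[OF i] sub[OF i] by auto
      have int: "(\<lambda>s. g s (p i)) integrable_on {\<tau> i..\<tau> (Suc i)}" "(\<lambda>s. g s s) integrable_on {\<tau> i..\<tau> (Suc i)}"
        using continuous_on_subset[OF row[OF pi] sub[OF i]] continuous_on_subset[OF diag sub[OF i]]
        by (auto intro!: integrable_continuous_real)
      have "norm (integral {\<tau> i..\<tau> (Suc i)} (\<lambda>s. g s (p i) - g s s)) \<le> e' * (\<tau> (Suc i) - \<tau> i)"
      proof (rule integral_bound)
        fix s assume s: "s \<in> {\<tau> i..\<tau> (Suc i)}"
        have "dist (s, p i) (s, s) < d"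
          using s p[OF i] mesh[OF i] by (auto simp: dist_Pair_Pair dist_real_def)
        then show "norm (g s (p i) - g s s) \<le> e'"
          using d(2)[of "(s, s)" "(s, p i)"] s sub[OF i] pi by (auto simp: dist_norm)
      qed (use mono[OF i] continuous_on_subset[OF row[OF pi] sub[OF i]] continuous_on_subset[OF diag sub[OF i]]
            in \<open>auto intro!: continuous_intros\<close>)
      then show "norm (integral {\<tau> i..\<tau> (Suc i)} (\<lambda>s. g s (p i)) - integral {\<tau> i..\<tau> (Suc i)} (\<lambda>s. g s s))
         \<le> e' * (\<tau> (Suc i) - \<tau> i)"
        using integral_diff[OF int] by simp
    qed
    also have "\<dots> = e' * (b - a)"
      using sum_lessThan_telescope[of \<tau> n] \<tau> by (simp flip: sum_distrib_left)
    finally show "norm ((\<Sum>i<n. integral {\<tau> i..\<tau> (Suc i)} (\<lambda>s. g s (p i))) - integral {a..b} (\<lambda>s. g s s)) \<le> e"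
      using e' by linarith
  qed
qed

lemma tagged_integral_limit:
  fixes g :: "real \<Rightarrow> real \<Rightarrow> 'b::banach"
  assumes g: "continuous_on ({a..b} \<times> {a..b}) (\<lambda>(s, r). g s r)" and "a \<le> b"
    and \<tau>: "\<And>k. \<tau> k 0 = a" "\<And>k. \<tau> k (n k) = b" "\<And>k i. i < n k \<Longrightarrow> \<tau> k i \<le> \<tau> k (Suc i)"
    and p: "\<And>k i. i < n k \<Longrightarrow> p k i \<in> {\<tau> k i..\<tau> k (Suc i)}"
    and mesh: "\<And>k i. i < n k \<Longrightarrow> \<tau> k (Suc i) - \<tau> k i \<le> h k" and h: "h \<longlonglongrightarrow> 0"
  shows "(\<lambda>k. \<Sum>i<n k. integral {\<tau> k i..\<tau> k (Suc i)} (\<lambda>s. g s (p k i))) \<longlonglongrightarrow> integral {a..b} (\<lambda>s. g s s)"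
proof (rule metric_LIMSEQ_I)
  fix e :: real assume "0 < e"
  then obtain d where d: "0 < d"
    "\<And>n \<tau> p. \<tau> 0 = a \<Longrightarrow> \<tau> n = b \<Longrightarrow> (\<And>i. i < n \<Longrightarrow> \<tau> i \<le> \<tau> (Suc i)) \<Longrightarrow>
       (\<And>i. i < n \<Longrightarrow> p i \<in> {\<tau> i..\<tau> (Suc i)}) \<Longrightarrow> (\<And>i. i < n \<Longrightarrow> \<tau> (Suc i) - \<tau> i < d) \<Longrightarrow>
       norm ((\<Sum>i<n. integral {\<tau> i..\<tau> (Suc i)} (\<lambda>s. g s (p i))) - integral {a..b} (\<lambda>s. g s s)) \<le> e/2"
    using tagged_integral_close[OF g \<open>a \<le> b\<close>, of "e/2"] by auto
  from order_tendstoD(2)[OF h d(1)] obtain N where N: "\<And>k. N \<le> k \<Longrightarrow> h k < d"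
    by (auto simp: eventually_sequentially)
  show "\<exists>N. \<forall>k\<ge>N. dist (\<Sum>i<n k. integral {\<tau> k i..\<tau> k (Suc i)} (\<lambda>s. g s (p k i))) (integral {a..b} (\<lambda>s. g s s)) < e"
  proof (intro exI allI impI)
    fix k assume "N \<le> k"
    have "norm ((\<Sum>i<n k. integral {\<tau> k i..\<tau> k (Suc i)} (\<lambda>s. g s (p k i))) - integral {a..b} (\<lambda>s. g s s)) \<le> e/2"
      by (rule d(2)) (use \<tau> p le_less_trans[OF mesh N[OF \<open>N \<le> k\<close>]] in auto)
    then show "dist (\<Sum>i<n k. integral {\<tau> k i..\<tau> k (Suc i)} (\<lambda>s. g s (p k i))) (integral {a..b} (\<lambda>s. g s s)) < e"
      using \<open>0 < e\<close> by (simp add: dist_norm)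
  qed
qed

section \<open>Uniform partitions and measurability of integrals with a parameter\<close>

definition uniform_partition :: "real \<Rightarrow> real \<Rightarrow> nat \<Rightarrow> nat \<Rightarrow> real" where
  "uniform_partition a b n i = a + (b - a) * real i / real n"

lemma uniform_partition:
  assumes "a \<le> b" "0 < n"
  shows "uniform_partition a b n 0 = a" "uniform_partition a b n n = b"
    "uniform_partition a b n i \<le> uniform_partition a b n (Suc i)"
    "uniform_partition a b n (Suc i) - uniform_partition a b n i = (b - a) / real n"
    "a \<le> uniform_partition a b n i" "i \<le> n \<Longrightarrow> uniform_partition a b n i \<le> b"
proof -
  show "uniform_partition a b n (Suc i) - uniform_partition a b n i = (b - a) / real n"
    using assms by (simp add: uniform_partition_def field_simps)
  moreover have "0 \<le> (b - a) / real n" using assms by simp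
  ultimately show "uniform_partition a b n i \<le> uniform_partition a b n (Suc i)" by linarith
  show "a \<le> uniform_partition a b n i" using assms by (simp add: uniform_partition_def)
  show "uniform_partition a b n i \<le> b" if "i \<le> n"
  proof -
    have "(b - a) * (real i / real n) \<le> (b - a) * 1"
      using assms that by (intro mult_left_mono) auto
    then show ?thesis by (simp add: uniform_partition_def)
  qed
qed (use assms in \<open>auto simp: uniform_partition_def\<close>)

lemma mesh_tendsto: "(\<lambda>k. c / real (Suc k)) \<longlonglongrightarrow> 0"
  using tendsto_mult[OF tendsto_const[of c] LIMSEQ_inverse_real_of_nat]
  by (simp add: field_simps)

text \<open>For continuous paths the integral is a pointwise limit of left endpoint sums, each a
  finite combination of measurable functions. No joint measurability is involved, and with
  \<open>N = F t\<close> the result is adapted.\<close>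

lemma integral_measurable:
  fixes f :: "real \<Rightarrow> 'a \<Rightarrow> 'b::{banach, second_countable_topology}"
  assumes "\<And>s. s \<in> {0..t} \<Longrightarrow> f s \<in> borel_measurable N" "0 \<le> t"
    and "\<And>\<omega>. \<omega> \<in> space N \<Longrightarrow> continuous_on {0..t} (\<lambda>s. f s \<omega>)"
  shows "(\<lambda>\<omega>. integral {0..t} (\<lambda>s. f s \<omega>)) \<in> borel_measurable N"
proof (rule borel_measurable_LIMSEQ_metric)
  let ?u = "\<lambda>k. uniform_partition 0 t (Suc k)"
  note u = uniform_partition[of 0 t "Suc k" for k, OF \<open>0 \<le> t\<close>]
  show "(\<lambda>\<omega>. \<Sum>i<Suc k. (t / real (Suc k)) *\<^sub>R f (?u k i) \<omega>) \<in> borel_measurable N" for k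
    by (intro borel_measurable_sum borel_measurable_scaleR borel_measurable_const assms(1)) (auto intro!: u)
  fix \<omega> assume "\<omega> \<in> space N"
  have "(\<lambda>k. \<Sum>i<Suc k. integral {?u k i..?u k (Suc i)} (\<lambda>s. (\<lambda>s r. f r \<omega>) s (?u k i))) \<longlonglongrightarrow> integral {0..t} (\<lambda>s. (\<lambda>s r. f r \<omega>) s s)"
  proof (rule tagged_integral_limit[where h="\<lambda>k. t / real (Suc k)"])
    have "continuous_on {0..t} (\<lambda>s. f s \<omega>)" using assms \<open>\<omega> \<in> space N\<close> by auto
    then have "continuous_on ({0..t} \<times> {0..t}) (\<lambda>x. f (snd x) \<omega>)"
      by (rule continuous_on_compose2) (auto intro!: continuous_intros)
    then show "continuous_on ({0..t} \<times> {0..t}) (\<lambda>(s, r). f r \<omega>)"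
      by (simp add: case_prod_beta')
  qed (use u mesh_tendsto assms in auto)
  moreover have "integral {?u k i..?u k (Suc i)} (\<lambda>s. f (?u k i) \<omega>) = (t / real (Suc k)) *\<^sub>R f (?u k i) \<omega>" for k i
    using u(3,4)[of k i] by simp
  ultimately show "(\<lambda>k. \<Sum>i<Suc k. (t / real (Suc k)) *\<^sub>R f (?u k i) \<omega>) \<longlonglongrightarrow> integral {0..t} (\<lambda>s. f s \<omega>)"
    by (simp only:)
qed


section \<open>Gaussian increments\<close>

text \<open>For \<open>D\<close> normal with mean 0 and variance \<open>h\<close>, the logarithm of
  the mean of \<open>exp (a D + b D^2)\<close> is
  \<open>a^2 h / (2 (1 - 2 b h)) - ln (1 - 2 b h) / 2\<close>. It is subtracted here, so the
  exponential of this quantity has mean 1.\<close>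

definition gauss_exponent :: "real \<Rightarrow> real \<Rightarrow> real \<Rightarrow> real \<Rightarrow> real" where
  "gauss_exponent a b h d = a * d + b * d\<^sup>2 - a\<^sup>2 * h / (2 * (1 - 2 * b * h)) + ln (1 - 2 * b * h) / 2"

lemma nn_integral_normal_density: "0 < \<sigma> \<Longrightarrow> (\<integral>\<^sup>+z. ennreal (normal_density \<mu> \<sigma> z) \<partial>lborel) = 1"
  using prob_space.emeasure_space_1[OF prob_space_normal_density[of \<sigma> \<mu>]]
  by (simp add: emeasure_density)

text \<open>Completing the square: the exponential times the centred normal density is again a
  normal density, with mean \<open>a h / (1 - 2 b h)\<close> and variance
  \<open>h / (1 - 2 b h)\<close>.\<close>

lemma gauss_exponent_integral:
  assumes "0 < h" "2 * b * h < 1"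
  shows "(\<integral>\<^sup>+z. ennreal (exp (gauss_exponent a b h z)) * ennreal (normal_density 0 (sqrt h) z) \<partial>lborel) = 1"
proof -
  define k where "k = 1 - 2 * b * h"
  define \<sigma> where "\<sigma> = sqrt (h / k)"
  define \<mu> where "\<mu> = a * h / k"
  have k: "0 < k" "b = (1 - k) / (2 * h)" using assms by (auto simp: k_def field_simps)
  have \<sigma>: "0 < \<sigma>" "\<sigma>\<^sup>2 = h / k" using assms k by (auto simp: \<sigma>_def)
  have "exp (gauss_exponent a b h z) * normal_density 0 (sqrt h) z = normal_density \<mu> \<sigma> z" for z
  proof -
    have e: "gauss_exponent a b h z - z\<^sup>2 / (2 * h) = - ((z - \<mu>)\<^sup>2 / (2 * \<sigma>\<^sup>2)) + ln k / 2"
      unfolding gauss_exponent_def \<sigma>(2) \<mu>_def k_def[symmetric]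
      using k(1) assms(1) by (subst k(2)) (simp add: field_simps power2_eq_square)
    have "sqrt (2 * pi * \<sigma>\<^sup>2) = sqrt (2 * pi * h) / sqrt k"
      by (simp add: \<sigma> real_sqrt_mult real_sqrt_divide)
    moreover have "exp (ln k / 2) = sqrt k"
      using k(1) by (simp flip: ln_sqrt)
    moreover have "exp (gauss_exponent a b h z) * exp (- (z\<^sup>2 / (2 * h))) = exp (- ((z - \<mu>)\<^sup>2 / (2 * \<sigma>\<^sup>2))) * exp (ln k / 2)"
      using e by (simp flip: exp_add)
    ultimately show ?thesis
      unfolding normal_density_def using assms(1) by simp
  qed
  then have "(\<integral>\<^sup>+z. ennreal (exp (gauss_exponent a b h z)) * ennreal (normal_density 0 (sqrt h) z) \<partial>lborel)
     = (\<integral>\<^sup>+z. ennreal (normal_density \<mu> \<sigma> z) \<partial>lborel)"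
    by (simp flip: ennreal_mult')
  then show ?thesis
    using nn_integral_normal_density \<sigma>(1) by simp
qed

context wiener_process
begin

lemma measurable_F_mono: "f \<in> F s \<rightarrow>\<^sub>M N \<Longrightarrow> s \<le> t \<Longrightarrow> f \<in> F t \<rightarrow>\<^sub>M N"
  using sets_F_mono[of s t] space_F by (auto simp: measurable_def)

lemma measurable_F_M: "f \<in> F s \<rightarrow>\<^sub>M N \<Longrightarrow> f \<in> M \<rightarrow>\<^sub>M N"
  using sets_F_subset[of s] space_F by (auto simp: measurable_def)

lemma W_measurable_F: "0 \<le> s \<Longrightarrow> s \<le> t \<Longrightarrow> W s \<in> borel_measurable (F t)"
  using W_adapted measurable_F_mono by blast

lemma W_measurable: "0 \<le> s \<Longrightarrow> W s \<in> borel_measurable M"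
  using W_adapted measurable_F_M by blast

text \<open>The past may be frozen while the increment is integrated out. The identity, viewed as a
  random variable with values in the coarser space \<open>F s\<close>, turns independence of a
  \<sigma>-algebra into a product law for the pair of past and increment, to which Tonelli
  applies.\<close>

lemma nn_integral_increment:
  assumes "0 \<le> s" "s < t" and \<phi>: "\<phi> \<in> borel_measurable (F s \<Otimes>\<^sub>M borel)"
  shows "(\<integral>\<^sup>+\<omega>. \<phi> (\<omega>, W t \<omega> - W s \<omega>) \<partial>M)
    = (\<integral>\<^sup>+\<omega>. (\<integral>\<^sup>+z. \<phi> (\<omega>, z) * ennreal (normal_density 0 (sqrt (t - s)) z) \<partial>lborel) \<partial>M)"
proof -
  let ?D = "\<lambda>\<omega>. W t \<omega> - W s \<omega>"
  define N where "N = density lborel (\<lambda>x. ennreal (normal_density 0 (sqrt (t - s)) x))"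
  have id: "(\<lambda>\<omega>. \<omega>) \<in> M \<rightarrow>\<^sub>M F s"
    by (rule measurable_F_M[of _ s]) simp
  have D: "?D \<in> borel_measurable M"
    using W_measurable assms by auto
  have N: "distr M borel ?D = N"
  proof -
    have "distr M borel ?D = distr M lborel ?D" by (rule distr_cong) auto
    then show ?thesis
      using W_increment_normal[OF assms(1,2)] by (simp add: distributed_def N_def)
  qed
  interpret FF: prob_space "distr M (F s) (\<lambda>\<omega>. \<omega>)" by (rule prob_space_distr[OF id])
  interpret DD: prob_space "distr M borel ?D" by (rule prob_space_distr[OF D])
  have joint: "distr M (F s) (\<lambda>\<omega>. \<omega>) \<Otimes>\<^sub>M distr M borel ?D = distr M (F s \<Otimes>\<^sub>M borel) (\<lambda>\<omega>. (\<omega>, ?D \<omega>))"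
  proof (rule pair_measure_eqI)
    show "sets (distr M (F s) (\<lambda>\<omega>. \<omega>) \<Otimes>\<^sub>M distr M borel ?D) = sets (distr M (F s \<Otimes>\<^sub>M borel) (\<lambda>\<omega>. (\<omega>, ?D \<omega>)))"
      by (auto intro!: sets_pair_measure_cong)
    fix A B assume "A \<in> sets (distr M (F s) (\<lambda>\<omega>. \<omega>))" "B \<in> sets (distr M borel ?D)"
    then have AB: "A \<in> sets (F s)" "B \<in> sets borel" by auto
    have A: "A \<subseteq> space M" using sets.sets_into_space[OF AB(1)] space_F by simp
    then have "(\<lambda>\<omega>. \<omega>) -` A \<inter> space M = A" by auto
    moreover have "(\<lambda>\<omega>. (\<omega>, ?D \<omega>)) -` (A \<times> B) \<inter> space M = A \<inter> (?D -` B \<inter> space M)" using A by auto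
    moreover have "prob (A \<inter> (?D -` B \<inter> space M)) = prob A * prob (?D -` B \<inter> space M)"
      by (rule indep_setD[OF W_increment_indep[OF assms(1,2)]]) (use AB in auto)
    ultimately show "emeasure (distr M (F s) (\<lambda>\<omega>. \<omega>)) A * emeasure (distr M borel ?D) B
        = emeasure (distr M (F s \<Otimes>\<^sub>M borel) (\<lambda>\<omega>. (\<omega>, ?D \<omega>))) (A \<times> B)"
      using AB id D by (simp add: emeasure_distr measurable_Pair emeasure_eq_measure ennreal_mult')
  qed (rule FF.sigma_finite_measure_axioms DD.sigma_finite_measure_axioms)+
  have meas: "\<phi> \<in> borel_measurable (distr M (F s) (\<lambda>\<omega>. \<omega>) \<Otimes>\<^sub>M distr M borel ?D)"
    using \<phi> by (subst measurable_cong_sets) (auto intro!: sets_pair_measure_cong)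
  have "(\<integral>\<^sup>+\<omega>. \<phi> (\<omega>, ?D \<omega>) \<partial>M) = (\<integral>\<^sup>+x. \<phi> x \<partial>distr M (F s \<Otimes>\<^sub>M borel) (\<lambda>\<omega>. (\<omega>, ?D \<omega>)))"
    by (rule nn_integral_distr[symmetric]) (use id D \<phi> in auto)
  also have "\<dots> = (\<integral>\<^sup>+x. (\<integral>\<^sup>+z. \<phi> (x, z) \<partial>distr M borel ?D) \<partial>distr M (F s) (\<lambda>\<omega>. \<omega>))"
    unfolding joint[symmetric] by (rule DD.nn_integral_fst[symmetric, OF meas])
  also have "\<dots> = (\<integral>\<^sup>+\<omega>. (\<integral>\<^sup>+z. \<phi> (\<omega>, z) \<partial>distr M borel ?D) \<partial>M)"
    by (rule nn_integral_distr[OF id]) (use DD.borel_measurable_nn_integral_fst[OF meas] in simp)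
  also have "\<dots> = (\<integral>\<^sup>+\<omega>. (\<integral>\<^sup>+z. \<phi> (\<omega>, z) * ennreal (normal_density 0 (sqrt (t - s)) z) \<partial>lborel) \<partial>M)"
  proof (rule nn_integral_cong)
    fix \<omega> assume "\<omega> \<in> space M"
    then have "(\<lambda>z. \<phi> (\<omega>, z)) \<in> borel_measurable borel"
      using measurable_compose[OF measurable_Pair1' \<phi>] space_F by auto
    then show "(\<integral>\<^sup>+z. \<phi> (\<omega>, z) \<partial>distr M borel ?D)
       = (\<integral>\<^sup>+z. \<phi> (\<omega>, z) * ennreal (normal_density 0 (sqrt (t - s)) z) \<partial>lborel)"
      unfolding N N_def by (subst nn_integral_density) (auto simp: mult.commute)
  qed
  finally show ?thesis .
qed

text \<open>The product is integrated from the last factor backwards: given the past up to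
  \<open>\<tau> n\<close> both coefficients of that factor are constants, and its Gaussian mean is
  1. Only \<open>a\<close> may be random; \<open>b\<close> is fixed in advance, so that the bound on
  the mesh is deterministic.\<close>

lemma gauss_exponent_expectation:
  assumes "0 \<le> \<tau> 0" "\<And>i. i < n \<Longrightarrow> \<tau> i \<le> \<tau> (Suc i)"
    and "\<And>i. i < n \<Longrightarrow> a i \<in> borel_measurable (F (\<tau> i))"
    and "\<And>i. i < n \<Longrightarrow> 2 * b i * (\<tau> (Suc i) - \<tau> i) < 1"
  shows "(\<integral>\<^sup>+\<omega>. ennreal (exp (\<Sum>i<n. gauss_exponent (a i \<omega>) (b i) (\<tau> (Suc i) - \<tau> i) (W (\<tau> (Suc i)) \<omega> - W (\<tau> i) \<omega>))) \<partial>M) = 1"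
  using assms(2-)
proof (induction n)
  case 0
  then show ?case by (simp add: emeasure_space_1)
next
  case (Suc n)
  define P where "P = (\<lambda>\<omega>. exp (\<Sum>i<n. gauss_exponent (a i \<omega>) (b i) (\<tau> (Suc i) - \<tau> i) (W (\<tau> (Suc i)) \<omega> - W (\<tau> i) \<omega>)))"
  have IH: "(\<integral>\<^sup>+\<omega>. ennreal (P \<omega>) \<partial>M) = 1"
    unfolding P_def using Suc by auto
  have \<tau>: "0 \<le> \<tau> i" "\<tau> i \<le> \<tau> n" if "i \<le> n" for i
    using partition_mono[of n \<tau> 0 i] partition_mono[of n \<tau> i n] Suc.prems(1) assms(1) that by auto
  have P: "P \<in> borel_measurable (F (\<tau> n))"
    unfolding P_def
  proof (rule measurable_compose[OF _ borel_measurable_exp], rule borel_measurable_sum)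
    fix i assume "i \<in> {..<n}"
    then have i: "i < n" by simp
    have [measurable]: "a i \<in> borel_measurable (F (\<tau> n))" "W (\<tau> (Suc i)) \<in> borel_measurable (F (\<tau> n))" "W (\<tau> i) \<in> borel_measurable (F (\<tau> n))"
      using i \<tau>[of i] \<tau>[of "Suc i"] Suc.prems(2)[of i]
      by (auto intro: measurable_F_mono W_measurable_F)
    show "(\<lambda>\<omega>. gauss_exponent (a i \<omega>) (b i) (\<tau> (Suc i) - \<tau> i) (W (\<tau> (Suc i)) \<omega> - W (\<tau> i) \<omega>)) \<in> borel_measurable (F (\<tau> n))"
      unfolding gauss_exponent_def by measurable
  qed
  let ?g = "\<lambda>\<omega> z. gauss_exponent (a n \<omega>) (b n) (\<tau> (Suc n) - \<tau> n) z"
  have "(\<integral>\<^sup>+\<omega>. ennreal (P \<omega>) * ennreal (exp (?g \<omega> (W (\<tau> (Suc n)) \<omega> - W (\<tau> n) \<omega>))) \<partial>M) = 1"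
  \<comment> \<open>A cell of length zero has no normal density, but its exponent is 0 since the
    logarithm is \<open>ln 1\<close>.\<close>
  proof (cases "\<tau> n = \<tau> (Suc n)")
    case True
    then show ?thesis using IH by (simp add: gauss_exponent_def)
  next
    case False
    with Suc.prems(1)[of n] have lt: "\<tau> n < \<tau> (Suc n)" by simp
    have [measurable]: "a n \<in> borel_measurable (F (\<tau> n))" "P \<in> borel_measurable (F (\<tau> n))"
      using Suc.prems(2) P by auto
    have "(\<integral>\<^sup>+\<omega>. ennreal (P \<omega>) * ennreal (exp (?g \<omega> (W (\<tau> (Suc n)) \<omega> - W (\<tau> n) \<omega>))) \<partial>M)
      = (\<integral>\<^sup>+\<omega>. (\<integral>\<^sup>+z. ennreal (P \<omega>) * ennreal (exp (?g \<omega> z)) * ennreal (normal_density 0 (sqrt (\<tau> (Suc n) - \<tau> n)) z) \<partial>lborel) \<partial>M)"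
      using nn_integral_increment[OF \<tau>(1)[of n] lt, of "\<lambda>(\<omega>, z). ennreal (P \<omega>) * ennreal (exp (?g \<omega> z))"]
      unfolding gauss_exponent_def by simp
    also have "\<dots> = (\<integral>\<^sup>+\<omega>. ennreal (P \<omega>) \<partial>M)"
    proof (rule nn_integral_cong)
      fix \<omega>
      have [measurable]: "(\<lambda>z. ?g \<omega> z) \<in> borel_measurable borel"
        unfolding gauss_exponent_def by measurable
      show "(\<integral>\<^sup>+z. ennreal (P \<omega>) * ennreal (exp (?g \<omega> z)) * ennreal (normal_density 0 (sqrt (\<tau> (Suc n) - \<tau> n)) z) \<partial>lborel) = ennreal (P \<omega>)"
        using gauss_exponent_integral[of "\<tau> (Suc n) - \<tau> n" "b n" "a n \<omega>"] lt Suc.prems(3)[of n]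
        by (simp add: mult.assoc nn_integral_cmult)
    qed
    finally show ?thesis using IH by simp
  qed
  then show ?case
    by (simp add: P_def exp_add flip: ennreal_mult')
qed

end


section \<open>Ito integrals of continuously differentiable integrands\<close>

text \<open>Summation by parts moves the increments from \<open>w\<close>, which is merely
  continuous, to \<open>H\<close>. The increments of \<open>H\<close> are integrals of
  \<open>H'\<close> over the cells with \<open>w\<close> frozen at the right endpoint, and these
  converge.\<close>

lemma Riemann_Stieltjes_limit:
  fixes H H' w :: "real \<Rightarrow> real"
  assumes "0 \<le> t"
    and H: "\<And>s. s \<in> {0..t} \<Longrightarrow> (H has_real_derivative H' s) (at s within {0..t})"
    and H': "continuous_on {0..t} H'" and w: "continuous_on {0..t} w"
    and \<tau>: "\<And>k. \<tau> k 0 = 0" "\<And>k. \<tau> k (n k) = t" "\<And>k i. i < n k \<Longrightarrow> \<tau> k i \<le> \<tau> k (Suc i)"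
    and mesh: "\<And>k i. i < n k \<Longrightarrow> \<tau> k (Suc i) - \<tau> k i \<le> h k" and h: "h \<longlonglongrightarrow> 0"
  shows "(\<lambda>k. \<Sum>i<n k. H (\<tau> k i) * (w (\<tau> k (Suc i)) - w (\<tau> k i)))
    \<longlonglongrightarrow> H t * w t - H 0 * w 0 - integral {0..t} (\<lambda>s. H' s * w s)"
proof -
  have lim: "(\<lambda>k. \<Sum>i<n k. integral {\<tau> k i..\<tau> k (Suc i)} (\<lambda>s. H' s * w (\<tau> k (Suc i))))
    \<longlonglongrightarrow> integral {0..t} (\<lambda>s. H' s * w s)"
  proof (rule tagged_integral_limit[where g="\<lambda>s r. H' s * w r", OF _ \<open>0 \<le> t\<close> \<tau>(1,2,3) _ mesh h])
    have "continuous_on ({0..t} \<times> {0..t}) (\<lambda>x. H' (fst x) * w (snd x))"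
      by (intro continuous_intros continuous_on_compose2[OF H'] continuous_on_compose2[OF w]) auto
    then show "continuous_on ({0..t} \<times> {0..t}) (\<lambda>(s, r). H' s * w r)"
      by (simp add: case_prod_beta')
  qed (use \<tau> in auto)
  have eq: "(\<Sum>i<n k. H (\<tau> k i) * (w (\<tau> k (Suc i)) - w (\<tau> k i)))
    = H t * w t - H 0 * w 0 - (\<Sum>i<n k. integral {\<tau> k i..\<tau> k (Suc i)} (\<lambda>s. H' s * w (\<tau> k (Suc i))))" for k
  proof -
    have "integral {\<tau> k i..\<tau> k (Suc i)} (\<lambda>s. H' s * w (\<tau> k (Suc i))) = (H (\<tau> k (Suc i)) - H (\<tau> k i)) * w (\<tau> k (Suc i))"
      if i: "i < n k" for i
    proof -
      have sub: "{\<tau> k i..\<tau> k (Suc i)} \<subseteq> {0..t}"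
        using partition_mono[of "n k" "\<tau> k" 0 i] partition_mono[of "n k" "\<tau> k" "Suc i" "n k"] \<tau> i by auto
      have "(H' has_integral (H (\<tau> k (Suc i)) - H (\<tau> k i))) {\<tau> k i..\<tau> k (Suc i)}"
      proof (rule fundamental_theorem_of_calculus[OF \<tau>(3)[OF i]])
        fix x assume x: "x \<in> {\<tau> k i..\<tau> k (Suc i)}"
        then have "(H has_real_derivative H' x) (at x within {0..t})" using H sub by blast
        then show "(H has_vector_derivative H' x) (at x within {\<tau> k i..\<tau> k (Suc i)})"
          using sub by (auto intro: DERIV_subset simp flip: has_real_derivative_iff_has_vector_derivative)
      qed
      then show ?thesis
        by (simp add: integral_unique has_integral_mult_left)
    qed
    then have "(\<Sum>i<n k. integral {\<tau> k i..\<tau> k (Suc i)} (\<lambda>s. H' s * w (\<tau> k (Suc i))))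
      = (\<Sum>i<n k. (H (\<tau> k (Suc i)) - H (\<tau> k i)) * w (\<tau> k (Suc i)))"
      by (intro sum.cong refl) blast
    moreover have "(\<Sum>i<n k. H (\<tau> k i) * (w (\<tau> k (Suc i)) - w (\<tau> k i)))
       + (\<Sum>i<n k. (H (\<tau> k (Suc i)) - H (\<tau> k i)) * w (\<tau> k (Suc i)))
       = (\<Sum>i<n k. H (\<tau> k (Suc i)) * w (\<tau> k (Suc i)) - H (\<tau> k i) * w (\<tau> k i))"
      unfolding sum.distrib[symmetric] by (rule sum.cong) (auto simp: algebra_simps)
    moreover have "\<dots> = H t * w t - H 0 * w 0"
      using sum_lessThan_telescope[of "\<lambda>i. H (\<tau> k i) * w (\<tau> k i)" "n k"] \<tau> by simp
    ultimately show ?thesis by simp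
  qed
  show ?thesis
    unfolding eq by (intro tendsto_diff tendsto_const lim)
qed

section \<open>Simple processes: disjoint cells and the squared norm\<close>

lemma simple_value_eq:
  assumes "\<And>i. i < n \<Longrightarrow> \<tau> i \<le> \<tau> (Suc i)" "i < n" "s \<in> {\<tau> i<..\<tau> (Suc i)}"
  shows "simple_value n \<tau> \<xi> s \<omega> = \<xi> i \<omega>"
proof -
  have "indicator {\<tau> j<..\<tau> (Suc j)} s = (if j = i then 1 else 0 :: real)" if "j < n" for j
  proof (cases j i rule: linorder_cases)
    case less
    then have "\<tau> (Suc j) \<le> \<tau> i" using partition_mono[of n \<tau> "Suc j" i] assms(1,2) by simp
    with assms(3) less show ?thesis by auto
  next
    case greater
    then have "\<tau> (Suc i) \<le> \<tau> j" using partition_mono[of n \<tau> "Suc i" j] assms(1) that by simp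
    with assms(3) greater show ?thesis by auto
  qed (use assms in auto)
  then have "simple_value n \<tau> \<xi> s \<omega> = (\<Sum>j<n. if j = i then \<xi> i \<omega> else 0)"
    unfolding simple_value_def by (intro sum.cong) auto
  with assms(2) show ?thesis by simp
qed

lemma partition_cases:
  fixes s :: real
  assumes "s \<in> {\<tau> 0<..\<tau> n}"
  shows "\<exists>i<n. s \<in> {\<tau> i<..\<tau> (Suc i)}"
  using assms
proof (induction n)
  case (Suc n)
  then show ?case
    by (cases "s \<le> \<tau> n") (auto simp: less_Suc_eq)
qed auto

lemma simple_value_power2:
  assumes "\<And>i. i < n \<Longrightarrow> \<tau> i \<le> \<tau> (Suc i)"
  shows "(simple_value n \<tau> \<xi> s \<omega>)\<^sup>2 = simple_value n \<tau> (\<lambda>i \<omega>. (\<xi> i \<omega>)\<^sup>2) s \<omega>"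
proof (cases "\<exists>i<n. s \<in> {\<tau> i<..\<tau> (Suc i)}")
  case True
  then show ?thesis using simple_value_eq[of n \<tau>] assms by metis
next
  case False
  then show ?thesis by (auto simp: simple_value_def sum.neutral)
qed

lemma simple_value_nn_integral:
  assumes \<tau>: "\<tau> 0 = 0" "\<tau> n = t" "\<And>i. i < n \<Longrightarrow> \<tau> i \<le> \<tau> (Suc i)"
  shows "(\<integral>\<^sup>+s\<in>{0..t}. ennreal ((simple_value n \<tau> \<xi> s \<omega>)\<^sup>2) \<partial>lborel) = ennreal (\<Sum>i<n. (\<xi> i \<omega>)\<^sup>2 * (\<tau> (Suc i) - \<tau> i))"
proof -
  have sub: "0 \<le> s \<and> s \<le> t" if "i < n" "\<tau> i < s" "s \<le> \<tau> (Suc i)" for i s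
    using partition_mono[of n \<tau> 0 i] partition_mono[of n \<tau> "Suc i" n] \<tau> that by auto
  have "(\<integral>\<^sup>+s\<in>{0..t}. ennreal ((simple_value n \<tau> \<xi> s \<omega>)\<^sup>2) \<partial>lborel)
    = (\<integral>\<^sup>+s. (\<Sum>i<n. ennreal ((\<xi> i \<omega>)\<^sup>2) * indicator {\<tau> i<..\<tau> (Suc i)} s) \<partial>lborel)"
  proof (rule nn_integral_cong)
    fix s
    have "ennreal ((simple_value n \<tau> \<xi> s \<omega>)\<^sup>2) * indicator {0..t} s = (\<Sum>i<n. ennreal ((\<xi> i \<omega>)\<^sup>2 * indicator {\<tau> i<..\<tau> (Suc i)} s)) * indicator {0..t} s"
    proof -
      have "(simple_value n \<tau> \<xi> s \<omega>)\<^sup>2 = (\<Sum>i<n. (\<xi> i \<omega>)\<^sup>2 * indicator {\<tau> i<..\<tau> (Suc i)} s)"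
        using simple_value_power2[of n \<tau> \<xi> s \<omega>] \<tau>(3) unfolding simple_value_def by blast
      also have "ennreal \<dots> = (\<Sum>i<n. ennreal ((\<xi> i \<omega>)\<^sup>2 * indicator {\<tau> i<..\<tau> (Suc i)} s))"
        by (rule sum_ennreal[symmetric]) auto
      finally show ?thesis by (rule arg_cong)
    qed
    also have "\<dots> = (\<Sum>i<n. ennreal ((\<xi> i \<omega>)\<^sup>2) * indicator {\<tau> i<..\<tau> (Suc i)} s)"
      unfolding sum_distrib_right
      by (rule sum.cong) (use sub in \<open>auto simp: ennreal_mult indicator_def\<close>)
    finally show "ennreal ((simple_value n \<tau> \<xi> s \<omega>)\<^sup>2) * indicator {0..t} s = \<dots>" .
  qed
  also have "\<dots> = (\<Sum>i<n. ennreal ((\<xi> i \<omega>)\<^sup>2) * emeasure lborel {\<tau> i<..\<tau> (Suc i)})"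
    by (subst nn_integral_sum) (auto simp: nn_integral_cmult_indicator)
  also have "\<dots> = (\<Sum>i<n. ennreal ((\<xi> i \<omega>)\<^sup>2 * (\<tau> (Suc i) - \<tau> i)))"
    by (rule sum.cong) (use \<tau> in \<open>auto simp: ennreal_mult\<close>)
  also have "\<dots> = ennreal (\<Sum>i<n. (\<xi> i \<omega>)\<^sup>2 * (\<tau> (Suc i) - \<tau> i))"
    by (rule sum_ennreal) (use \<tau> in auto)
  finally show ?thesis .
qed

section \<open>Refinement of partitions without changing the simple process\<close>

definition refine :: "nat \<Rightarrow> (nat \<Rightarrow> real) \<Rightarrow> nat \<Rightarrow> real" where
  "refine N \<tau> j = \<tau> (j div N) + (\<tau> (Suc (j div N)) - \<tau> (j div N)) * real (j mod N) / real N"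

text \<open>Index \<open>i * N + r\<close> stands for the \<open>r\<close>-th of \<open>N\<close>
  equal subdivision points of cell \<open>i\<close>. The case \<open>r = N\<close> is included:
  there the quotient jumps to \<open>i + 1\<close> and the formula of the next cell gives the same
  point.\<close>

lemma refine_within:
  assumes "0 < N" "r \<le> N"
  shows "refine N \<tau> (i * N + r) = \<tau> i + (\<tau> (Suc i) - \<tau> i) * real r / real N"
  using assms by (cases "r = N") (auto simp: refine_def div_mult_self3 div_add1_eq)

lemma refine:
  assumes "0 < N" "\<And>i. i < n \<Longrightarrow> \<tau> i \<le> \<tau> (Suc i)"
  shows "refine N \<tau> 0 = \<tau> 0" "refine N \<tau> (n * N) = \<tau> n"
    "j < n * N \<Longrightarrow> refine N \<tau> (Suc j) - refine N \<tau> j = (\<tau> (Suc (j div N)) - \<tau> (j div N)) / real N"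
    "j < n * N \<Longrightarrow> refine N \<tau> j \<le> refine N \<tau> (Suc j)"
    "j < n * N \<Longrightarrow> \<tau> (j div N) \<le> refine N \<tau> j"
proof -
  show "refine N \<tau> 0 = \<tau> 0" "refine N \<tau> (n * N) = \<tau> n"
    using assms(1) by (auto simp: refine_def)
  assume j: "j < n * N"
  define i r where "i = j div N" and "r = j mod N"
  have ir: "j = i * N + r" "r < N" "i < n"
    using assms(1) j by (auto simp: i_def r_def less_mult_imp_div_less)
  have 1: "refine N \<tau> j = \<tau> i + (\<tau> (Suc i) - \<tau> i) * real r / real N"
    "refine N \<tau> (Suc j) = \<tau> i + (\<tau> (Suc i) - \<tau> i) * real (Suc r) / real N"
    using refine_within[of N r \<tau> i] refine_within[of N "Suc r" \<tau> i] ir assms(1) by simp_all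
  show 2: "refine N \<tau> (Suc j) - refine N \<tau> j = (\<tau> (Suc (j div N)) - \<tau> (j div N)) / real N"
    unfolding 1 i_def[symmetric] using assms(1) by (simp add: field_simps)
  have "0 \<le> (\<tau> (Suc i) - \<tau> i) / real N" using assms(2)[OF ir(3)] by simp
  then show "refine N \<tau> j \<le> refine N \<tau> (Suc j)" using 2 i_def by simp
  show "\<tau> (j div N) \<le> refine N \<tau> j"
    unfolding 1 i_def[symmetric] using assms(2)[OF ir(3)] by simp
qed

lemma sum_refine:
  fixes f :: "nat \<Rightarrow> 'b::comm_ring_1"
  assumes N: "0 < N" and f: "\<And>i. i < n \<Longrightarrow> (\<Sum>j\<in>{i * N..<i * N + N}. f j) = g i"
  shows "(\<Sum>j<n * N. \<xi> (j div N) * f j) = (\<Sum>i<n. \<xi> i * g i)"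
proof -
  have "(\<Sum>j<n * N. \<xi> (j div N) * f j) = (\<Sum>i<n. \<Sum>j\<in>{i * N..<i * N + N}. \<xi> (j div N) * f j)"
    by (rule sum.nat_group[symmetric])
  also have "\<dots> = (\<Sum>i<n. \<xi> i * g i)"
  proof (rule sum.cong[OF refl])
    fix i assume "i \<in> {..<n}"
    have "(\<Sum>j\<in>{i * N..<i * N + N}. \<xi> (j div N) * f j) = (\<Sum>j\<in>{i * N..<i * N + N}. \<xi> i * f j)"
    proof (rule sum.cong[OF refl])
      fix j assume "j \<in> {i * N..<i * N + N}"
      then have "j div N = i" using N by (auto intro!: div_nat_eqI simp: algebra_simps)
      then show "\<xi> (j div N) * f j = \<xi> i * f j" by simp
    qed
    then show "(\<Sum>j\<in>{i * N..<i * N + N}. \<xi> (j div N) * f j) = \<xi> i * g i"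
      using f \<open>i \<in> {..<n}\<close> by (simp flip: sum_distrib_left)
  qed
  finally show ?thesis .
qed

text \<open>Within each old cell the coefficient is constant and the sum telescopes. The value at
  \<open>s\<close> has the same form as the integral once the indicator of \<open>{a<..b}\<close> at
  \<open>s\<close> is read as the increment from \<open>a\<close> to \<open>b\<close> of the
  indicator of \<open>{s..}\<close>, so one grouping argument serves both.\<close>

lemma simple_refine:
  assumes N: "0 < N" and \<tau>: "\<And>i. i < n \<Longrightarrow> \<tau> i \<le> \<tau> (Suc i)"
  shows "simple_value (n * N) (refine N \<tau>) (\<lambda>j. \<xi> (j div N)) s \<omega> = simple_value n \<tau> \<xi> s \<omega>"
    "simple_integral W (n * N) (refine N \<tau>) (\<lambda>j. \<xi> (j div N)) \<omega> = simple_integral W n \<tau> \<xi> \<omega>"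
proof -
  have end_points: "refine N \<tau> (i * N) = \<tau> i" "refine N \<tau> (i * N + N) = \<tau> (Suc i)" for i
    using refine_within[of N 0 \<tau> i] refine_within[of N N \<tau> i] N by auto
  have tele: "(\<Sum>j\<in>{i * N..<i * N + N}. f (refine N \<tau> (Suc j)) - f (refine N \<tau> j)) = f (\<tau> (Suc i)) - f (\<tau> i)"
    for i and f :: "real \<Rightarrow> real"
    using sum_Suc_diff'[of "i * N" "i * N + N" "\<lambda>j. f (refine N \<tau> j)"] end_points by simp
  show "simple_integral W (n * N) (refine N \<tau>) (\<lambda>j. \<xi> (j div N)) \<omega> = simple_integral W n \<tau> \<xi> \<omega>"
    unfolding simple_integral_def
    using sum_refine[OF N tele[of "\<lambda>r. W r \<omega>"], where n=n and \<xi>="\<lambda>i. \<xi> i \<omega>"] by simp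
  have ind: "indicator {a<..b} s = indicator {s..} b - (indicator {s..} a :: real)" if "a \<le> b" for a b
    using that by (auto simp: indicator_def)
  have "(\<Sum>j<n * N. \<xi> (j div N) \<omega> * indicator {refine N \<tau> j<..refine N \<tau> (Suc j)} s)
    = (\<Sum>j<n * N. \<xi> (j div N) \<omega> * (indicator {s..} (refine N \<tau> (Suc j)) - indicator {s..} (refine N \<tau> j)))"
    by (rule sum.cong) (use refine(4)[of N n \<tau>, OF N \<tau>] ind in auto)
  also have "\<dots> = (\<Sum>i<n. \<xi> i \<omega> * (indicator {s..} (\<tau> (Suc i)) - indicator {s..} (\<tau> i)))"
    using sum_refine[OF N tele[of "indicator {s..}"], where n=n and \<xi>="\<lambda>i. \<xi> i \<omega>"] by simp
  also have "\<dots> = (\<Sum>i<n. \<xi> i \<omega> * indicator {\<tau> i<..\<tau> (Suc i)} s)"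
    by (rule sum.cong) (use \<tau> ind in auto)
  finally show "simple_value (n * N) (refine N \<tau>) (\<lambda>j. \<xi> (j div N)) s \<omega> = simple_value n \<tau> \<xi> s \<omega>"
    by (simp add: simple_value_def)
qed

text \<open>By uniform continuity the step function is within \<open>c\<close> of \<open>H\<close>
  once the mesh is small, and \<open>c\<close> is chosen with \<open>c^2 t \<le> e\<close>.\<close>

lemma left_endpoint_sums_converge:
  fixes H :: "real \<Rightarrow> real"
  assumes "0 \<le> t" and H: "continuous_on {0..t} H"
    and \<tau>: "\<And>k. \<tau> k 0 = 0" "\<And>k. \<tau> k (n k) = t" "\<And>k i. i < n k \<Longrightarrow> \<tau> k i \<le> \<tau> k (Suc i)"
    and mesh: "\<And>k i. i < n k \<Longrightarrow> \<tau> k (Suc i) - \<tau> k i \<le> h k" and h: "h \<longlonglongrightarrow> 0"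
    and "0 < e"
  shows "\<forall>\<^sub>F k in sequentially.
    (\<integral>\<^sup>+s\<in>{0..t}. ennreal ((simple_value (n k) (\<tau> k) (\<lambda>i \<omega>. H (\<tau> k i)) s \<omega> - H s)\<^sup>2) \<partial>lborel) \<le> ennreal e"
proof -
  define c where "c = sqrt (e / (t + 1))"
  have c: "0 < c" "c\<^sup>2 * t \<le> e"
    using assms(1,8) by (auto simp: c_def field_simps)
  have "uniformly_continuous_on {0..t} H"
    by (intro compact_uniformly_continuous H compact_Icc)
  then obtain d where d: "0 < d" "\<And>x y. x \<in> {0..t} \<Longrightarrow> y \<in> {0..t} \<Longrightarrow> dist y x < d \<Longrightarrow> dist (H y) (H x) < c"
    unfolding uniformly_continuous_on_def using c(1) by metis
  from order_tendstoD(2)[OF h d(1)] show ?thesis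
  proof eventually_elim
    case (elim k)
    let ?v = "\<lambda>s. simple_value (n k) (\<tau> k) (\<lambda>i \<omega>. H (\<tau> k i)) s \<omega> - H s"
    have bound: "(?v s)\<^sup>2 \<le> c\<^sup>2" if "s \<in> {0<..t}" for s
    proof -
      have "s \<in> {\<tau> k 0<..\<tau> k (n k)}" using \<tau>(1,2) that by simp
      from partition_cases[OF this] obtain i where i: "i < n k" "s \<in> {\<tau> k i<..\<tau> k (Suc i)}"
        by blast
      have "0 \<le> \<tau> k i" using partition_mono[of "n k" "\<tau> k" 0 i] \<tau> i by auto
      then have "\<bar>H (\<tau> k i) - H s\<bar> < c"
        using d(2)[of s "\<tau> k i"] i mesh[OF i(1)] that elim by (auto simp: dist_real_def)
      moreover have "?v s = H (\<tau> k i) - H s"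
        using simple_value_eq[OF \<tau>(3) i] by simp
      ultimately show ?thesis
        using c(1) by (simp add: abs_le_square_iff[symmetric])
    qed
    have "(\<integral>\<^sup>+s\<in>{0..t}. ennreal ((?v s)\<^sup>2) \<partial>lborel) \<le> (\<integral>\<^sup>+s. ennreal (c\<^sup>2) * indicator {0..t} s \<partial>lborel)"
    proof (rule nn_integral_mono_AE)
      \<comment> \<open>The half-open cells miss the point 0, where the simple process takes the
        value 0 and not \<open>H 0\<close>.\<close>
      have "AE s in lborel. s \<noteq> 0" by (rule AE_lborel_singleton)
      then show "AE s in lborel. ennreal ((?v s)\<^sup>2) * indicator {0..t} s \<le> ennreal (c\<^sup>2) * indicator {0..t} s"
        by eventually_elim (use bound in \<open>auto simp: indicator_def\<close>)
    qed
    also have "\<dots> = ennreal (c\<^sup>2 * t)"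
      using assms(1) by (simp add: nn_integral_cmult_indicator ennreal_mult)
    finally show ?case
      using c(2) by (meson ennreal_leI order_trans)
  qed
qed

section \<open>Almost sure limits and limits in probability\<close>

lemma (in prob_space) tends_to_zero_in_probI:
  assumes "AE \<omega> in M. \<forall>e>0. \<forall>\<^sub>F k in sequentially. X k \<omega> \<le> ennreal e"
  shows "tends_to_zero_in_prob M X"
  unfolding tends_to_zero_in_prob_def
proof (intro allI impI)
  fix \<epsilon> :: real assume "0 < \<epsilon>"
  text \<open>\<open>X k\<close> need not be measurable, but non-measurable sets have measure zero by convention.\<close>
  define A where "A k = (let B = {\<omega>\<in>space M. ennreal \<epsilon> < X k \<omega>} in if B \<in> sets M then B else {})" for k
  have A: "A k \<in> sets M" "measure M {\<omega>\<in>space M. ennreal \<epsilon> < X k \<omega>} = prob (A k)" for k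
    by (auto simp: A_def Let_def measure_notin_sets)
  have "AE \<omega> in M. (\<lambda>k. indicator (A k) \<omega> :: real) \<longlonglongrightarrow> 0"
    using assms
  proof eventually_elim
    case (elim \<omega>)
    then have "\<forall>\<^sub>F k in sequentially. X k \<omega> \<le> ennreal \<epsilon>" using \<open>0 < \<epsilon>\<close> by blast
    then have "\<forall>\<^sub>F k in sequentially. indicator (A k) \<omega> = (0 :: real)"
      by eventually_elim (auto simp: A_def Let_def indicator_def)
    then show ?case by (rule tendsto_eventually)
  qed
  then have "(\<lambda>k. \<integral>\<omega>. indicator (A k) \<omega> \<partial>M) \<longlonglongrightarrow> (\<integral>\<omega>. 0 \<partial>M :: real)"
    by (intro integral_dominated_convergence[where w="\<lambda>_. 1"]) (use A in \<open>auto simp: indicator_def\<close>)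
  then show "(\<lambda>k. measure M {\<omega>\<in>space M. ennreal \<epsilon> < X k \<omega>}) \<longlonglongrightarrow> 0"
    unfolding A(2) using A(1) by simp
qed

text \<open>A positive limit forces \<open>X k\<close> above some \<open>1 / (m + 1)\<close> for all
  \<open>k\<close> from some \<open>n\<close> on. The probability of that event is at most that of
  every later single event, and these tend to 0; countably many pairs \<open>m\<close>,
  \<open>n\<close> suffice. It serves to identify a limit in probability with an almost sure
  one.\<close>

lemma (in prob_space) limit_in_prob_nonpos:
  assumes [measurable]: "\<And>k. X k \<in> borel_measurable M"
    and zero: "\<And>\<epsilon>. 0 < \<epsilon> \<Longrightarrow> (\<lambda>k. prob {\<omega>\<in>space M. \<epsilon> < X k \<omega>}) \<longlonglongrightarrow> 0"
    and lim: "AE \<omega> in M. (\<lambda>k. X k \<omega>) \<longlonglongrightarrow> (x \<omega> :: real)"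
  shows "AE \<omega> in M. x \<omega> \<le> 0"
proof -
  have "AE \<omega> in M. \<not> (\<forall>k\<ge>n. \<epsilon> < X k \<omega>)" if "0 < \<epsilon>" for \<epsilon> n
  proof -
    have "prob {\<omega>\<in>space M. \<forall>k\<ge>n. \<epsilon> < X k \<omega>} \<le> 0"
    proof (rule LIMSEQ_le_const[OF zero[OF that]], intro exI allI impI)
      fix k assume "n \<le> k"
      then show "prob {\<omega>\<in>space M. \<forall>k\<ge>n. \<epsilon> < X k \<omega>} \<le> prob {\<omega>\<in>space M. \<epsilon> < X k \<omega>}"
        by (intro finite_measure_mono) auto
    qed
    then have "emeasure M {\<omega>\<in>space M. \<forall>k\<ge>n. \<epsilon> < X k \<omega>} = 0"
      by (simp add: emeasure_eq_measure measure_le_0_iff)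
    then show ?thesis by (subst AE_iff_measurable[OF _ refl]) auto
  qed
  then have "AE \<omega> in M. \<forall>m n. \<not> (\<forall>k\<ge>n. 1 / real (Suc m) < X k \<omega>)"
    by (auto simp: AE_all_countable)
  with lim show ?thesis
  proof eventually_elim
    case (elim \<omega>)
    show ?case
    proof (rule ccontr)
      assume "\<not> x \<omega> \<le> 0"
      then obtain m where "1 / real (Suc m) < x \<omega>"
        using reals_Archimedean[of "x \<omega>"] by (auto simp: field_simps)
      from order_tendstoD(1)[OF elim(1) this] elim(2) show False
        by (auto simp: eventually_sequentially)
    qed
  qed
qed

context wiener_process
begin

section \<open>Tail estimates for integrals of simple processes\<close>

lemma simple_integral_measurable:
  assumes "simple_process M F t n \<tau> \<xi>"
  shows "simple_integral W n \<tau> \<xi> \<in> borel_measurable M"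
    "(\<lambda>\<omega>. \<Sum>i<n. (\<xi> i \<omega>)\<^sup>2 * (\<tau> (Suc i) - \<tau> i)) \<in> borel_measurable M"
proof -
  have [measurable]: "\<xi> i \<in> borel_measurable M" "W (\<tau> i) \<in> borel_measurable M" "W (\<tau> (Suc i)) \<in> borel_measurable M"
    if "i \<in> {..<n}" for i
    using assms that partition_mono[of n \<tau> 0 i] partition_mono[of n \<tau> 0 "Suc i"]
    by (auto simp: simple_process_def intro!: W_measurable intro: measurable_F_M)
  show "simple_integral W n \<tau> \<xi> \<in> borel_measurable M"
    unfolding simple_integral_def by measurable
  show "(\<lambda>\<omega>. \<Sum>i<n. (\<xi> i \<omega>)\<^sup>2 * (\<tau> (Suc i) - \<tau> i)) \<in> borel_measurable M"
    by measurable
qed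

text \<open>Chernoff bound with the exponential martingale of the integral: on the event in question
  its value is at least \<open>exp (l \<epsilon> - l^2 \<delta> / 2)\<close>, while its mean is
  1.\<close>

lemma simple_integral_upper_tail:
  assumes S: "simple_process M F t n \<tau> \<xi>" and "0 < \<epsilon>" "0 < \<delta>"
  shows "prob {\<omega>\<in>space M. \<epsilon> < simple_integral W n \<tau> \<xi> \<omega> \<and> (\<Sum>i<n. (\<xi> i \<omega>)\<^sup>2 * (\<tau> (Suc i) - \<tau> i)) \<le> \<delta>}
    \<le> exp (- (\<epsilon>\<^sup>2 / (2 * \<delta>)))"
proof -
  \<comment> \<open>This choice maximises \<open>l \<epsilon> - l^2 \<delta> / 2\<close>, with
    maximum \<open>\<epsilon>^2 / (2 \<delta>)\<close>.\<close>
  define l where "l = \<epsilon> / \<delta>"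
  have l: "0 < l" using assms by (simp add: l_def)
  let ?Q = "\<lambda>\<omega>. \<Sum>i<n. (\<xi> i \<omega>)\<^sup>2 * (\<tau> (Suc i) - \<tau> i)"
  let ?S = "simple_integral W n \<tau> \<xi>"
  let ?A = "{\<omega>\<in>space M. \<epsilon> < ?S \<omega> \<and> ?Q \<omega> \<le> \<delta>}"
  note [measurable] = simple_integral_measurable[OF S]
  have \<tau>: "\<tau> 0 = 0" "\<tau> n = t" "\<And>i. i < n \<Longrightarrow> \<tau> i \<le> \<tau> (Suc i)" "\<And>i. i < n \<Longrightarrow> \<xi> i \<in> borel_measurable (F (\<tau> i))"
    using S by (auto simp: simple_process_def)
  have "(\<integral>\<^sup>+\<omega>. ennreal (exp (\<Sum>i<n. gauss_exponent (l * \<xi> i \<omega>) 0 (\<tau> (Suc i) - \<tau> i) (W (\<tau> (Suc i)) \<omega> - W (\<tau> i) \<omega>))) \<partial>M) = 1"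
    by (rule gauss_exponent_expectation[where b="\<lambda>_. 0"]) (use \<tau> in auto)
  moreover have "(\<Sum>i<n. gauss_exponent (l * \<xi> i \<omega>) 0 (\<tau> (Suc i) - \<tau> i) (W (\<tau> (Suc i)) \<omega> - W (\<tau> i) \<omega>))
      = l * ?S \<omega> - l\<^sup>2 * ?Q \<omega> / 2" for \<omega>
    unfolding gauss_exponent_def simple_integral_def
    by (simp add: sum_subtractf sum_distrib_left sum_divide_distrib power_mult_distrib mult_ac)
  ultimately have E: "(\<integral>\<^sup>+\<omega>. ennreal (exp (l * ?S \<omega> - l\<^sup>2 * ?Q \<omega> / 2)) \<partial>M) = 1"
    by simp
  have "ennreal (prob ?A) = (\<integral>\<^sup>+\<omega>. indicator ?A \<omega> \<partial>M)"
    by (simp add: emeasure_eq_measure)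
  also have "\<dots> \<le> (\<integral>\<^sup>+\<omega>. ennreal (exp (- (\<epsilon>\<^sup>2 / (2 * \<delta>)))) * ennreal (exp (l * ?S \<omega> - l\<^sup>2 * ?Q \<omega> / 2)) \<partial>M)"
  proof (rule nn_integral_mono)
    fix \<omega>
    show "indicator ?A \<omega> \<le> ennreal (exp (- (\<epsilon>\<^sup>2 / (2 * \<delta>)))) * ennreal (exp (l * ?S \<omega> - l\<^sup>2 * ?Q \<omega> / 2))"
    proof (cases "\<omega> \<in> ?A")
      case True
      have "l * \<epsilon> \<le> l * ?S \<omega>" "l\<^sup>2 * ?Q \<omega> \<le> l\<^sup>2 * \<delta>"
        using True l by (auto intro!: mult_left_mono)
      moreover have "l * \<epsilon> - l\<^sup>2 * \<delta> / 2 = \<epsilon>\<^sup>2 / (2 * \<delta>)"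
        using assms by (simp add: l_def field_simps power2_eq_square)
      ultimately have "0 \<le> - (\<epsilon>\<^sup>2 / (2 * \<delta>)) + (l * ?S \<omega> - l\<^sup>2 * ?Q \<omega> / 2)" by linarith
      then have "1 \<le> exp (- (\<epsilon>\<^sup>2 / (2 * \<delta>))) * exp (l * ?S \<omega> - l\<^sup>2 * ?Q \<omega> / 2)"
        unfolding exp_add[symmetric] by simp
      then show ?thesis using True by (simp flip: ennreal_mult')
    qed simp
  qed
  also have "\<dots> = ennreal (exp (- (\<epsilon>\<^sup>2 / (2 * \<delta>))))"
    by (subst nn_integral_cmult) (auto simp: E)
  finally show ?thesis by simp
qed

text \<open>The one-sided bound is applied to the process and to its negative. The estimate plays
  the part of the Ito isometry for integrands whose squared norm is small only in
  probability.\<close>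

lemma simple_integral_tail:
  assumes S: "simple_process M F t n \<tau> \<xi>" and "0 < \<epsilon>" "0 < \<delta>"
  shows "prob {\<omega>\<in>space M. \<epsilon> < \<bar>simple_integral W n \<tau> \<xi> \<omega>\<bar>}
    \<le> 2 * exp (- (\<epsilon>\<^sup>2 / (2 * \<delta>))) + prob {\<omega>\<in>space M. \<delta> < (\<Sum>i<n. (\<xi> i \<omega>)\<^sup>2 * (\<tau> (Suc i) - \<tau> i))}"
proof -
  let ?Q = "\<lambda>\<omega>. \<Sum>i<n. (\<xi> i \<omega>)\<^sup>2 * (\<tau> (Suc i) - \<tau> i)"
  have S': "simple_process M F t n \<tau> (\<lambda>i \<omega>. - \<xi> i \<omega>)"
    using S by (auto simp: simple_process_def)
  note [measurable] = simple_integral_measurable[OF S]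
  have neg: "simple_integral W n \<tau> (\<lambda>i \<omega>. - \<xi> i \<omega>) \<omega> = - simple_integral W n \<tau> \<xi> \<omega>" for \<omega>
    by (simp add: simple_integral_def sum_negf)
  let ?A = "{\<omega>\<in>space M. \<epsilon> < simple_integral W n \<tau> \<xi> \<omega> \<and> ?Q \<omega> \<le> \<delta>}"
  let ?B = "{\<omega>\<in>space M. \<epsilon> < - simple_integral W n \<tau> \<xi> \<omega> \<and> ?Q \<omega> \<le> \<delta>}"
  let ?C = "{\<omega>\<in>space M. \<delta> < ?Q \<omega>}"
  have "prob {\<omega>\<in>space M. \<epsilon> < \<bar>simple_integral W n \<tau> \<xi> \<omega>\<bar>} \<le> prob (?A \<union> ?B \<union> ?C)"
    by (intro finite_measure_mono) auto
  also have "\<dots> \<le> prob ?A + prob ?B + prob ?C"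
    using measure_Un_le[of "?A \<union> ?B" M ?C] measure_Un_le[of ?A M ?B] by force
  also have "prob ?A \<le> exp (- (\<epsilon>\<^sup>2 / (2 * \<delta>)))"
    by (rule simple_integral_upper_tail[OF assms])
  also have "prob ?B \<le> exp (- (\<epsilon>\<^sup>2 / (2 * \<delta>)))"
    using simple_integral_upper_tail[OF S' assms(2,3)] by (simp add: neg)
  finally show ?thesis by simp
qed

text \<open>The path is approximated by its values at \<open>floor (s (k + 1)) / (k + 1)\<close>.
  Each approximation glues countably many functions that depend on the second coordinate alone, and
  continuity gives the limit.\<close>

lemma progressive_upto_continuous:
  assumes H: "\<And>s. 0 \<le> s \<Longrightarrow> H s \<in> borel_measurable (F s)"
    and cont: "\<And>\<omega>. \<omega> \<in> space M \<Longrightarrow> continuous_on {0..} (\<lambda>s. H s \<omega>)"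
  shows "progressive_upto F t H"
  unfolding progressive_upto_def
proof
  fix T assume T: "T \<in> {0..t}"
  let ?N = "restrict_space borel {0..T} \<Otimes>\<^sub>M F T"
  \<comment> \<open>Clamping to \<open>{0..T}\<close> makes \<open>H (u k i)\<close> measurable for
    \<open>F T\<close> for every integer \<open>i\<close>, as countable gluing demands.\<close>
  define u where "u k i = max 0 (min T (real_of_int i / real (Suc k)))" for k :: nat and i :: int
  have u: "u k i \<in> {0..T}" for k i using T by (auto simp: u_def)
  show "(\<lambda>(s, \<omega>). H s \<omega>) \<in> borel_measurable ?N"
  proof (rule borel_measurable_LIMSEQ_real)
    fix x assume "x \<in> space ?N"
    then obtain s \<omega> where x: "x = (s, \<omega>)" "s \<in> {0..T}" "\<omega> \<in> space M"
      by (auto simp: space_pair_measure space_F space_restrict_space)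
    have "(\<lambda>k. u k \<lfloor>s * real (Suc k)\<rfloor>) \<longlonglongrightarrow> s"
    proof (rule LIMSEQ_I)
      fix r :: real assume "0 < r"
      from order_tendstoD(2)[OF mesh_tendsto[of 1] this]
      obtain N where N: "\<And>k. N \<le> k \<Longrightarrow> 1 / real (Suc k) < r"
        by (auto simp: eventually_sequentially)
      have "norm (u k \<lfloor>s * real (Suc k)\<rfloor> - s) < r" if "N \<le> k" for k
      proof -
        let ?K = "real (Suc k)"
        have K: "s - 1 / ?K = (s * ?K - 1) / ?K" "s = s * ?K / ?K"
          by (auto simp: field_simps)
        have "s - 1 / ?K \<le> real_of_int \<lfloor>s * ?K\<rfloor> / ?K"
          unfolding K(1) using real_of_int_floor_gt_diff_one[of "s * ?K"] by (intro divide_right_mono) auto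
        moreover have "real_of_int \<lfloor>s * ?K\<rfloor> / ?K \<le> s"
          by (subst (2) K(2), intro divide_right_mono) auto
        ultimately show ?thesis
          using x(2) N[OF that] unfolding u_def by (auto simp: abs_less_iff max_def min_def)
      qed
      then show "\<exists>N. \<forall>k\<ge>N. norm (u k \<lfloor>s * real (Suc k)\<rfloor> - s) < r" by blast
    qed
    then show "(\<lambda>k. case x of (s, \<omega>) \<Rightarrow> H (u k \<lfloor>s * real (Suc k)\<rfloor>) \<omega>) \<longlonglongrightarrow> (case x of (s, \<omega>) \<Rightarrow> H s \<omega>)"
      unfolding x using continuous_on_tendsto_compose[OF cont[OF x(3)], of "\<lambda>k. u k \<lfloor>s * real (Suc k)\<rfloor>" s] u x(2) by auto
  next
    fix k
    have fl: "(\<lambda>x. \<lfloor>fst x * real (Suc k)\<rfloor>) \<in> ?N \<rightarrow>\<^sub>M count_space UNIV"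
    proof -
      have [measurable]: "(\<lambda>s. s) \<in> borel_measurable (restrict_space borel {0..T})"
        by (rule measurable_restrict_space1) simp
      have [measurable]: "fst \<in> borel_measurable ?N"
        using measurable_compose[OF measurable_fst, of "\<lambda>s. s" "restrict_space borel {0..T}" borel "F T"] by simp
      show ?thesis by measurable
    qed
    have "(\<lambda>x. (\<lambda>i x. H (u k i) (snd x)) \<lfloor>fst x * real (Suc k)\<rfloor> x) \<in> borel_measurable ?N"
    proof (rule measurable_compose_countable[OF _ fl])
      fix i
      show "(\<lambda>x. H (u k i) (snd x)) \<in> borel_measurable ?N"
        by (rule measurable_compose[OF measurable_snd]) (use measurable_F_mono[OF H, of "u k i" T] u[of k i] in auto)
    qed
    then show "(\<lambda>(s, \<omega>). H (u k \<lfloor>s * real (Suc k)\<rfloor>) \<omega>) \<in> borel_measurable ?N"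
      by (simp add: case_prod_beta')
  qed
qed

text \<open>Progressive measurability makes the integrand jointly measurable, so Tonelli applies.
  Probabilities of events about this distance can then be compared by monotonicity and union
  bounds.\<close>

lemma L2_distance_measurable:
  assumes S: "simple_process M F t n \<tau> \<xi>" and H: "progressive_upto F t H" and "0 \<le> t"
  shows "(\<lambda>\<omega>. \<integral>\<^sup>+s\<in>{0..t}. ennreal ((simple_value n \<tau> \<xi> s \<omega> - H s \<omega>)\<^sup>2) \<partial>lborel) \<in> borel_measurable M"
proof -
  let ?L = "restrict_space lborel {0..t}"
  interpret L: sigma_finite_measure ?L
    by (rule sigma_finite_measure_restrict_space) (auto intro: lborel.sigma_finite_measure_axioms)
  have sets_L: "sets ?L = sets (restrict_space borel {0..t})"
    by (auto simp: sets_restrict_space)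
  have "(\<lambda>(s, \<omega>). H s \<omega>) \<in> borel_measurable (restrict_space borel {0..t} \<Otimes>\<^sub>M F t)"
    using H \<open>0 \<le> t\<close> by (simp add: progressive_upto_def)
  then have [measurable]: "(\<lambda>x. H (fst x) (snd x)) \<in> borel_measurable (?L \<Otimes>\<^sub>M F t)"
    by (subst measurable_cong_sets[OF sets_pair_measure_cong[OF sets_L refl] refl]) (simp add: case_prod_beta')
  have \<xi>[measurable]: "\<xi> i \<in> borel_measurable (F t)" if "i \<in> {..<n}" for i
    using S that partition_mono[of n \<tau> i n] measurable_F_mono[of "\<xi> i" "\<tau> i" borel t] by (auto simp: simple_process_def)
  have [measurable]: "(\<lambda>s. s) \<in> borel_measurable ?L"
    by (rule measurable_restrict_space1) simp
  have [measurable]: "fst \<in> borel_measurable (?L \<Otimes>\<^sub>M F t)"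
    using measurable_compose[OF measurable_fst, of "\<lambda>s. s" ?L borel "F t"] by simp
  have [measurable]: "(\<lambda>x. simple_value n \<tau> \<xi> (fst x) (snd x)) \<in> borel_measurable (?L \<Otimes>\<^sub>M F t)"
    unfolding simple_value_def by measurable
  have "(\<lambda>x. ennreal ((simple_value n \<tau> \<xi> (fst x) (snd x) - H (fst x) (snd x))\<^sup>2)) \<in> borel_measurable (?L \<Otimes>\<^sub>M F t)"
    by measurable
  from measurable_compose[OF measurable_pair_swap' this]
  have "(\<lambda>(\<omega>, s). ennreal ((simple_value n \<tau> \<xi> s \<omega> - H s \<omega>)\<^sup>2)) \<in> borel_measurable (F t \<Otimes>\<^sub>M ?L)"
    by (simp add: case_prod_beta')
  from L.borel_measurable_nn_integral[OF this]
  have "(\<lambda>\<omega>. \<integral>\<^sup>+s. ennreal ((simple_value n \<tau> \<xi> s \<omega> - H s \<omega>)\<^sup>2) \<partial>?L) \<in> borel_measurable (F t)" .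
  then show ?thesis
    by (subst (asm) nn_integral_restrict_space) (auto intro: measurable_F_M)
qed

text \<open>Refining the partition of an arbitrary approximating simple process so that its mesh tends to
  zero makes it comparable, on a common partition, with the left endpoint sums of the integrand.\<close>

lemma ito_integral_C1_unique:
  assumes I: "has_ito_integral M F W H t I" and "0 \<le> t"
    and H: "\<And>s. 0 \<le> s \<Longrightarrow> H s \<in> borel_measurable (F s)"
    and C: "\<And>s \<omega>. 0 \<le> s \<Longrightarrow> \<omega> \<in> space M \<Longrightarrow> \<bar>H s \<omega>\<bar> \<le> C"
    and cont: "\<And>\<omega>. \<omega> \<in> space M \<Longrightarrow> continuous_on {0..} (\<lambda>s. H s \<omega>)"
    and H': "AE \<omega> in M. (\<forall>s\<in>{0..t}. ((\<lambda>s. H s \<omega>) has_real_derivative H' s \<omega>) (at s within {0..t}))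
        \<and> continuous_on {0..t} (\<lambda>s. H' s \<omega>)"
  shows "AE \<omega> in M. I \<omega> = H t \<omega> * W t \<omega> - H 0 \<omega> * W 0 \<omega> - integral {0..t} (\<lambda>s. H' s \<omega> * W s \<omega>)"
proof -
  let ?J = "\<lambda>\<omega>. H t \<omega> * W t \<omega> - H 0 \<omega> * W 0 \<omega> - integral {0..t} (\<lambda>s. H' s \<omega> * W s \<omega>)"
  from I obtain n \<tau> \<xi> where prog: "progressive_upto F t H" and I_meas[measurable]: "I \<in> borel_measurable M"
    and G: "\<And>k. simple_process M F t (n k) (\<tau> k) (\<xi> k)"
    and G_L2: "tends_to_zero_in_prob M (\<lambda>k \<omega>.
          \<integral>\<^sup>+ s\<in>{0..t}. ennreal ((simple_value (n k) (\<tau> k) (\<xi> k) s \<omega> - H s \<omega>)\<^sup>2) \<partial>lborel)"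
    and G_int: "tends_to_zero_in_prob M (\<lambda>k \<omega>. ennreal \<bar>simple_integral W (n k) (\<tau> k) (\<xi> k) \<omega> - I \<omega>\<bar>)"
    unfolding has_ito_integral_def by blast
  have \<tau>: "\<tau> k 0 = 0" "\<tau> k (n k) = t" "\<And>i. i < n k \<Longrightarrow> \<tau> k i \<le> \<tau> k (Suc i)"
    "\<And>i. i < n k \<Longrightarrow> \<xi> k i \<in> borel_measurable (F (\<tau> k i))" for k
    using G[of k] by (auto simp: simple_process_def)
  have bnd: "\<exists>B. \<forall>i<n k. \<forall>\<omega>\<in>space M. \<bar>\<xi> k i \<omega>\<bar> \<le> B" for k
    using G[of k] by (auto simp: simple_process_def)
  \<comment> \<open>Cutting every cell of the \<open>k\<close>-th partition into
    \<open>k + 1\<close> parts makes the mesh at most \<open>t / (k + 1)\<close>, whatever the given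
    partition was.\<close>
  define \<sigma> where "\<sigma> k = refine (Suc k) (\<tau> k)" for k
  define N where "N k = n k * Suc k" for k
  define \<eta> where "\<eta> k j = \<xi> k (j div Suc k)" for k j
  define \<rho> where "\<rho> k j = H (\<sigma> k j)" for k j
  \<comment> \<open>On the common partition the difference between the given process and the left
    endpoint process is again simple, so its integral is subject to the tail estimate.\<close>
  define \<Delta> where "\<Delta> k j = (\<lambda>\<omega>. \<eta> k j \<omega> - \<rho> k j \<omega>)" for k j
  note ref = refine[of "Suc k" "n k" "\<tau> k" for k, OF _ \<tau>(3), simplified, folded \<sigma>_def]
  have \<sigma>: "\<sigma> k 0 = 0" "\<sigma> k (N k) = t" "\<And>j. j < N k \<Longrightarrow> \<sigma> k j \<le> \<sigma> k (Suc j)" for k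
    using ref[of k] \<tau>[of k] by (auto simp: N_def)
  have div: "j div Suc k < n k" if "j < N k" for k j
    using that unfolding N_def by (rule less_mult_imp_div_less)
  have mesh: "\<sigma> k (Suc j) - \<sigma> k j \<le> t / real (Suc k)" if "j < N k" for k j
  proof -
    have "0 \<le> \<tau> k (j div Suc k)" "\<tau> k (Suc (j div Suc k)) \<le> t"
      using partition_mono[of "n k" "\<tau> k" 0 "j div Suc k"] partition_mono[of "n k" "\<tau> k" "Suc (j div Suc k)" "n k"]
        \<tau>(1,2,3) div[OF that] by auto
    then show ?thesis
      using ref(3)[of k j] that by (simp add: N_def divide_right_mono)
  qed
  have \<sigma>_nonneg: "0 \<le> \<sigma> k j" if "j \<le> N k" for k j
    using partition_mono[of "N k" "\<sigma> k" 0 j] \<sigma>(1,3) that by auto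
  have \<eta>: "\<eta> k j \<in> borel_measurable (F (\<sigma> k j))" if "j < N k" for k j
    unfolding \<eta>_def using measurable_F_mono[OF \<tau>(4)[OF div[OF that]]] ref(5)[of k j] that by (simp add: N_def)
  have \<rho>: "\<rho> k j \<in> borel_measurable (F (\<sigma> k j))" if "j < N k" for k j
    unfolding \<rho>_def using H \<sigma>_nonneg[of j k] that by simp
  have R: "simple_process M F t (N k) (\<sigma> k) (\<rho> k)" for k
    unfolding simple_process_def using \<sigma> \<rho>[of _ k] C \<sigma>_nonneg[of _ k] by (auto simp: \<rho>_def intro!: exI[of _ C])
  have D: "simple_process M F t (N k) (\<sigma> k) (\<Delta> k)" for k
  proof -
    obtain B where B: "\<And>i \<omega>. i < n k \<Longrightarrow> \<omega> \<in> space M \<Longrightarrow> \<bar>\<xi> k i \<omega>\<bar> \<le> B"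
      using bnd[of k] by blast
    have "\<bar>\<Delta> k j \<omega>\<bar> \<le> B + C" if "j < N k" "\<omega> \<in> space M" for j \<omega>
      using B[OF div[OF that(1)] that(2)] C[OF \<sigma>_nonneg[of j k] that(2)] that(1)
      by (simp add: \<Delta>_def \<eta>_def \<rho>_def)
    then show ?thesis
      unfolding simple_process_def using \<sigma> \<eta>[of _ k] \<rho>[of _ k] by (auto simp: \<Delta>_def)
  qed
  have G_value: "simple_value (N k) (\<sigma> k) (\<eta> k) s \<omega> = simple_value (n k) (\<tau> k) (\<xi> k) s \<omega>"
    and G_integral: "simple_integral W (N k) (\<sigma> k) (\<eta> k) \<omega> = simple_integral W (n k) (\<tau> k) (\<xi> k) \<omega>" for k s \<omega>
    unfolding N_def \<sigma>_def \<eta>_def by (rule simple_refine; use \<tau>(3) in simp)+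
  have D_value: "simple_value (N k) (\<sigma> k) (\<Delta> k) s \<omega> = simple_value (n k) (\<tau> k) (\<xi> k) s \<omega> - simple_value (N k) (\<sigma> k) (\<rho> k) s \<omega>"
    and D_integral: "simple_integral W (N k) (\<sigma> k) (\<Delta> k) \<omega> = simple_integral W (n k) (\<tau> k) (\<xi> k) \<omega> - simple_integral W (N k) (\<sigma> k) (\<rho> k) \<omega>" for k s \<omega>
    unfolding G_value[symmetric] G_integral[symmetric]
    by (simp_all add: simple_value_def simple_integral_def \<Delta>_def left_diff_distrib sum_subtractf)
  define A where "A k \<omega> = (\<integral>\<^sup>+ s\<in>{0..t}. ennreal ((simple_value (n k) (\<tau> k) (\<xi> k) s \<omega> - H s \<omega>)\<^sup>2) \<partial>lborel)" for k \<omega>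
  define B where "B k \<omega> = (\<integral>\<^sup>+ s\<in>{0..t}. ennreal ((simple_value (N k) (\<sigma> k) (\<rho> k) s \<omega> - H s \<omega>)\<^sup>2) \<partial>lborel)" for k \<omega>
  define Q where "Q k \<omega> = (\<Sum>j<N k. (\<Delta> k j \<omega>)\<^sup>2 * (\<sigma> k (Suc j) - \<sigma> k j))" for k \<omega>
  have [measurable]: "A k \<in> borel_measurable M" "B k \<in> borel_measurable M" for k
    unfolding A_def B_def by (rule L2_distance_measurable[OF _ prog \<open>0 \<le> t\<close>], rule G R)+
  have [measurable]: "Q k \<in> borel_measurable M" "simple_integral W (N k) (\<sigma> k) (\<rho> k) \<in> borel_measurable M"
    "simple_integral W (n k) (\<tau> k) (\<xi> k) \<in> borel_measurable M" for k
    unfolding Q_def by (rule simple_integral_measurable, rule R G D)+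
  have Q_le: "ennreal (Q k \<omega>) \<le> 2 * A k \<omega> + 2 * B k \<omega>" if \<omega>: "\<omega> \<in> space M" for k \<omega>
  proof -
    \<comment> \<open>The path is continued by constants outside \<open>{0..t}\<close>, which makes
      it continuous on the line and hence Borel measurable.\<close>
    define h where "h s = H (max 0 (min t s)) \<omega>" for s
    have "continuous_on UNIV h"
      unfolding h_def by (rule continuous_on_compose2[OF cont[OF \<omega>]]) (auto intro!: continuous_intros)
    then have [measurable]: "h \<in> borel_measurable borel" by (rule borel_measurable_continuous_onI)
    have h: "H s \<omega> = h s" if "s \<in> {0..t}" for s using that by (simp add: h_def)
    have [measurable]: "(\<lambda>s. simple_value m \<theta> \<zeta> s \<omega>) \<in> borel_measurable borel" for m \<theta> and \<zeta> :: "nat \<Rightarrow> 'a \<Rightarrow> real"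
      unfolding simple_value_def by measurable
    have A: "A k \<omega> = (\<integral>\<^sup>+ s\<in>{0..t}. ennreal ((simple_value (n k) (\<tau> k) (\<xi> k) s \<omega> - h s)\<^sup>2) \<partial>lborel)"
      and B: "B k \<omega> = (\<integral>\<^sup>+ s\<in>{0..t}. ennreal ((simple_value (N k) (\<sigma> k) (\<rho> k) s \<omega> - h s)\<^sup>2) \<partial>lborel)"
      unfolding A_def B_def by (rule nn_integral_cong; simp add: h split: split_indicator)+
    have "ennreal (Q k \<omega>) = (\<integral>\<^sup>+s\<in>{0..t}. ennreal ((simple_value (N k) (\<sigma> k) (\<Delta> k) s \<omega>)\<^sup>2) \<partial>lborel)"
      unfolding Q_def by (rule simple_value_nn_integral[symmetric]) (use \<sigma> in auto)
    also have "\<dots> \<le> (\<integral>\<^sup>+s. 2 * (ennreal ((simple_value (n k) (\<tau> k) (\<xi> k) s \<omega> - h s)\<^sup>2) * indicator {0..t} s)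
        + 2 * (ennreal ((simple_value (N k) (\<sigma> k) (\<rho> k) s \<omega> - h s)\<^sup>2) * indicator {0..t} s) \<partial>lborel)"
    proof (rule nn_integral_mono)
      fix s
      let ?x = "simple_value (n k) (\<tau> k) (\<xi> k) s \<omega> - h s" and ?y = "simple_value (N k) (\<sigma> k) (\<rho> k) s \<omega> - h s"
      have "0 \<le> (?x + ?y)\<^sup>2" by simp
      then have "(?x - ?y)\<^sup>2 \<le> 2 * ?x\<^sup>2 + 2 * ?y\<^sup>2"
        by (simp add: power2_eq_square algebra_simps)
      then have "ennreal ((?x - ?y)\<^sup>2) \<le> ennreal (2 * ?x\<^sup>2 + 2 * ?y\<^sup>2)" by (rule ennreal_leI)
      also have "\<dots> = 2 * ennreal (?x\<^sup>2) + 2 * ennreal (?y\<^sup>2)"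
        by (simp add: ennreal_plus ennreal_mult)
      finally show "ennreal ((simple_value (N k) (\<sigma> k) (\<Delta> k) s \<omega>)\<^sup>2) * indicator {0..t} s \<le>
         2 * (ennreal (?x\<^sup>2) * indicator {0..t} s) + 2 * (ennreal (?y\<^sup>2) * indicator {0..t} s)"
        unfolding D_value by (simp split: split_indicator)
    qed
    also have "\<dots> = 2 * A k \<omega> + 2 * B k \<omega>"
      unfolding A B by (subst nn_integral_add) (auto simp: nn_integral_cmult)
    finally show ?thesis .
  qed
  have B_lim: "tends_to_zero_in_prob M B"
  proof (rule tends_to_zero_in_probI, rule AE_I2, intro allI impI)
    fix \<omega> e assume "\<omega> \<in> space M" "0 < (e :: real)"
    then show "\<forall>\<^sub>F k in sequentially. B k \<omega> \<le> ennreal e"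
      using left_endpoint_sums_converge[OF \<open>0 \<le> t\<close> _ \<sigma> mesh mesh_tendsto, where H="\<lambda>s. H s \<omega>" and e=e]
        continuous_on_subset[OF cont, of \<omega> "{0..t}"]
      unfolding B_def \<rho>_def by (auto simp: simple_value_def)
  qed
  have X_lim: "(\<lambda>k. prob {\<omega>\<in>space M. \<epsilon> < \<bar>simple_integral W (N k) (\<sigma> k) (\<rho> k) \<omega> - I \<omega>\<bar>}) \<longlonglongrightarrow> 0" if "0 < \<epsilon>" for \<epsilon>
  proof (rule LIMSEQ_I)
    fix r :: real assume "0 < r"
    define e where "e = \<epsilon> / 2"
    have e: "0 < e" using that by (simp add: e_def)
    \<comment> \<open>With this value \<open>e^2 / (2 \<delta>) = 8 / r\<close>, and
      \<open>exp (8 / r) \<ge> 1 + 8 / r\<close> pushes the exponential term below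
      \<open>r / 4\<close>. The other three terms get \<open>r / 4\<close> each.\<close>
    define \<delta> where "\<delta> = e\<^sup>2 * r / 16"
    have \<delta>: "0 < \<delta>" using e \<open>0 < r\<close> by (simp add: \<delta>_def)
    have "1 + 8 / r \<le> exp (8 / r)" by (rule exp_ge_add_one_self)
    then have "exp (- (8 / r)) < r / 8"
      using \<open>0 < r\<close> by (simp add: exp_minus field_simps)
    moreover have "e\<^sup>2 / (2 * \<delta>) = 8 / r" using e \<open>0 < r\<close> by (simp add: \<delta>_def field_simps)
    ultimately have small: "2 * exp (- (e\<^sup>2 / (2 * \<delta>))) < r / 4" by simp
    let ?a = "\<lambda>k. prob {\<omega>\<in>space M. ennreal (\<delta> / 4) < A k \<omega>}"
    let ?b = "\<lambda>k. prob {\<omega>\<in>space M. ennreal (\<delta> / 4) < B k \<omega>}"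
    let ?g = "\<lambda>k. prob {\<omega>\<in>space M. ennreal e < ennreal \<bar>simple_integral W (n k) (\<tau> k) (\<xi> k) \<omega> - I \<omega>\<bar>}"
    have lims: "?a \<longlonglongrightarrow> 0" "?b \<longlonglongrightarrow> 0" "?g \<longlonglongrightarrow> 0"
      using G_L2 B_lim G_int \<delta> e unfolding tends_to_zero_in_prob_def A_def by auto
    have "\<forall>\<^sub>F k in sequentially. ?a k < r / 4" "\<forall>\<^sub>F k in sequentially. ?b k < r / 4" "\<forall>\<^sub>F k in sequentially. ?g k < r / 4"
      using \<open>0 < r\<close> by (intro lims[THEN order_tendstoD(2)], simp)+
    then have "\<forall>\<^sub>F k in sequentially. norm (prob {\<omega>\<in>space M. \<epsilon> < \<bar>simple_integral W (N k) (\<sigma> k) (\<rho> k) \<omega> - I \<omega>\<bar>} - 0) < r"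
    proof eventually_elim
      case (elim k)
      have "prob {\<omega>\<in>space M. \<epsilon> < \<bar>simple_integral W (N k) (\<sigma> k) (\<rho> k) \<omega> - I \<omega>\<bar>}
        \<le> prob ({\<omega>\<in>space M. e < \<bar>simple_integral W (N k) (\<sigma> k) (\<Delta> k) \<omega>\<bar>}
          \<union> {\<omega>\<in>space M. ennreal e < ennreal \<bar>simple_integral W (n k) (\<tau> k) (\<xi> k) \<omega> - I \<omega>\<bar>})"
      proof (rule finite_measure_mono)
        show "{\<omega>\<in>space M. \<epsilon> < \<bar>simple_integral W (N k) (\<sigma> k) (\<rho> k) \<omega> - I \<omega>\<bar>}
          \<subseteq> {\<omega>\<in>space M. e < \<bar>simple_integral W (N k) (\<sigma> k) (\<Delta> k) \<omega>\<bar>}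
          \<union> {\<omega>\<in>space M. ennreal e < ennreal \<bar>simple_integral W (n k) (\<tau> k) (\<xi> k) \<omega> - I \<omega>\<bar>}"
          unfolding D_integral e_def
        proof
          fix \<omega>
          let ?R = "simple_integral W (N k) (\<sigma> k) (\<rho> k) \<omega>" and ?G = "simple_integral W (n k) (\<tau> k) (\<xi> k) \<omega>"
          have "\<bar>?R - I \<omega>\<bar> \<le> \<bar>?G - ?R\<bar> + \<bar>?G - I \<omega>\<bar>" by linarith
          then show "\<omega> \<in> {\<omega>\<in>space M. \<epsilon> < \<bar>simple_integral W (N k) (\<sigma> k) (\<rho> k) \<omega> - I \<omega>\<bar>} \<Longrightarrow>
             \<omega> \<in> {\<omega>\<in>space M. \<epsilon> / 2 < \<bar>simple_integral W (n k) (\<tau> k) (\<xi> k) \<omega> - simple_integral W (N k) (\<sigma> k) (\<rho> k) \<omega>\<bar>}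
               \<union> {\<omega>\<in>space M. ennreal (\<epsilon> / 2) < ennreal \<bar>simple_integral W (n k) (\<tau> k) (\<xi> k) \<omega> - I \<omega>\<bar>}"
            using that by (auto simp: ennreal_less_iff)
        qed
      qed (auto simp: D_integral)
      also have "\<dots> \<le> prob {\<omega>\<in>space M. e < \<bar>simple_integral W (N k) (\<sigma> k) (\<Delta> k) \<omega>\<bar>} + ?g k"
        by (rule measure_Un_le) (auto simp: D_integral)
      also have "prob {\<omega>\<in>space M. e < \<bar>simple_integral W (N k) (\<sigma> k) (\<Delta> k) \<omega>\<bar>}
         \<le> 2 * exp (- (e\<^sup>2 / (2 * \<delta>))) + prob {\<omega>\<in>space M. \<delta> < Q k \<omega>}"
        unfolding Q_def by (rule simple_integral_tail[OF D e \<delta>])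
      \<comment> \<open>Because \<open>Q\<close> is at most twice the sum of \<open>A\<close> and
        \<open>B\<close>, a value above \<open>\<delta>\<close> forces one of them above
        \<open>\<delta> / 4\<close>.\<close>
      also have "prob {\<omega>\<in>space M. \<delta> < Q k \<omega>} \<le> prob ({\<omega>\<in>space M. ennreal (\<delta> / 4) < A k \<omega>} \<union> {\<omega>\<in>space M. ennreal (\<delta> / 4) < B k \<omega>})"
      proof (rule finite_measure_mono, rule subsetI, rule ccontr)
        fix \<omega> assume \<omega>: "\<omega> \<in> {\<omega>\<in>space M. \<delta> < Q k \<omega>}"
          and n: "\<omega> \<notin> {\<omega>\<in>space M. ennreal (\<delta> / 4) < A k \<omega>} \<union> {\<omega>\<in>space M. ennreal (\<delta> / 4) < B k \<omega>}"
        from n \<omega> have "A k \<omega> \<le> ennreal (\<delta> / 4)" "B k \<omega> \<le> ennreal (\<delta> / 4)" by auto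
        then have "2 * A k \<omega> + 2 * B k \<omega> \<le> 2 * ennreal (\<delta> / 4) + 2 * ennreal (\<delta> / 4)"
          by (intro add_mono mult_left_mono) auto
        also have "\<dots> = ennreal (2 * (\<delta> / 4) + 2 * (\<delta> / 4))"
          using \<delta> by (simp add: numeral_mult_ennreal flip: ennreal_plus)
        finally have "ennreal (Q k \<omega>) \<le> ennreal \<delta>"
          using Q_le[of \<omega> k] \<omega> by simp
        then show False using \<omega> \<delta> by simp
      qed auto
      also have "\<dots> \<le> ?a k + ?b k"
        by (rule measure_Un_le) auto
      finally show ?case using elim small by simp
    qed
    then show "\<exists>no. \<forall>k\<ge>no. norm (prob {\<omega>\<in>space M. \<epsilon> < \<bar>simple_integral W (N k) (\<sigma> k) (\<rho> k) \<omega> - I \<omega>\<bar>} - 0) < r"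
      by (simp add: eventually_sequentially)
  qed
  \<comment> \<open>The left endpoint integrals tend to \<open>?J\<close> path by path and to
    \<open>I\<close> in probability.\<close>
  have "AE \<omega> in M. \<bar>?J \<omega> - I \<omega>\<bar> \<le> 0"
  proof (rule limit_in_prob_nonpos[OF _ X_lim])
    show "AE \<omega> in M. (\<lambda>k. \<bar>simple_integral W (N k) (\<sigma> k) (\<rho> k) \<omega> - I \<omega>\<bar>) \<longlonglongrightarrow> \<bar>?J \<omega> - I \<omega>\<bar>"
      using H' AE_space
    proof eventually_elim
      case (elim \<omega>)
      have "(\<lambda>k. simple_integral W (N k) (\<sigma> k) (\<rho> k) \<omega>) \<longlonglongrightarrow> ?J \<omega>"
        unfolding simple_integral_def \<rho>_def
        using elim W_continuous[of \<omega>]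
        by (intro Riemann_Stieltjes_limit[OF \<open>0 \<le> t\<close> _ _ _ \<sigma> mesh mesh_tendsto])
          (auto intro: continuous_on_subset)
      then show ?case by (intro tendsto_intros)
    qed
  qed auto
  then show ?thesis by eventually_elim simp
qed

text \<open>Left endpoint processes on uniform partitions serve as approximations: they are adapted
  and bounded by \<open>C\<close>, and both required limits hold for every path, hence in
  probability.\<close>

lemma ito_integral_C1_exists:
  assumes "0 \<le> t"
    and H: "\<And>s. 0 \<le> s \<Longrightarrow> H s \<in> borel_measurable (F s)"
    and C: "\<And>s \<omega>. 0 \<le> s \<Longrightarrow> \<omega> \<in> space M \<Longrightarrow> \<bar>H s \<omega>\<bar> \<le> C"
    and cont: "\<And>\<omega>. \<omega> \<in> space M \<Longrightarrow> continuous_on {0..} (\<lambda>s. H s \<omega>)"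
    and H': "\<And>\<omega> s. \<omega> \<in> space M \<Longrightarrow> s \<in> {0..t} \<Longrightarrow> ((\<lambda>s. H s \<omega>) has_real_derivative H' s \<omega>) (at s within {0..t})"
    and cont': "\<And>\<omega>. \<omega> \<in> space M \<Longrightarrow> continuous_on {0..t} (\<lambda>s. H' s \<omega>)"
  shows "has_ito_integral M F W H t (\<lambda>\<omega>. H t \<omega> * W t \<omega> - H 0 \<omega> * W 0 \<omega> - integral {0..t} (\<lambda>s. H' s \<omega> * W s \<omega>))"
proof -
  let ?J = "\<lambda>\<omega>. H t \<omega> * W t \<omega> - H 0 \<omega> * W 0 \<omega> - integral {0..t} (\<lambda>s. H' s \<omega> * W s \<omega>)"
  define \<sigma> where "\<sigma> k = uniform_partition 0 t (Suc k)" for k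
  note u = uniform_partition[of 0 t "Suc k" for k, OF \<open>0 \<le> t\<close>, simplified, folded \<sigma>_def]
  have \<sigma>: "\<sigma> k 0 = 0" "\<sigma> k (Suc k) = t" "\<And>j. j < Suc k \<Longrightarrow> \<sigma> k j \<le> \<sigma> k (Suc j)"
    "\<And>j. j < Suc k \<Longrightarrow> \<sigma> k (Suc j) - \<sigma> k j \<le> t / real (Suc k)" for k
    using u by auto
  define \<rho> where "\<rho> k j = H (\<sigma> k j)" for k j
  have R: "simple_process M F t (Suc k) (\<sigma> k) (\<rho> k)" for k
    unfolding simple_process_def using \<sigma> H C u by (auto simp: \<rho>_def intro!: exI[of _ C])
  have lim: "(\<lambda>k. simple_integral W (Suc k) (\<sigma> k) (\<rho> k) \<omega>) \<longlonglongrightarrow> ?J \<omega>" if \<omega>: "\<omega> \<in> space M" for \<omega>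
    unfolding simple_integral_def \<rho>_def
    using W_continuous[OF \<omega>] H'[OF \<omega>] cont'[OF \<omega>]
    by (intro Riemann_Stieltjes_limit[OF \<open>0 \<le> t\<close> _ _ _ \<sigma> mesh_tendsto]) (auto intro: continuous_on_subset)
  show ?thesis
    unfolding has_ito_integral_def
  proof (intro conjI exI allI)
    show "progressive_upto F t H" by (rule progressive_upto_continuous[OF H cont])
    show "?J \<in> borel_measurable M"
      by (rule borel_measurable_LIMSEQ_real[OF lim simple_integral_measurable(1)[OF R]])
    show "simple_process M F t (Suc k) (\<sigma> k) (\<rho> k)" for k by (rule R)
    show "tends_to_zero_in_prob M (\<lambda>k \<omega>. \<integral>\<^sup>+ s\<in>{0..t}. ennreal ((simple_value (Suc k) (\<sigma> k) (\<rho> k) s \<omega> - H s \<omega>)\<^sup>2) \<partial>lborel)"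
    proof (rule tends_to_zero_in_probI, rule AE_I2, intro allI impI)
      fix \<omega> e assume "\<omega> \<in> space M" "0 < (e :: real)"
      then show "\<forall>\<^sub>F k in sequentially. (\<integral>\<^sup>+ s\<in>{0..t}. ennreal ((simple_value (Suc k) (\<sigma> k) (\<rho> k) s \<omega> - H s \<omega>)\<^sup>2) \<partial>lborel) \<le> ennreal e"
        using left_endpoint_sums_converge[OF \<open>0 \<le> t\<close> _ \<sigma> mesh_tendsto, where H="\<lambda>s. H s \<omega>" and e=e]
          continuous_on_subset[OF cont, of \<omega> "{0..t}"]
        unfolding \<rho>_def by (auto simp: simple_value_def)
    qed
    show "tends_to_zero_in_prob M (\<lambda>k \<omega>. ennreal \<bar>simple_integral W (Suc k) (\<sigma> k) (\<rho> k) \<omega> - ?J \<omega>\<bar>)"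
    proof (rule tends_to_zero_in_probI, rule AE_I2, intro allI impI)
      fix \<omega> e assume \<omega>: "\<omega> \<in> space M" "0 < (e :: real)"
      from tendstoD[OF lim[OF \<omega>(1)] \<omega>(2)]
      show "\<forall>\<^sub>F k in sequentially. ennreal \<bar>simple_integral W (Suc k) (\<sigma> k) (\<rho> k) \<omega> - ?J \<omega>\<bar> \<le> ennreal e"
        by eventually_elim (auto simp: dist_real_def intro!: ennreal_leI)
    qed
  qed
qed

end


section \<open>Ordinary differential equations\<close>

lemma at_within_halfline: "0 \<le> t \<Longrightarrow> t < T \<Longrightarrow> at t within {0..} = at t within {0..T}" for t T :: real
  by (rule at_within_nhd[of _ "{..<T}"]) auto

lemma continuous_on_halfline:
  fixes g :: "real \<Rightarrow> 'b::topological_space"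
  assumes "\<And>T. 0 < T \<Longrightarrow> continuous_on {0..T} g"
  shows "continuous_on {0..} g"
  unfolding continuous_on_def
proof
  fix t :: real assume "t \<in> {0..}"
  then have t: "0 \<le> t" "t < t + 1" by auto
  show "(g \<longlongrightarrow> g t) (at t within {0..})"
    using assms[of "t + 1"] t unfolding at_within_halfline[OF t] by (auto simp: continuous_on_def)
qed

lemma integral_continuous_halfline:
  fixes g :: "real \<Rightarrow> 'b::banach"
  assumes "continuous_on {0..} g"
  shows "continuous_on {0..} (\<lambda>t. integral {0..t} g)"
  by (rule continuous_on_halfline, rule indefinite_integral_continuous_1, rule integrable_continuous_real)
    (use assms in \<open>auto elim: continuous_on_subset\<close>)

lemma integral_has_vector_derivative_halfline:
  fixes g :: "real \<Rightarrow> 'b::banach"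
  assumes "continuous_on {0..} g" "0 \<le> t"
  shows "((\<lambda>t. integral {0..t} g) has_vector_derivative g t) (at t within {0..})"
  unfolding at_within_halfline[OF assms(2) less_add_one]
  by (rule integral_has_vector_derivative) (use assms in \<open>auto elim: continuous_on_subset\<close>)

lemma integral_equation_of_derivative:
  fixes Y :: "real \<Rightarrow> 'b::banach"
  assumes "\<And>s. 0 \<le> s \<Longrightarrow> (Y has_vector_derivative g s) (at s within {0..})" "0 \<le> t"
  shows "integral {0..t} g = Y t - Y 0"
proof -
  have "(g has_integral (Y t - Y 0)) {0..t}"
    by (rule fundamental_theorem_of_calculus[OF \<open>0 \<le> t\<close>], rule has_vector_derivative_within_subset[OF assms(1)]) auto
  then show "integral {0..t} g = Y t - Y 0"
    by (rule integral_unique)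
qed

lemma continuous_on_has_vector_derivative:
  assumes "\<And>s. s \<in> S \<Longrightarrow> (Y has_vector_derivative g s) (at s within S)"
  shows "continuous_on S Y"
  using assms has_vector_derivative_continuous continuous_on_eq_continuous_within by blast

text \<open>Each integration raises the power of \<open>t\<close> by one and supplies the next
  factor of the factorial. A constant sequence gives Gronwall's lemma; the differences of successive
  Picard iterates give uniform convergence.\<close>

lemma iterated_integral_bound:
  fixes \<phi> :: "nat \<Rightarrow> real \<Rightarrow> real"
  assumes "0 \<le> L" and 0: "\<And>t. t \<in> {0..T} \<Longrightarrow> \<phi> 0 t \<le> C"
    and cont: "\<And>n. continuous_on {0..T} (\<phi> n)"
    and step: "\<And>n t. t \<in> {0..T} \<Longrightarrow> \<phi> (Suc n) t \<le> L * integral {0..t} (\<phi> n)"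
    and "t \<in> {0..T}"
  shows "\<phi> n t \<le> C * (L * t) ^ n / fact n"
  using \<open>t \<in> {0..T}\<close>
proof (induction n arbitrary: t)
  case 0
  then show ?case using assms(2) by simp
next
  case (Suc n)
  let ?F = "\<lambda>s. C * L ^ n * s ^ Suc n / fact (Suc n)"
  have "((\<lambda>s. C * (L * s) ^ n / fact n) has_integral (?F t - ?F 0)) {0..t}"
  proof (rule fundamental_theorem_of_calculus)
    fix s assume "s \<in> {0..t}"
    have "((\<lambda>s. s ^ Suc n) has_real_derivative real (Suc n) * s ^ n) (at s within {0..t})"
      using DERIV_pow[of "Suc n" s] by simp
    then have "(?F has_real_derivative C * L ^ n * (real (Suc n) * s ^ n) / fact (Suc n)) (at s within {0..t})"
      by (intro DERIV_cdivide DERIV_cmult)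
    moreover have "C * L ^ n * (real (Suc n) * s ^ n) / fact (Suc n) = C * (L * s) ^ n / fact n"
      by (simp add: power_mult_distrib del: of_nat_Suc)
    ultimately show "(?F has_vector_derivative C * (L * s) ^ n / fact n) (at s within {0..t})"
      by (simp only: has_real_derivative_iff_has_vector_derivative)
  qed (use Suc in auto)
  moreover have "?F 0 = 0" by simp
  ultimately have I: "integral {0..t} (\<lambda>s. C * (L * s) ^ n / fact n) = ?F t" "(\<lambda>s. C * (L * s) ^ n / fact n) integrable_on {0..t}"
    by (simp_all only: integral_unique has_integral_integrable diff_0_right)
  have "\<phi> (Suc n) t \<le> L * integral {0..t} (\<phi> n)" using step Suc.prems by blast
  also have "\<dots> \<le> L * integral {0..t} (\<lambda>s. C * (L * s) ^ n / fact n)"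
    by (intro mult_left_mono integral_le I(2) \<open>0 \<le> L\<close> integrable_continuous_real continuous_on_subset[OF cont])
      (use Suc in auto)
  also have "\<dots> = C * (L * t) ^ Suc n / fact (Suc n)"
    unfolding I(1) by (simp add: power_mult_distrib)
  finally show ?case .
qed

text \<open>The iterated bound holds for the constant sequence \<open>\<phi>\<close> at every order,
  and its right-hand side tends to 0 as the general term of an exponential series.\<close>

lemma Gronwall_zero:
  fixes \<phi> :: "real \<Rightarrow> real"
  assumes "0 \<le> L" and cont: "continuous_on {0..T} \<phi>"
    and step: "\<And>t. t \<in> {0..T} \<Longrightarrow> \<phi> t \<le> L * integral {0..t} \<phi>"
    and t: "t \<in> {0..T}"
  shows "\<phi> t \<le> 0"
proof -
  have "bounded (\<phi> ` {0..T})"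
    by (intro compact_imp_bounded compact_continuous_image cont compact_Icc)
  then obtain C where "\<forall>x\<in>\<phi> ` {0..T}. norm x \<le> C"
    unfolding bounded_iff by blast
  then have C: "\<And>t. t \<in> {0..T} \<Longrightarrow> \<phi> t \<le> C" by force
  have "\<phi> t \<le> C * (L * t) ^ n / fact n" for n
    by (rule iterated_integral_bound[where \<phi>="\<lambda>_. \<phi>" and T=T]) (use assms C in auto)
  moreover have "(\<lambda>n. C * ((L * t) ^ n / fact n)) \<longlonglongrightarrow> C * 0"
    using summable_LIMSEQ_zero[OF summable_exp[of "L * t"]]
    by (intro tendsto_mult tendsto_const) (simp add: field_simps)
  ultimately show ?thesis
    by (intro LIMSEQ_le_const[of _ 0]) auto
qed

section \<open>Picard iteration for globally Lipschitz equations\<close>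

primrec picard_iter :: "(real \<Rightarrow> 'b \<Rightarrow> 'b) \<Rightarrow> 'b \<Rightarrow> nat \<Rightarrow> real \<Rightarrow> 'b::banach" where
  "picard_iter f x 0 t = x"
| "picard_iter f x (Suc n) t = x + integral {0..t} (\<lambda>s. f s (picard_iter f x n s))"

definition picard_limit :: "(real \<Rightarrow> 'b \<Rightarrow> 'b) \<Rightarrow> 'b \<Rightarrow> real \<Rightarrow> 'b::banach" where
  "picard_limit f x t = lim (\<lambda>n. picard_iter f x n t)"

lemma norm_integral_diff_le:
  fixes g h :: "real \<Rightarrow> 'b::banach"
  assumes "continuous_on {0..t} g" "continuous_on {0..t} h" "continuous_on {0..t} \<psi>"
    and "\<And>s. s \<in> {0..t} \<Longrightarrow> norm (g s - h s) \<le> \<psi> s"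
  shows "norm (integral {0..t} g - integral {0..t} h) \<le> integral {0..t} \<psi>"
proof -
  have "integral {0..t} g - integral {0..t} h = integral {0..t} (\<lambda>s. g s - h s)"
    by (rule integral_diff[symmetric]) (intro integrable_continuous_real assms)+
  also have "norm \<dots> \<le> integral {0..t} \<psi>"
    by (rule integral_norm_bound_integral)
      (use assms in \<open>auto intro!: integrable_continuous_real continuous_intros\<close>)
  finally show ?thesis .
qed

text \<open>Continuity is required along continuous curves, the form in which the integral equation
  uses it. The Lipschitz constant is uniform in space but may depend on the time horizon, as it must
  when the coefficients follow a noise path.\<close>

locale globally_lipschitz_ode =
  fixes f :: "real \<Rightarrow> 'b::banach \<Rightarrow> 'b"
  assumes cont: "\<And>Z. continuous_on {0..} Z \<Longrightarrow> continuous_on {0..} (\<lambda>s. f s (Z s))"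
    and lipschitz: "\<And>T. \<exists>L\<ge>0. \<forall>t\<in>{0..T}. \<forall>x y. norm (f t x - f t y) \<le> L * norm (x - y)"
begin

lemma picard_iter_continuous: "continuous_on {0..} (picard_iter f x n)"
proof (induction n)
  case (Suc n)
  then show ?case
    unfolding picard_iter.simps by (intro continuous_intros integral_continuous_halfline cont)
qed simp

text \<open>The iterates are the partial sums of their successive differences, whose norms are
  dominated by the terms of an exponential series; the Weierstrass test applies.\<close>

lemma picard_uniform:
  "uniform_limit {0..T} (picard_iter f x) (picard_limit f x) sequentially"
proof -
  obtain L where L: "0 \<le> L" "\<And>t x y. t \<in> {0..T} \<Longrightarrow> norm (f t x - f t y) \<le> L * norm (x - y)"
    using lipschitz by blast
  let ?X = "picard_iter f x"
  let ?\<phi> = "\<lambda>n t. norm (?X (Suc n) t - ?X n t)"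
  have X: "continuous_on {0..t} (?X n)" "continuous_on {0..t} (\<lambda>s. f s (?X n s))" for n t
    by (rule continuous_on_subset[OF picard_iter_continuous], simp)
      (rule continuous_on_subset[OF cont[OF picard_iter_continuous]], simp)
  have "bounded (?\<phi> 0 ` {0..T})"
    by (intro compact_imp_bounded compact_continuous_image compact_Icc continuous_intros X)
  then obtain C where "\<forall>x\<in>?\<phi> 0 ` {0..T}. norm x \<le> C"
    unfolding bounded_iff by blast
  then have C: "\<And>t. t \<in> {0..T} \<Longrightarrow> ?\<phi> 0 t \<le> C" by force
  have bound: "?\<phi> n t \<le> C * (L * t) ^ n / fact n" if "t \<in> {0..T}" for n t
  proof (rule iterated_integral_bound[where T=T])
    fix n t assume t: "t \<in> {0..T}"
    have "?\<phi> (Suc n) t = norm (integral {0..t} (\<lambda>s. f s (?X (Suc n) s)) - integral {0..t} (\<lambda>s. f s (?X n s)))"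
      by (simp only: picard_iter.simps) simp
    also have "\<dots> \<le> integral {0..t} (\<lambda>s. L * ?\<phi> n s)"
      by (rule norm_integral_diff_le) (use L t in \<open>auto intro!: continuous_intros X simp del: picard_iter.simps\<close>)
    also have "\<dots> = L * integral {0..t} (?\<phi> n)"
      by (rule integral_mult_right)
    finally show "?\<phi> (Suc n) t \<le> L * integral {0..t} (?\<phi> n)" .
  qed (use that C L X in \<open>auto intro!: continuous_intros simp del: picard_iter.simps\<close>)
  have C0: "0 \<le> C" if "0 \<le> T" using C[of 0] that order_trans[OF norm_ge_zero] by auto
  have "uniform_limit {0..T} (\<lambda>n t. \<Sum>i<n. ?X (Suc i) t - ?X i t) (\<lambda>t. \<Sum>i. ?X (Suc i) t - ?X i t) sequentially"
  proof (rule Weierstrass_m_test)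
    show "norm (?X (Suc n) t - ?X n t) \<le> C * ((L * T) ^ n / fact n)" if "t \<in> {0..T}" for n t
    proof -
      have "C * ((L * t) ^ n / fact n) \<le> C * ((L * T) ^ n / fact n)"
        using that L C0 by (intro mult_left_mono divide_right_mono power_mono) auto
      with bound[OF that, of n] show ?thesis by simp
    qed
    show "summable (\<lambda>n. C * ((L * T) ^ n / fact n))"
      using summable_exp[of "L * T"] by (intro summable_mult) (simp add: field_simps)
  qed
  then have lim: "uniform_limit {0..T} (\<lambda>n t. x + (\<Sum>i<n. ?X (Suc i) t - ?X i t)) (\<lambda>t. x + (\<Sum>i. ?X (Suc i) t - ?X i t)) sequentially"
    by (intro uniform_limit_intros)
  have sum: "x + (\<Sum>i<n. ?X (Suc i) t - ?X i t) = ?X n t" for n t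
    using sum_lessThan_telescope[of "\<lambda>i. ?X i t" n] by simp
  have "uniform_limit {0..T} ?X (\<lambda>t. x + (\<Sum>i. ?X (Suc i) t - ?X i t)) sequentially"
    using lim unfolding sum .
  moreover have "x + (\<Sum>i. ?X (Suc i) t - ?X i t) = picard_limit f x t" if "t \<in> {0..T}" for t
    unfolding picard_limit_def
    by (rule limI[symmetric]) (use tendsto_uniform_limitI[OF lim that] in \<open>simp only: sum\<close>)
  ultimately show ?thesis
    by (subst (asm) uniform_limit_cong') auto
qed

lemma picard_limit_tendsto: "0 \<le> t \<Longrightarrow> (\<lambda>n. picard_iter f x n t) \<longlonglongrightarrow> picard_limit f x t"
  using tendsto_uniform_limitI[OF picard_uniform[where T=t and x=x], of t] by simp

lemma picard_limit_continuous: "continuous_on {0..} (picard_limit f x)"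
  by (rule continuous_on_halfline, rule uniform_limit_theorem[OF _ picard_uniform])
    (auto intro!: always_eventually continuous_on_subset[OF picard_iter_continuous])

lemma picard_limit_eq:
  assumes "0 \<le> t"
  shows "picard_limit f x t = x + integral {0..t} (\<lambda>s. f s (picard_limit f x s))"
proof -
  obtain L where L: "0 \<le> L" "\<And>s x y. s \<in> {0..t} \<Longrightarrow> norm (f s x - f s y) \<le> L * norm (x - y)"
    using lipschitz by blast
  have "(\<lambda>n. integral {0..t} (\<lambda>s. f s (picard_iter f x n s))) \<longlonglongrightarrow> integral {0..t} (\<lambda>s. f s (picard_limit f x s))"
  proof (rule tendstoI)
    fix e :: real assume "0 < e"
    \<comment> \<open>The summand 1 gives \<open>L d t < e\<close> even when
      \<open>L t = 0\<close>.\<close>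
    define d where "d = e / (L * t + 1)"
    have d: "0 < d" "L * d * t < e"
    proof -
      have "0 \<le> L * t" using L assms by simp
      then show "0 < d" "L * d * t < e" using \<open>0 < e\<close> by (auto simp: d_def field_simps)
    qed
    from uniform_limitD[OF picard_uniform[where T=t and x=x] d(1)]
    show "\<forall>\<^sub>F n in sequentially. dist (integral {0..t} (\<lambda>s. f s (picard_iter f x n s))) (integral {0..t} (\<lambda>s. f s (picard_limit f x s))) < e"
    proof eventually_elim
      case (elim n)
      have "norm (integral {0..t} (\<lambda>s. f s (picard_iter f x n s)) - integral {0..t} (\<lambda>s. f s (picard_limit f x s)))
        \<le> integral {0..t} (\<lambda>s. L * d)"
      proof (rule norm_integral_diff_le)
        fix s assume s: "s \<in> {0..t}"
        have "norm (f s (picard_iter f x n s) - f s (picard_limit f x s)) \<le> L * norm (picard_iter f x n s - picard_limit f x s)"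
          using L s by blast
        also have "\<dots> \<le> L * d"
          using elim s L(1) by (intro mult_left_mono) (auto simp: dist_norm less_imp_le)
        finally show "norm (f s (picard_iter f x n s) - f s (picard_limit f x s)) \<le> L * d" .
      qed (auto intro!: continuous_on_subset[OF cont] picard_iter_continuous picard_limit_continuous)
      then show ?case using assms d(2) by (simp add: dist_norm mult_ac)
    qed
  qed
  then have "(\<lambda>n. picard_iter f x (Suc n) t) \<longlonglongrightarrow> x + integral {0..t} (\<lambda>s. f s (picard_limit f x s))"
    unfolding picard_iter.simps by (intro tendsto_intros)
  moreover have "(\<lambda>n. picard_iter f x (Suc n) t) \<longlonglongrightarrow> picard_limit f x t"
    using picard_limit_tendsto[OF assms] by (rule LIMSEQ_Suc)
  ultimately show ?thesis by (rule LIMSEQ_unique[symmetric])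
qed

lemma picard_limit_derivative:
  assumes "0 \<le> t"
  shows "(picard_limit f x has_vector_derivative f t (picard_limit f x t)) (at t within {0..})"
proof -
  have "((\<lambda>t. x + integral {0..t} (\<lambda>s. f s (picard_limit f x s))) has_vector_derivative f t (picard_limit f x t)) (at t within {0..})"
    using integral_has_vector_derivative_halfline[OF cont[OF picard_limit_continuous] assms]
    by (auto intro!: derivative_eq_intros)
  then show ?thesis
    by (rule has_vector_derivative_transform[rotated 2]) (use assms picard_limit_eq in auto)
qed

lemma picard_limit_0 [simp]: "picard_limit f x 0 = x"
  using picard_limit_eq[of 0 x] by simp

end

text \<open>A Lipschitz condition on balls is enough: on \<open>{0..T}\<close> both curves stay in
  one ball by compactness, and Gronwall's lemma applies to their distance.\<close>

lemma ode_unique: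
  fixes Y Z :: "real \<Rightarrow> 'b::banach"
  assumes Y: "\<And>t. t \<in> {0..T} \<Longrightarrow> (Y has_vector_derivative f t (Y t)) (at t within {0..})"
    and Z: "\<And>t. t \<in> {0..T} \<Longrightarrow> (Z has_vector_derivative f t (Z t)) (at t within {0..})"
    and init: "Y 0 = Z 0"
    and cont: "\<And>t Z. continuous_on {0..t} Z \<Longrightarrow> continuous_on {0..t} (\<lambda>s. f s (Z s))"
    and lipschitz: "\<And>r. \<exists>L\<ge>0. \<forall>t\<in>{0..T}. \<forall>x\<in>cball 0 r. \<forall>y\<in>cball 0 r. norm (f t x - f t y) \<le> L * norm (x - y)"
    and t: "t \<in> {0..T}"
  shows "Y t = Z t"
proof -
  have sub: "continuous_on {0..u} Y" "continuous_on {0..u} Z" if "u \<le> T" for u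
    by (rule continuous_on_has_vector_derivative, rule has_vector_derivative_within_subset[OF Y] has_vector_derivative_within_subset[OF Z];
        use that in auto)+
  have "bounded (Y ` {0..T} \<union> Z ` {0..T})"
    unfolding bounded_Un by (intro conjI compact_imp_bounded compact_continuous_image sub compact_Icc) auto
  then obtain r where "\<forall>x\<in>Y ` {0..T} \<union> Z ` {0..T}. norm x \<le> r"
    unfolding bounded_iff by blast
  then have r: "\<And>s. s \<in> {0..T} \<Longrightarrow> Y s \<in> cball 0 r \<and> Z s \<in> cball 0 r"
    by force
  obtain L where L: "0 \<le> L" "\<And>s x y. s \<in> {0..T} \<Longrightarrow> x \<in> cball 0 r \<Longrightarrow> y \<in> cball 0 r \<Longrightarrow> norm (f s x - f s y) \<le> L * norm (x - y)"
    using lipschitz by blast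
  have "norm (Y t - Z t) \<le> 0"
  proof (rule Gronwall_zero[where \<phi>="\<lambda>t. norm (Y t - Z t)", OF L(1), where T=T])
    fix u assume u: "u \<in> {0..T}"
    have int: "integral {0..u} (\<lambda>s. f s (Y s)) = Y u - Y 0" "integral {0..u} (\<lambda>s. f s (Z s)) = Z u - Z 0"
      by (rule integral_unique, rule fundamental_theorem_of_calculus,
          use u in simp, rule has_vector_derivative_within_subset[OF Y] has_vector_derivative_within_subset[OF Z]; use u in auto)+
    have "Y u - Z u = integral {0..u} (\<lambda>s. f s (Y s)) - integral {0..u} (\<lambda>s. f s (Z s))"
      unfolding int using init by simp
    also have "norm \<dots> \<le> integral {0..u} (\<lambda>s. L * norm (Y s - Z s))"
      by (rule norm_integral_diff_le)
        (use u L(2) r in \<open>auto intro!: continuous_intros sub cont simp del: mem_cball\<close>)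
    also have "\<dots> = L * integral {0..u} (\<lambda>s. norm (Y s - Z s))"
      by (rule integral_mult_right)
    finally show "norm (Y u - Z u) \<le> L * integral {0..u} (\<lambda>s. norm (Y s - Z s))" .
  qed (use t in \<open>auto intro!: continuous_intros sub\<close>)
  then show ?thesis by simp
qed

text \<open>The function \<open>exp (- A s) (1 + e s)\<close> has a nonpositive derivative.\<close>

lemma Gronwall_growth:
  fixes e :: "real \<Rightarrow> real"
  assumes "0 \<le> t" and e: "\<And>s. s \<in> {0..t} \<Longrightarrow> (e has_real_derivative e' s) (at s within {0..})"
    and le: "\<And>s. s \<in> {0..t} \<Longrightarrow> e' s \<le> A * (1 + e s)"
  shows "1 + e t \<le> (1 + e 0) * exp (A * t)"
proof -
  let ?h = "\<lambda>s. exp (- (A * s)) * (1 + e s)"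
  have h: "(?h has_real_derivative exp (- (A * s)) * (e' s - A * (1 + e s))) (at s within {0..})" if "s \<in> {0..t}" for s
    by (rule derivative_eq_intros e that refl | simp add: algebra_simps)+
  have "?h t \<le> ?h 0"
  proof (rule DERIV_nonpos_imp_decreasing_open[OF \<open>0 \<le> t\<close>])
    show "continuous_on {0..t} ?h"
      by (rule DERIV_continuous_on, rule DERIV_subset[OF h]) auto
    fix s assume s: "0 < s" "s < t"
    have "at s within {0..} = at s"
      using s by (intro at_within_nhd[of _ "{0<..}"]) auto
    then have "(?h has_real_derivative exp (- (A * s)) * (e' s - A * (1 + e s))) (at s)"
      using h[of s] s by simp
    moreover have "exp (- (A * s)) * (e' s - A * (1 + e s)) \<le> 0"
      using le[of s] s by (intro mult_nonneg_nonpos) auto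
    ultimately show "\<exists>y. (?h has_real_derivative y) (at s) \<and> y \<le> 0" by blast
  qed
  then show ?thesis by (simp add: exp_minus field_simps)
qed

section \<open>Calculus of bounded Lipschitz functions\<close>

definition bounded_lipschitz :: "'c::metric_space set \<Rightarrow> ('c \<Rightarrow> real) \<Rightarrow> bool" where
  "bounded_lipschitz S g \<longleftrightarrow> (\<exists>B. \<forall>x\<in>S. \<bar>g x\<bar> \<le> B) \<and> (\<exists>L. \<forall>x\<in>S. \<forall>y\<in>S. \<bar>g x - g y\<bar> \<le> L * dist x y)"

lemma bounded_lipschitzD:
  assumes "bounded_lipschitz S g"
  obtains K where "0 \<le> K" "\<And>x. x \<in> S \<Longrightarrow> \<bar>g x\<bar> \<le> K" "\<And>x y. x \<in> S \<Longrightarrow> y \<in> S \<Longrightarrow> \<bar>g x - g y\<bar> \<le> K * dist x y"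
proof -
  obtain B L where BL: "\<And>x. x \<in> S \<Longrightarrow> \<bar>g x\<bar> \<le> B" "\<And>x y. x \<in> S \<Longrightarrow> y \<in> S \<Longrightarrow> \<bar>g x - g y\<bar> \<le> L * dist x y"
    using assms unfolding bounded_lipschitz_def by blast
  show ?thesis
  proof (rule that[of "max 0 (max B L)"])
    show "\<bar>g x - g y\<bar> \<le> max 0 (max B L) * dist x y" if "x \<in> S" "y \<in> S" for x y
      by (rule order_trans[OF BL(2)[OF that]]) (auto intro: mult_right_mono)
    show "\<bar>g x\<bar> \<le> max 0 (max B L)" if "x \<in> S" for x
      using BL(1)[OF that] by simp
  qed simp
qed

lemma bounded_lipschitz_bound:
  assumes "bounded_lipschitz S g"
  shows "\<exists>K\<ge>0. \<forall>x\<in>S. \<forall>y\<in>S. \<bar>g x\<bar> \<le> K \<and> \<bar>g x - g y\<bar> \<le> K * dist x y"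
proof (rule bounded_lipschitzD[OF assms])
qed blast

lemma bounded_lipschitzI:
  "(\<And>x. x \<in> S \<Longrightarrow> \<bar>g x\<bar> \<le> B) \<Longrightarrow> (\<And>x y. x \<in> S \<Longrightarrow> y \<in> S \<Longrightarrow> \<bar>g x - g y\<bar> \<le> L * dist x y) \<Longrightarrow> bounded_lipschitz S g"
  unfolding bounded_lipschitz_def by blast

lemma bounded_lipschitz_const: "bounded_lipschitz S (\<lambda>x. c)"
  by (rule bounded_lipschitzI[of _ _ "\<bar>c\<bar>" 0]) auto

lemma bounded_lipschitz_add:
  assumes "bounded_lipschitz S g" "bounded_lipschitz S h"
  shows "bounded_lipschitz S (\<lambda>x. g x + h x)"
proof -
  obtain K where K: "\<And>x. x \<in> S \<Longrightarrow> \<bar>g x\<bar> \<le> K" "\<And>x y. x \<in> S \<Longrightarrow> y \<in> S \<Longrightarrow> \<bar>g x - g y\<bar> \<le> K * dist x y"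
    using bounded_lipschitzD[OF assms(1)] by metis
  obtain K' where K': "\<And>x. x \<in> S \<Longrightarrow> \<bar>h x\<bar> \<le> K'" "\<And>x y. x \<in> S \<Longrightarrow> y \<in> S \<Longrightarrow> \<bar>h x - h y\<bar> \<le> K' * dist x y"
    using bounded_lipschitzD[OF assms(2)] by metis
  show ?thesis
  proof (rule bounded_lipschitzI)
    show "\<bar>g x + h x\<bar> \<le> K + K'" if "x \<in> S" for x using K(1)[OF that] K'(1)[OF that] by linarith
    show "\<bar>g x + h x - (g y + h y)\<bar> \<le> (K + K') * dist x y" if "x \<in> S" "y \<in> S" for x y
      using K(2)[OF that] K'(2)[OF that] by (simp add: distrib_right)
  qed
qed

text \<open>Here lies the reason why boundedness belongs to the notion: in
  \<open>g x (h x - h y) + (g x - g y) h y\<close> each Lipschitz difference is multiplied by a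
  value of the other function.\<close>

lemma bounded_lipschitz_mult:
  assumes "bounded_lipschitz S g" "bounded_lipschitz S h"
  shows "bounded_lipschitz S (\<lambda>x. g x * h x)"
proof -
  obtain K where K: "0 \<le> K" "\<And>x. x \<in> S \<Longrightarrow> \<bar>g x\<bar> \<le> K" "\<And>x y. x \<in> S \<Longrightarrow> y \<in> S \<Longrightarrow> \<bar>g x - g y\<bar> \<le> K * dist x y"
    using bounded_lipschitzD[OF assms(1)] by metis
  obtain K' where K': "0 \<le> K'" "\<And>x. x \<in> S \<Longrightarrow> \<bar>h x\<bar> \<le> K'" "\<And>x y. x \<in> S \<Longrightarrow> y \<in> S \<Longrightarrow> \<bar>h x - h y\<bar> \<le> K' * dist x y"
    using bounded_lipschitzD[OF assms(2)] by metis
  show ?thesis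
  proof (rule bounded_lipschitzI)
    show "\<bar>g x * h x\<bar> \<le> K * K'" if "x \<in> S" for x
      unfolding abs_mult using K(1,2) K'(1,2) that by (intro mult_mono) auto
    show "\<bar>g x * h x - g y * h y\<bar> \<le> (2 * K * K') * dist x y" if xy: "x \<in> S" "y \<in> S" for x y
    proof -
      have "g x * h x - g y * h y = g x * (h x - h y) + (g x - g y) * h y" by (simp add: algebra_simps)
      also have "\<bar>\<dots>\<bar> \<le> \<bar>g x\<bar> * \<bar>h x - h y\<bar> + \<bar>g x - g y\<bar> * \<bar>h y\<bar>"
        by (rule order_trans[OF abs_triangle_ineq]) (simp add: abs_mult)
      also have "\<dots> \<le> K * (K' * dist x y) + (K * dist x y) * K'"
        using K K' xy by (intro add_mono mult_mono) auto
      finally show ?thesis by (simp add: algebra_simps)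
    qed
  qed
qed

lemma bounded_lipschitz_diff:
  assumes "bounded_lipschitz S g" "bounded_lipschitz S h"
  shows "bounded_lipschitz S (\<lambda>x. g x - h x)"
  using bounded_lipschitz_add[OF assms(1) bounded_lipschitz_mult[OF bounded_lipschitz_const[of S "-1"] assms(2)]]
  by simp

lemma bounded_lipschitz_compose:
  assumes "bounded_lipschitz S g" "bounded_lipschitz (g ` S) \<psi>"
  shows "bounded_lipschitz S (\<lambda>x. \<psi> (g x))"
proof -
  obtain K where K: "\<And>x. x \<in> S \<Longrightarrow> \<bar>g x\<bar> \<le> K" "\<And>x y. x \<in> S \<Longrightarrow> y \<in> S \<Longrightarrow> \<bar>g x - g y\<bar> \<le> K * dist x y"
    using bounded_lipschitzD[OF assms(1)] by metis
  obtain K' where K': "0 \<le> K'" "\<And>x. x \<in> g ` S \<Longrightarrow> \<bar>\<psi> x\<bar> \<le> K'" "\<And>x y. x \<in> g ` S \<Longrightarrow> y \<in> g ` S \<Longrightarrow> \<bar>\<psi> x - \<psi> y\<bar> \<le> K' * dist x y"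
    using bounded_lipschitzD[OF assms(2)] by metis
  show ?thesis
  proof (rule bounded_lipschitzI)
    show "\<bar>\<psi> (g x) - \<psi> (g y)\<bar> \<le> (K' * K) * dist x y" if xy: "x \<in> S" "y \<in> S" for x y
    proof -
      have "\<bar>\<psi> (g x) - \<psi> (g y)\<bar> \<le> K' * \<bar>g x - g y\<bar>"
        using K'(3)[of "g x" "g y"] xy by (simp add: dist_real_def)
      also have "\<dots> \<le> K' * (K * dist x y)"
        using K(2)[OF xy] K'(1) by (rule mult_left_mono)
      finally show ?thesis by simp
    qed
  qed (use K' in auto)
qed

lemma bounded_lipschitz_sin_cos: "bounded_lipschitz S sin" "bounded_lipschitz S cos"
proof -
  have "\<bar>f x - f y\<bar> \<le> 1 * dist x y"
    if "\<And>z. (f has_field_derivative f' z) (at z within UNIV)" "\<And>z. \<bar>f' z\<bar> \<le> 1" for x y and f f' :: "real \<Rightarrow> real"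
    using field_differentiable_bound[of UNIV f f' 1 x y] that by (simp add: dist_real_def)
  from this[of sin cos] this[of cos "\<lambda>z. - sin z"]
  show "bounded_lipschitz S sin" "bounded_lipschitz S cos"
    by (auto intro!: bounded_lipschitzI[of _ _ 1 1] derivative_eq_intros)
qed

lemma bounded_lipschitz_sin:
  assumes "bounded_lipschitz S g" shows "bounded_lipschitz S (\<lambda>x. sin (g x))"
  by (rule bounded_lipschitz_compose[OF assms bounded_lipschitz_sin_cos(1)])

lemma bounded_lipschitz_cos:
  assumes "bounded_lipschitz S g" shows "bounded_lipschitz S (\<lambda>x. cos (g x))"
  by (rule bounded_lipschitz_compose[OF assms bounded_lipschitz_sin_cos(2)])

lemma bounded_lipschitz_divide:
  assumes "bounded_lipschitz S g" "bounded_lipschitz S h" "0 < c" "\<And>x. x \<in> S \<Longrightarrow> c \<le> h x"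
  shows "bounded_lipschitz S (\<lambda>x. g x / h x)"
proof -
  have "bounded_lipschitz (h ` S) (\<lambda>z. 1 / z)"
  proof (rule bounded_lipschitzI)
    show "\<bar>1 / z\<bar> \<le> 1 / c" if "z \<in> h ` S" for z
    proof -
      have "c \<le> z" using assms(4) that by auto
      with assms(3) show ?thesis by (simp add: frac_le)
    qed
    show "\<bar>1 / x - 1 / y\<bar> \<le> 1 / c\<^sup>2 * dist x y" if "x \<in> h ` S" "y \<in> h ` S" for x y
    proof -
      have xy: "c \<le> x" "c \<le> y" using that assms by auto
      then have "0 < x" "0 < y" using assms(3) by auto
      then have "\<bar>1 / x - 1 / y\<bar> = \<bar>x - y\<bar> / (x * y)" by (simp add: field_simps abs_minus_commute)
      also have "\<dots> \<le> \<bar>x - y\<bar> / (c * c)"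
        using xy assms(3) by (intro divide_left_mono mult_mono) auto
      finally show ?thesis by (simp add: dist_real_def power2_eq_square)
    qed
  qed
  from bounded_lipschitz_mult[OF assms(1) bounded_lipschitz_compose[OF assms(2) this]]
  show ?thesis by simp
qed

lemmas bounded_lipschitz_intros = bounded_lipschitz_const bounded_lipschitz_add bounded_lipschitz_diff
  bounded_lipschitz_mult bounded_lipschitz_sin bounded_lipschitz_cos

section \<open>Cutoff of a locally Lipschitz field\<close>

definition cutoff :: "real \<Rightarrow> 'b::real_normed_vector \<Rightarrow> real" where
  "cutoff r x = max 0 (min 1 (r + 1 - norm x))"

lemma cutoff: "0 \<le> cutoff r x" "cutoff r x \<le> 1" "norm x \<le> r \<Longrightarrow> cutoff r x = 1"
    "r + 1 \<le> norm x \<Longrightarrow> cutoff r x = 0" "\<bar>cutoff r x - cutoff r y\<bar> \<le> norm (x - y)"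
  using norm_triangle_ineq3[of x y] by (auto simp: cutoff_def)

text \<open>Bounds on the ball of radius \<open>r + 1\<close> suffice because the cutoff vanishes
  outside. If both points lie inside, the product rule applies; if one lies outside, the cutoff at
  the other is at most their distance.\<close>

lemma cutoff_lipschitz:
  fixes f :: "'b::real_normed_vector \<Rightarrow> 'b"
  assumes L: "0 \<le> L" "\<And>x y. norm x \<le> r + 1 \<Longrightarrow> norm y \<le> r + 1 \<Longrightarrow> norm (f x - f y) \<le> L * norm (x - y)"
    and K: "0 \<le> K" "\<And>x. norm x \<le> r + 1 \<Longrightarrow> norm (f x) \<le> K"
  shows "norm (cutoff r x *\<^sub>R f x - cutoff r y *\<^sub>R f y) \<le> (L + K) * norm (x - y)"
proof -
  have one: "norm (cutoff r x *\<^sub>R f x - cutoff r y *\<^sub>R f y) \<le> (L + K) * norm (x - y)"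
    if y: "r + 1 \<le> norm y" for x y
  proof (cases "norm x \<le> r + 1")
    case True
    have "norm (cutoff r x *\<^sub>R f x) \<le> norm (x - y) * K"
      using cutoff(1,5)[of r x] cutoff(4)[OF y] K True cutoff(5)[of r x y]
      by (auto intro!: mult_mono)
    also have "\<dots> \<le> (L + K) * norm (x - y)" using L(1) by (simp add: algebra_simps)
    finally show ?thesis using cutoff(4)[OF y] by simp
  next
    case False
    then show ?thesis using cutoff(4)[OF y] cutoff(4)[of r x] L(1) K(1) by simp
  qed
  show ?thesis
  proof (cases "norm x \<le> r + 1 \<and> norm y \<le> r + 1")
    case True
    have "cutoff r x *\<^sub>R f x - cutoff r y *\<^sub>R f y = cutoff r x *\<^sub>R (f x - f y) + (cutoff r x - cutoff r y) *\<^sub>R f y"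
      by (simp add: algebra_simps)
    also have "norm \<dots> \<le> cutoff r x * norm (f x - f y) + \<bar>cutoff r x - cutoff r y\<bar> * norm (f y)"
      by (rule order_trans[OF norm_triangle_ineq]) (simp add: cutoff(1))
    also have "\<dots> \<le> 1 * (L * norm (x - y)) + norm (x - y) * K"
      using True K L cutoff(1,2)[of r x] cutoff(5)[of r x y] by (intro add_mono mult_mono) auto
    finally show ?thesis by (simp add: algebra_simps)
  next
    case False
    then show ?thesis
      using one[of y x] one[of x y] by (auto simp: norm_minus_commute)
  qed
qed


section \<open>The pendulum with additive noise\<close>

lemma norm_tuple4: "norm X \<le> \<bar>fst X\<bar> + (\<bar>fst (snd X)\<bar> + (\<bar>fst (snd (snd X))\<bar> + \<bar>snd (snd (snd X))\<bar>))"
  for X :: "real \<times> real \<times> real \<times> real"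
proof -
  have n2: "norm (a, b) \<le> \<bar>a\<bar> + norm b" for a :: real and b :: "'z::real_normed_vector"
    using sqrt_sum_squares_le_sum_abs[of "\<bar>a\<bar>" "norm b"] by (simp add: norm_Pair)
  obtain a b c d where X: "X = (a, b, c, d)" by (cases X)
  show ?thesis
    using n2[of a "(b, c, d)"] n2[of b "(c, d)"] n2[of c d] unfolding X by simp
qed

locale pendulum =
  fixes R \<zeta>1 \<zeta>2 chi \<kappa> \<nu> :: real
  assumes R: "0 < R" "R < 1" and pos: "0 < \<zeta>1" "0 < \<zeta>2" "0 < chi" "0 < \<kappa>" "0 < \<nu>"
begin

definition den :: "real \<Rightarrow> real" where
  "den \<theta> = 1 - R * (sin \<theta>)\<^sup>2"

text \<open>In terms of the velocities \<open>v, u\<close> the momenta are \<open>m = v - R u sin \<theta>\<close> and \<open>q = u - v sin \<theta>\<close>;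
  this is the inverse transformation.\<close>

definition vel :: "real \<Rightarrow> real \<Rightarrow> real \<Rightarrow> real" where
  "vel m \<theta> q = (m + R * sin \<theta> * q) / den \<theta>"

definition ang :: "real \<Rightarrow> real \<Rightarrow> real \<Rightarrow> real" where
  "ang m \<theta> q = (q + sin \<theta> * m) / den \<theta>"

lemma R_sin_le: "R * (sin \<theta>)\<^sup>2 \<le> R"
proof -
  have "(sin \<theta>)\<^sup>2 \<le> 1" by (simp add: abs_square_le_1)
  then show ?thesis using R(1) by (simp add: mult_left_le)
qed

lemma den: "1 - R \<le> den \<theta>" "den \<theta> \<le> 1" "0 < den \<theta>" "den \<theta> \<noteq> 0"
proof -
  have "0 \<le> R * (sin \<theta>)\<^sup>2" using R by simp
  then show "1 - R \<le> den \<theta>" "den \<theta> \<le> 1" "0 < den \<theta>" "den \<theta> \<noteq> 0"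
    using R_sin_le[of \<theta>] R unfolding den_def by linarith+
qed

lemma vel_ang: "vel m \<theta> q - R * ang m \<theta> q * sin \<theta> = m" "ang m \<theta> q - vel m \<theta> q * sin \<theta> = q"
proof -
  have "vel m \<theta> q - R * ang m \<theta> q * sin \<theta> = (m * den \<theta>) / den \<theta>"
    unfolding vel_def ang_def den_def by (simp add: algebra_simps power2_eq_square add_divide_distrib diff_divide_distrib)
  then show "vel m \<theta> q - R * ang m \<theta> q * sin \<theta> = m" using den by simp
  have "ang m \<theta> q - vel m \<theta> q * sin \<theta> = (q * den \<theta>) / den \<theta>"
    unfolding vel_def ang_def den_def by (simp add: algebra_simps power2_eq_square add_divide_distrib diff_divide_distrib)
  then show "ang m \<theta> q - vel m \<theta> q * sin \<theta> = q" using den by simp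
qed

text \<open>The velocities are affine in the momentum, and for \<open>d = \<nu> w\<close> the added
  terms are \<open>w\<close> times the noise coefficients of the original system. Removing the noise
  from the momentum is therefore the same as subtracting coefficient times noise from the
  velocities.\<close>

lemma vel_ang_shift: "vel (m + d) \<theta> q = vel m \<theta> q + d / den \<theta>" "ang (m + d) \<theta> q = ang m \<theta> q + sin \<theta> * d / den \<theta>"
  by (simp_all add: vel_def ang_def add_divide_distrib algebra_simps)

lemma vel_ang_velocities:
  "vel (v - R * u * sin \<theta>) \<theta> (u - v * sin \<theta>) = v" "ang (v - R * u * sin \<theta>) \<theta> (u - v * sin \<theta>) = u"
proof -
  have "v - R * u * sin \<theta> + R * sin \<theta> * (u - v * sin \<theta>) = v * den \<theta>"
       "u - v * sin \<theta> + sin \<theta> * (v - R * u * sin \<theta>) = u * den \<theta>"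
    by (auto simp: den_def algebra_simps power2_eq_square)
  then show "vel (v - R * u * sin \<theta>) \<theta> (u - v * sin \<theta>) = v" "ang (v - R * u * sin \<theta>) \<theta> (u - v * sin \<theta>) = u"
    using den by (auto simp: vel_def ang_def)
qed

text \<open>The random vector field for \<open>(v\<^sub>1, m - \<nu> w, \<theta>, q)\<close>, where \<open>w\<close> is the current value of the noise.\<close>

definition field :: "real \<Rightarrow> real \<times> real \<times> real \<times> real \<Rightarrow> real \<times> real \<times> real \<times> real" where
  "field w = (\<lambda>(p, y, \<theta>, q).
     let v = vel (y + \<nu> * w) \<theta> q; u = ang (y + \<nu> * w) \<theta> q
     in (v, - 2 * \<zeta>1 * v - chi\<^sup>2 * p, u, - 2 * \<zeta>2 * u - \<kappa>\<^sup>2 * sin \<theta> - v * u * cos \<theta>))"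

text \<open>The noise value is treated as a fifth coordinate, so the constant is uniform in
  \<open>w\<close>. Every component is built from coordinates by sums, products, sine, cosine and
  division by \<open>den\<close>, which is at least \<open>1 - R\<close>.\<close>

lemma field_bounded_lipschitz:
  "\<exists>K\<ge>0. \<forall>w Y Z. \<bar>w\<bar> \<le> B \<longrightarrow> norm Y \<le> r \<longrightarrow> norm Z \<le> r \<longrightarrow>
     norm (field w Y) \<le> K \<and> norm (field w Y - field w Z) \<le> K * norm (Y - Z)"
proof -
  let ?S = "{x :: real \<times> real \<times> real \<times> real \<times> real. \<bar>fst x\<bar> \<le> B \<and> norm (snd x) \<le> r}"
  let ?w = "\<lambda>x :: real \<times> real \<times> real \<times> real \<times> real. fst x"
  let ?p = "\<lambda>x :: real \<times> real \<times> real \<times> real \<times> real. fst (snd x)"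
  let ?y = "\<lambda>x :: real \<times> real \<times> real \<times> real \<times> real. fst (snd (snd x))"
  let ?t = "\<lambda>x :: real \<times> real \<times> real \<times> real \<times> real. fst (snd (snd (snd x)))"
  let ?q = "\<lambda>x :: real \<times> real \<times> real \<times> real \<times> real. snd (snd (snd (snd x)))"
  have fst_le: "\<bar>a\<bar> \<le> norm (a, b)" and snd_le: "norm b \<le> norm (a, b)" for a :: real and b :: "'z::real_normed_vector"
    using norm_fst_le[of a b] norm_snd_le[of b a] by auto
  have comp: "\<bar>a\<bar> \<le> norm (a, b, c, d)" "\<bar>b\<bar> \<le> norm (a, b, c, d)" "\<bar>c\<bar> \<le> norm (a, b, c, d)" "\<bar>d\<bar> \<le> norm (a, b, c, d)"
    for a b c d :: real
    using fst_le[of a "(b, c, d)"] snd_le[of "(b, c, d)" a] fst_le[of b "(c, d)"] snd_le[of "(c, d)" b]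
      fst_le[of c d] snd_le[of d c] by auto
  have comp': "\<bar>fst X\<bar> \<le> norm X" "\<bar>fst (snd X)\<bar> \<le> norm X" "\<bar>fst (snd (snd X))\<bar> \<le> norm X" "\<bar>snd (snd (snd X))\<bar> \<le> norm X"
    for X :: "real \<times> real \<times> real \<times> real"
    by (cases X; use comp in simp)+
  have w: "bounded_lipschitz ?S ?w"
  proof (rule bounded_lipschitzI)
    show "\<bar>fst x - fst y\<bar> \<le> 1 * dist x y" for x y :: "real \<times> real \<times> real \<times> real \<times> real"
      using dist_fst_le[of x y] by (simp add: dist_real_def)
  qed auto
  have coordinate: "bounded_lipschitz ?S (\<lambda>x. c (snd x))"
    if c: "\<And>X. \<bar>c X\<bar> \<le> norm X" "\<And>X Y. c (X - Y) = c X - c Y"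
    for c :: "real \<times> real \<times> real \<times> real \<Rightarrow> real"
  proof (rule bounded_lipschitzI)
    show "\<bar>c (snd x)\<bar> \<le> r" if "x \<in> ?S" for x
      using c(1)[of "snd x"] that by auto
    show "\<bar>c (snd x) - c (snd y)\<bar> \<le> 1 * dist x y" for x y
      using c(1)[of "snd x - snd y"] dist_snd_le[of x y] by (simp add: c(2) dist_norm)
  qed
  have coord: "bounded_lipschitz ?S ?p" "bounded_lipschitz ?S ?y" "bounded_lipschitz ?S ?t" "bounded_lipschitz ?S ?q"
    using coordinate[of fst] coordinate[of "\<lambda>X. fst (snd X)"] coordinate[of "\<lambda>X. fst (snd (snd X))"]
      coordinate[of "\<lambda>X. snd (snd (snd X))"] comp' by simp_all
  define V where "V x = vel (?y x + \<nu> * ?w x) (?t x) (?q x)" for x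
  define U where "U x = ang (?y x + \<nu> * ?w x) (?t x) (?q x)" for x
  have bl_den: "bounded_lipschitz ?S (\<lambda>x. den (?t x))"
    unfolding den_def power2_eq_square by (intro bounded_lipschitz_intros coord)
  have V: "bounded_lipschitz ?S V" and U: "bounded_lipschitz ?S U"
    unfolding V_def U_def vel_def ang_def
    by (intro bounded_lipschitz_divide[OF _ bl_den, of _ "1 - R"] bounded_lipschitz_intros w coord; use R den in simp)+
  have field: "field (fst x) (snd x) = (V x, - 2 * \<zeta>1 * V x - chi\<^sup>2 * ?p x, U x,
      - 2 * \<zeta>2 * U x - \<kappa>\<^sup>2 * sin (?t x) - V x * U x * cos (?t x))" for x
    by (simp add: field_def V_def U_def case_prod_beta' Let_def)
  have c1: "bounded_lipschitz ?S (\<lambda>x. fst (field (fst x) (snd x)))"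
    and c2: "bounded_lipschitz ?S (\<lambda>x. fst (snd (field (fst x) (snd x))))"
    and c3: "bounded_lipschitz ?S (\<lambda>x. fst (snd (snd (field (fst x) (snd x)))))"
    and c4: "bounded_lipschitz ?S (\<lambda>x. snd (snd (snd (field (fst x) (snd x)))))"
    unfolding field fst_conv snd_conv
    by (rule V U | rule bounded_lipschitz_intros coord)+
  obtain K1 where K1: "0 \<le> K1" "\<forall>x\<in>?S. \<forall>y\<in>?S. \<bar>fst (field (fst x) (snd x))\<bar> \<le> K1 \<and>
      \<bar>fst (field (fst x) (snd x)) - fst (field (fst y) (snd y))\<bar> \<le> K1 * dist x y"
    using bounded_lipschitz_bound[OF c1] by blast
  obtain K2 where K2: "0 \<le> K2" "\<forall>x\<in>?S. \<forall>y\<in>?S. \<bar>fst (snd (field (fst x) (snd x)))\<bar> \<le> K2 \<and>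
      \<bar>fst (snd (field (fst x) (snd x))) - fst (snd (field (fst y) (snd y)))\<bar> \<le> K2 * dist x y"
    using bounded_lipschitz_bound[OF c2] by blast
  obtain K3 where K3: "0 \<le> K3" "\<forall>x\<in>?S. \<forall>y\<in>?S. \<bar>fst (snd (snd (field (fst x) (snd x))))\<bar> \<le> K3 \<and>
      \<bar>fst (snd (snd (field (fst x) (snd x)))) - fst (snd (snd (field (fst y) (snd y))))\<bar> \<le> K3 * dist x y"
    using bounded_lipschitz_bound[OF c3] by blast
  obtain K4 where K4: "0 \<le> K4" "\<forall>x\<in>?S. \<forall>y\<in>?S. \<bar>snd (snd (snd (field (fst x) (snd x))))\<bar> \<le> K4 \<and>
      \<bar>snd (snd (snd (field (fst x) (snd x)))) - snd (snd (snd (field (fst y) (snd y))))\<bar> \<le> K4 * dist x y"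
    using bounded_lipschitz_bound[OF c4] by blast
  show ?thesis
  proof (intro exI[of _ "K1 + (K2 + (K3 + K4))"] conjI allI impI)
    show "0 \<le> K1 + (K2 + (K3 + K4))" using K1 K2 K3 K4 by simp
    fix w :: real and Y Z :: "real \<times> real \<times> real \<times> real" assume *: "\<bar>w\<bar> \<le> B" "norm Y \<le> r" "norm Z \<le> r"
    have S: "(w, Y) \<in> ?S" "(w, Z) \<in> ?S" using * by auto
    have d: "dist (w, Y) (w, Z) = norm (Y - Z)" by (simp add: dist_Pair_Pair dist_norm)
    note bounds = K1(2)[THEN bspec, OF S(1), THEN bspec, OF S(2)] K2(2)[THEN bspec, OF S(1), THEN bspec, OF S(2)]
      K3(2)[THEN bspec, OF S(1), THEN bspec, OF S(2)] K4(2)[THEN bspec, OF S(1), THEN bspec, OF S(2)]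
    show "norm (field w Y) \<le> K1 + (K2 + (K3 + K4))"
      using bounds by (intro order_trans[OF norm_tuple4] add_mono) auto
    show "norm (field w Y - field w Z) \<le> (K1 + (K2 + (K3 + K4))) * norm (Y - Z)"
      unfolding distrib_right using bounds unfolding d
      by (intro order_trans[OF norm_tuple4] add_mono) auto
  qed
qed

lemma continuous_on_den: "continuous_on S \<theta> \<Longrightarrow> continuous_on S (\<lambda>t. den (\<theta> t))" for S :: "'c::t2_space set"
  unfolding den_def by (intro continuous_intros)

lemma continuous_on_vel_ang:
  fixes S :: "'c::t2_space set"
  assumes "continuous_on S m" "continuous_on S \<theta>" "continuous_on S q"
  shows "continuous_on S (\<lambda>t. vel (m t) (\<theta> t) (q t))" "continuous_on S (\<lambda>t. ang (m t) (\<theta> t) (q t))"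
  unfolding vel_def ang_def
  by (rule continuous_on_divide[OF _ continuous_on_den[OF assms(2)]], intro continuous_intros assms, simp add: den(4))+

lemma field_continuous:
  fixes S :: "'c::t2_space set"
  assumes w: "continuous_on S w" and Y: "continuous_on S Y"
  shows "continuous_on S (\<lambda>t. field (w t) (Y t))"
proof -
  have c: "continuous_on S (\<lambda>t. fst (Y t))" "continuous_on S (\<lambda>t. fst (snd (Y t)))"
    "continuous_on S (\<lambda>t. fst (snd (snd (Y t))))" "continuous_on S (\<lambda>t. snd (snd (snd (Y t))))"
    by (intro continuous_on_fst continuous_on_snd Y)+
  note vu = continuous_on_vel_ang[OF continuous_on_add[OF c(2) continuous_on_mult_left[OF w, of \<nu>]] c(3,4)]
  show ?thesis
    unfolding field_def case_prod_beta' Let_def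
    by (intro continuous_on_Pair continuous_on_diff continuous_on_mult continuous_on_const
        continuous_on_sin continuous_on_cos vu c)
qed

text \<open>The cutoff multiplies the field by a factor in \<open>[0, 1]\<close>, so the energy bound below holds for it
  uniformly in \<open>r\<close>.\<close>

definition cut_field :: "real \<Rightarrow> real \<Rightarrow> real \<times> real \<times> real \<times> real \<Rightarrow> real \<times> real \<times> real \<times> real" where
  "cut_field r w Y = cutoff r Y *\<^sub>R field w Y"

lemma cut_field_continuous:
  fixes S :: "'c::t2_space set"
  assumes "continuous_on S w" "continuous_on S Y"
  shows "continuous_on S (\<lambda>t. cut_field r (w t) (Y t))"
  unfolding cut_field_def cutoff_def by (intro continuous_intros field_continuous assms)

lemma bounded_on_compact:
  fixes w :: "real \<Rightarrow> real"
  assumes "continuous_on {0..} w"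
  obtains B where "0 \<le> B" "\<And>t. t \<in> {0..T} \<Longrightarrow> \<bar>w t\<bar> \<le> B"
proof -
  have "bounded (w ` {0..T})"
    by (intro compact_imp_bounded compact_continuous_image compact_Icc continuous_on_subset[OF assms]) auto
  then obtain B where "\<forall>x\<in>w ` {0..T}. norm x \<le> B" unfolding bounded_iff by blast
  then show ?thesis by (intro that[of "max 0 B"]) force+
qed

lemma cut_field_ode:
  assumes w: "continuous_on {0..} w"
  shows "globally_lipschitz_ode (\<lambda>t. cut_field r (w t))"
proof
  show "continuous_on {0..} (\<lambda>s. cut_field r (w s) (Z s))" if "continuous_on {0..} Z" for Z
    by (rule cut_field_continuous[OF w that])
  fix T
  obtain B where B: "\<And>t. t \<in> {0..T} \<Longrightarrow> \<bar>w t\<bar> \<le> B" using bounded_on_compact[OF w] by metis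
  obtain K where K: "0 \<le> K" "\<And>w Y Z. \<bar>w\<bar> \<le> B \<Longrightarrow> norm Y \<le> r + 1 \<Longrightarrow> norm Z \<le> r + 1 \<Longrightarrow>
     norm (field w Y) \<le> K \<and> norm (field w Y - field w Z) \<le> K * norm (Y - Z)"
    using field_bounded_lipschitz[of B "r + 1"] by blast
  show "\<exists>L\<ge>0. \<forall>t\<in>{0..T}. \<forall>x y. norm (cut_field r (w t) x - cut_field r (w t) y) \<le> L * norm (x - y)"
  proof (intro exI[of _ "K + K"] conjI ballI allI)
    fix t x y assume "t \<in> {0..T}"
    then show "norm (cut_field r (w t) x - cut_field r (w t) y) \<le> (K + K) * norm (x - y)"
      unfolding cut_field_def using K B by (intro cutoff_lipschitz) blast+
  qed (use K in simp)
qed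

lemma field_unique:
  assumes w: "continuous_on {0..} w"
    and Y: "\<And>t. t \<in> {0..T} \<Longrightarrow> (Y has_vector_derivative field (w t) (Y t)) (at t within {0..})"
    and Z: "\<And>t. t \<in> {0..T} \<Longrightarrow> (Z has_vector_derivative field (w t) (Z t)) (at t within {0..})"
    and "Y 0 = Z 0" "t \<in> {0..T}"
  shows "Y t = Z t"
proof (rule ode_unique[where f="\<lambda>t. field (w t)", OF Y Z])
  show "continuous_on {0..t} (\<lambda>s. field (w s) (Z s))" if "continuous_on {0..t} Z" for t Z
    by (intro field_continuous that continuous_on_subset[OF w]) auto
  fix r
  obtain B where B: "\<And>t. t \<in> {0..T} \<Longrightarrow> \<bar>w t\<bar> \<le> B" using bounded_on_compact[OF w] by metis
  obtain K where K: "0 \<le> K" "\<And>w Y Z. \<bar>w\<bar> \<le> B \<Longrightarrow> norm Y \<le> r \<Longrightarrow> norm Z \<le> r \<Longrightarrow>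
     norm (field w Y) \<le> K \<and> norm (field w Y - field w Z) \<le> K * norm (Y - Z)"
    using field_bounded_lipschitz[of B r] by blast
  show "\<exists>L\<ge>0. \<forall>t\<in>{0..T}. \<forall>x\<in>cball 0 r. \<forall>y\<in>cball 0 r. norm (field (w t) x - field (w t) y) \<le> L * norm (x - y)"
    using K B by (intro exI[of _ K]) (auto simp: dist_norm)
qed (use assms in auto)

text \<open>The fraction is the kinetic energy written in the momenta, followed by the spring energy
  and the cross term that makes \<open>p\<close> dissipate. The potential of the angle, a multiple
  of \<open>cos \<theta>\<close>, is left out; its bounded force is treated as a
  perturbation.\<close>

definition lyap :: "real \<Rightarrow> real \<Rightarrow> real \<Rightarrow> real \<Rightarrow> real \<Rightarrow> real" where
  "lyap \<epsilon> p m \<theta> q = (m\<^sup>2 + 2 * R * sin \<theta> * m * q + R * q\<^sup>2) / (2 * den \<theta>) + chi\<^sup>2 / 2 * p\<^sup>2 + \<epsilon> * p * m"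

text \<open>By duality of velocities and momenta the partial derivatives of the kinetic energy in
  \<open>m\<close>, \<open>q\<close> and \<open>\<theta>\<close> are \<open>vel\<close>,
  \<open>R ang\<close> and \<open>R cos \<theta> ang vel\<close>.\<close>

lemma lyap_derivative:
  assumes p: "(p has_real_derivative p') (at t within S)" and y: "(y has_real_derivative y') (at t within S)"
    and \<theta>: "(\<theta> has_real_derivative \<theta>') (at t within S)" and q: "(q has_real_derivative q') (at t within S)"
  shows "((\<lambda>s. lyap \<epsilon> (p s) (y s) (\<theta> s) (q s)) has_real_derivative
      vel (y t) (\<theta> t) (q t) * y' + R * ang (y t) (\<theta> t) (q t) * q'
      + R * cos (\<theta> t) * ang (y t) (\<theta> t) (q t) * vel (y t) (\<theta> t) (q t) * \<theta>'
      + chi\<^sup>2 * p t * p' + \<epsilon> * (p' * y t + p t * y')) (at t within S)"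
proof -
  define s c m z D where "s = sin (\<theta> t)" and "c = cos (\<theta> t)" and "m = y t" and "z = q t" and "D = den (\<theta> t)"
  let ?N = "\<lambda>t. (y t)\<^sup>2 + 2 * R * sin (\<theta> t) * y t * q t + R * (q t)\<^sup>2"
  define N' where "N' = 2 * m * y' + 2 * R * (c * \<theta>' * m * z + s * y' * z + s * m * q') + 2 * R * z * q'"
  have N: "(?N has_real_derivative N') (at t within S)"
    unfolding N'_def s_def c_def m_def z_def
    by (rule derivative_eq_intros p y \<theta> q refl | simp add: algebra_simps)+
  have den': "((\<lambda>t. 2 * den (\<theta> t)) has_real_derivative - (4 * R * s * c * \<theta>')) (at t within S)"
    unfolding s_def c_def den_def
    by (rule derivative_eq_intros p y \<theta> q refl | simp add: algebra_simps)+
  have D: "D \<noteq> 0" using den unfolding D_def by blast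
  have D2: "2 * den (\<theta> t) \<noteq> 0" using den by simp
  have p2: "((\<lambda>t. chi\<^sup>2 / 2 * (p t)\<^sup>2) has_real_derivative chi\<^sup>2 * p t * p') (at t within S)"
    by (rule derivative_eq_intros p refl | simp)+
  have py: "((\<lambda>t. \<epsilon> * p t * y t) has_real_derivative \<epsilon> * (p' * y t + p t * y')) (at t within S)"
    by (rule derivative_eq_intros p y refl | simp add: algebra_simps)+
  have "((\<lambda>t. ?N t / (2 * den (\<theta> t)) + chi\<^sup>2 / 2 * (p t)\<^sup>2 + \<epsilon> * p t * y t) has_real_derivative
    (N' * (2 * D) - (m\<^sup>2 + 2 * R * s * m * z + R * z\<^sup>2) * - (4 * R * s * c * \<theta>')) / (2 * D * (2 * D))
      + chi\<^sup>2 * p t * p' + \<epsilon> * (p' * y t + p t * y')) (at t within S)"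
    using DERIV_add[OF DERIV_add[OF DERIV_divide[OF N den' D2] p2] py]
    unfolding D_def m_def z_def s_def .
  moreover have "(N' * (2 * D) - (m\<^sup>2 + 2 * R * s * m * z + R * z\<^sup>2) * - (4 * R * s * c * \<theta>')) / (2 * D * (2 * D))
    = (m + R * s * z) / D * y' + R * ((z + s * m) / D) * q' + R * c * ((z + s * m) / D) * ((m + R * s * z) / D) * \<theta>'"
  proof -
    \<comment> \<open>This identity lets the derivative of the denominator combine with that of the
      numerator into the product of the two velocities.\<close>
    have "(m\<^sup>2 + 2 * R * s * m * z + R * z\<^sup>2) * s + m * z * D = (m + R * s * z) * (z + s * m)"
      unfolding D_def den_def s_def[symmetric] by (simp add: algebra_simps power2_eq_square)
    then have key: "(m\<^sup>2 + 2 * R * s * m * z + R * z\<^sup>2) * s = (m + R * s * z) * (z + s * m) - m * z * D" by simp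
    have "N' * (2 * D) - (m\<^sup>2 + 2 * R * s * m * z + R * z\<^sup>2) * - (4 * R * s * c * \<theta>')
      = N' * (2 * D) + 4 * R * c * \<theta>' * ((m\<^sup>2 + 2 * R * s * m * z + R * z\<^sup>2) * s)" by simp
    also have "\<dots> = 4 * D * ((m + R * s * z) * y') + 4 * D * (R * (z + s * m) * q') + 4 * (R * c * (z + s * m) * (m + R * s * z) * \<theta>')"
      unfolding key N'_def by (simp add: algebra_simps)
    finally have eq: "N' * (2 * D) - (m\<^sup>2 + 2 * R * s * m * z + R * z\<^sup>2) * - (4 * R * s * c * \<theta>') = \<dots>" .
    have "(4 * D * (A * y') + 4 * D * (R * B * q') + 4 * (R * c * B * A * \<theta>')) / (2 * D * (2 * D))
      = A / D * y' + R * (B / D) * q' + R * c * (B / D) * (A / D) * \<theta>'" for A B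
      using D by (simp add: field_simps)
    then show ?thesis unfolding eq .
  qed
  ultimately show ?thesis
    unfolding lyap_def vel_def ang_def by (simp add: s_def c_def m_def z_def D_def)
qed

text \<open>In velocities the denominator disappears: the quadratic form of the momenta is
  \<open>den\<close> times that of the velocities.\<close>

lemma kinetic_velocities:
  "(m\<^sup>2 + 2 * R * sin \<theta> * m * q + R * q\<^sup>2) / (2 * den \<theta>)
   = ((vel m \<theta> q)\<^sup>2 - 2 * R * sin \<theta> * vel m \<theta> q * ang m \<theta> q + R * (ang m \<theta> q)\<^sup>2) / 2"
proof -
  define v u s where "v = vel m \<theta> q" and "u = ang m \<theta> q" and "s = sin \<theta>"
  have m: "m = v - R * u * s" and q: "q = u - v * s"
    using vel_ang[of m \<theta> q] by (auto simp: v_def u_def s_def)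
  have "m\<^sup>2 + 2 * R * s * m * q + R * q\<^sup>2 = (v\<^sup>2 - 2 * R * s * v * u + R * u\<^sup>2) * den \<theta>"
    unfolding m q den_def s_def[symmetric] by (simp add: algebra_simps power2_eq_square)
  then show ?thesis
    using den[of \<theta>] unfolding v_def[symmetric] u_def[symmetric] s_def[symmetric] by simp
qed

lemma kinetic_lower_bound:
  "R * (1 - R) / 2 * (v\<^sup>2 + u\<^sup>2) \<le> v\<^sup>2 - 2 * R * sin \<theta> * v * u + R * u\<^sup>2"
proof -
  define s where "s = sin \<theta>"
  have s: "s\<^sup>2 \<le> 1" by (simp add: s_def abs_square_le_1)
  have "R * R * s\<^sup>2 \<le> R * R * 1" using R s by (intro mult_left_mono) auto
  moreover have "0 \<le> (1 - R)\<^sup>2" by simp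
  ultimately have a: "R\<^sup>2 * s\<^sup>2 \<le> ((1 + R) / 2)\<^sup>2 * R * 1" if "R * s\<^sup>2 \<le> ((1 + R) / 2)\<^sup>2"
    using mult_left_mono[OF that, of R] R by (simp add: power2_eq_square algebra_simps)
  have b: "R * s\<^sup>2 \<le> ((1 + R) / 2)\<^sup>2"
  proof -
    have "R * s\<^sup>2 \<le> R" using s R by (simp add: mult_left_le)
    also have "R \<le> ((1 + R) / 2)\<^sup>2" using \<open>0 \<le> (1 - R)\<^sup>2\<close> by (simp add: power2_eq_square field_simps)
    finally show ?thesis .
  qed
  \<comment> \<open>The form is split into the part with diagonal weight \<open>h\<close>, which is
    nonnegative since \<open>R s^2 \<le> R \<le> h^2\<close>, and a remainder with weight
    \<open>1 - h = (1 - R) / 2\<close>, which is the lower bound.\<close>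
  define h where "h = (1 + R) / 2"
  have h: "0 < h" using R by (simp add: h_def)
  have "h * (h * v\<^sup>2 - 2 * R * s * v * u + h * R * u\<^sup>2) = (h * v - R * s * u)\<^sup>2 + (h\<^sup>2 * R - R\<^sup>2 * s\<^sup>2) * u\<^sup>2"
    by (simp add: power2_eq_square algebra_simps)
  also have "\<dots> \<ge> 0" using a[OF b] by (simp add: h_def)
  finally have pos: "0 \<le> h * v\<^sup>2 - 2 * R * s * v * u + h * R * u\<^sup>2"
    using h by (simp add: zero_le_mult_iff)
  have "R * (1 - R) / 2 * v\<^sup>2 \<le> (1 - R) / 2 * v\<^sup>2"
    using R by (intro mult_right_mono) (auto simp: mult_left_le_one_le)
  then show ?thesis
    using pos unfolding s_def[symmetric] by (simp add: h_def field_simps)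
qed

lemma lyap_0_lower_bound:
  "\<exists>a>0. \<forall>p m \<theta> q. a * (p\<^sup>2 + (vel m \<theta> q)\<^sup>2 + (ang m \<theta> q)\<^sup>2) \<le> lyap 0 p m \<theta> q"
proof -
  define a where "a = min (R * (1 - R) / 4) (chi\<^sup>2 / 2)"
  show ?thesis
  proof (intro exI[of _ a] conjI allI)
  show "0 < a" using R pos by (simp add: a_def)
    fix p m \<theta> q
    define S c K where "S = (vel m \<theta> q)\<^sup>2 + (ang m \<theta> q)\<^sup>2" and "c = R * (1 - R) / 4"
      and "K = (vel m \<theta> q)\<^sup>2 - 2 * R * sin \<theta> * vel m \<theta> q * ang m \<theta> q + R * (ang m \<theta> q)\<^sup>2"
    have "a * p\<^sup>2 \<le> chi\<^sup>2 / 2 * p\<^sup>2" unfolding a_def by (intro mult_right_mono) auto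
    moreover have "a * S \<le> c * S"
      unfolding a_def c_def S_def by (intro mult_right_mono) auto
    moreover have "2 * (c * S) \<le> K"
      using kinetic_lower_bound[of "vel m \<theta> q" "ang m \<theta> q" \<theta>] unfolding c_def S_def K_def by simp
    moreover have "a * (p\<^sup>2 + (vel m \<theta> q)\<^sup>2 + (ang m \<theta> q)\<^sup>2) = a * p\<^sup>2 + a * S"
      by (simp add: S_def distrib_left)
    ultimately show "a * (p\<^sup>2 + (vel m \<theta> q)\<^sup>2 + (ang m \<theta> q)\<^sup>2) \<le> lyap 0 p m \<theta> q"
      unfolding lyap_def kinetic_velocities K_def[symmetric] by linarith
  qed
qed

end


section \<open>A priori bounds along a fixed noise path\<close>

lemma abs_mult_le: "\<bar>a\<bar> \<le> \<alpha> \<Longrightarrow> \<bar>b\<bar> \<le> \<beta> \<Longrightarrow> \<bar>a * b\<bar> \<le> \<alpha> * \<beta>" for a b :: real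
  unfolding abs_mult by (rule mult_mono) auto

lemma abs_le_1_plus_power2: "\<bar>x\<bar> \<le> 1 + x\<^sup>2" for x :: real
proof -
  have "0 \<le> (\<bar>x\<bar> - 1)\<^sup>2" by simp
  then show ?thesis by (simp add: power2_eq_square algebra_simps)
qed

context pendulum
begin

lemma noise_bound: "\<bar>w\<bar> \<le> B \<Longrightarrow> \<bar>\<nu> * w / den \<theta>\<bar> \<le> \<nu> * B / (1 - R)"
  unfolding abs_divide abs_mult using pos R den[of \<theta>]
  by (intro frac_le mult_mono) auto

text \<open>With the noise frozen out of the energy, the cubic terms of its derivative still cancel, so that
  it grows at most exponentially along each path.\<close>

lemma energy_rate_bound:
  "\<exists>A\<ge>0. \<forall>w p y \<theta> q V U v u. \<bar>w\<bar> \<le> B \<longrightarrow>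
     V = vel y \<theta> q \<longrightarrow> U = ang y \<theta> q \<longrightarrow> v = vel (y + \<nu> * w) \<theta> q \<longrightarrow> u = ang (y + \<nu> * w) \<theta> q \<longrightarrow>
     V * (- 2 * \<zeta>1 * v - chi\<^sup>2 * p) + R * U * (- 2 * \<zeta>2 * u - \<kappa>\<^sup>2 * sin \<theta> - v * u * cos \<theta>)
      + R * cos \<theta> * U * V * u + chi\<^sup>2 * p * v \<le> A * (1 + (p\<^sup>2 + V\<^sup>2 + U\<^sup>2))"
proof -
  define d where "d = \<nu> * \<bar>B\<bar> / (1 - R)"
  have d: "0 \<le> d" using R pos by (simp add: d_def)
  let ?A = "2 * \<zeta>1 * d + 2 * R * \<zeta>2 * d + R * \<kappa>\<^sup>2 + R * d + R * d\<^sup>2 + chi\<^sup>2 * d"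
  show ?thesis
  proof (intro exI[of _ ?A] conjI allI impI)
    show "0 \<le> ?A" using d R pos by simp
    fix w p y \<theta> q V U v u
    assume w: "\<bar>w\<bar> \<le> B" and V: "V = vel y \<theta> q" and U: "U = ang y \<theta> q"
      and v: "v = vel (y + \<nu> * w) \<theta> q" and u: "u = ang (y + \<nu> * w) \<theta> q"
    define e s c G where "e = \<nu> * w / den \<theta>" and "s = sin \<theta>" and "c = cos \<theta>" and "G = 1 + (p\<^sup>2 + V\<^sup>2 + U\<^sup>2)"
    have e: "\<bar>e\<bar> \<le> d" using noise_bound[of w "\<bar>B\<bar>" \<theta>] w unfolding e_def d_def by simp
    have sc: "\<bar>s\<bar> \<le> 1" "\<bar>c\<bar> \<le> 1" by (auto simp: s_def c_def)
    have v: "v = V + e" and u: "u = U + s * e"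
      by (simp_all add: v u V U vel_ang_shift e_def s_def)
    have G: "\<bar>V\<bar> \<le> G" "\<bar>U\<bar> \<le> G" "\<bar>p\<bar> \<le> G" "\<bar>U\<^sup>2\<bar> \<le> G"
      using abs_le_1_plus_power2[of V] abs_le_1_plus_power2[of U] abs_le_1_plus_power2[of p]
      unfolding G_def by (smt (verit) zero_le_power2)+
    have "\<bar>V * e\<bar> \<le> G * d" by (rule abs_mult_le[OF G(1) e])
    then have "2 * \<zeta>1 * - (V * e) \<le> 2 * \<zeta>1 * (G * d)" using pos by (intro mult_left_mono) auto
    moreover
    have "\<bar>s * e\<bar> \<le> 1 * d" by (rule abs_mult_le[OF sc(1) e])
    then have "\<bar>U * (s * e)\<bar> \<le> G * (1 * d)" by (rule abs_mult_le[OF G(2)])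
    then have "2 * R * \<zeta>2 * - (U * (s * e)) \<le> 2 * R * \<zeta>2 * (G * d)" using pos R by (intro mult_left_mono) auto
    moreover
    have "\<bar>s * U\<bar> \<le> 1 * G" by (rule abs_mult_le[OF sc(1) G(2)])
    then have "R * \<kappa>\<^sup>2 * - (s * U) \<le> R * \<kappa>\<^sup>2 * G" using R by (intro mult_left_mono) auto
    moreover
    have "\<bar>c * e\<bar> \<le> 1 * d" by (rule abs_mult_le[OF sc(2) e])
    then have "\<bar>U\<^sup>2 * (c * e)\<bar> \<le> G * (1 * d)" by (rule abs_mult_le[OF G(4)])
    then have "R * - (U\<^sup>2 * (c * e)) \<le> R * (G * d)" using R by (intro mult_left_mono) auto
    moreover
    have "\<bar>(c * e) * (s * e)\<bar> \<le> (1 * d) * (1 * d)"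
      by (rule abs_mult_le[OF \<open>\<bar>c * e\<bar> \<le> 1 * d\<close> \<open>\<bar>s * e\<bar> \<le> 1 * d\<close>])
    then have "\<bar>U * ((c * e) * (s * e))\<bar> \<le> G * ((1 * d) * (1 * d))" by (rule abs_mult_le[OF G(2)])
    then have "R * - (U * ((c * e) * (s * e))) \<le> R * (G * d\<^sup>2)"
      using R by (intro mult_left_mono) (auto simp: power2_eq_square)
    moreover
    have "\<bar>p * e\<bar> \<le> G * d" by (rule abs_mult_le[OF G(3) e])
    then have "chi\<^sup>2 * (p * e) \<le> chi\<^sup>2 * (G * d)" by (intro mult_left_mono) auto
    moreover have "0 \<le> 2 * \<zeta>1 * V\<^sup>2" "0 \<le> 2 * R * \<zeta>2 * U\<^sup>2" using pos R by auto
    moreover have "V * (- 2 * \<zeta>1 * v - chi\<^sup>2 * p) + R * U * (- 2 * \<zeta>2 * u - \<kappa>\<^sup>2 * s - v * u * c)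
        + R * c * U * V * u + chi\<^sup>2 * p * v
      = 2 * \<zeta>1 * - (V * e) + 2 * R * \<zeta>2 * - (U * (s * e)) + R * \<kappa>\<^sup>2 * - (s * U) + R * - (U\<^sup>2 * (c * e))
        + R * - (U * ((c * e) * (s * e))) + chi\<^sup>2 * (p * e) - 2 * \<zeta>1 * V\<^sup>2 - 2 * R * \<zeta>2 * U\<^sup>2"
      unfolding v u by (simp add: algebra_simps power2_eq_square)
    ultimately have "V * (- 2 * \<zeta>1 * v - chi\<^sup>2 * p) + R * U * (- 2 * \<zeta>2 * u - \<kappa>\<^sup>2 * s - v * u * c)
        + R * c * U * V * u + chi\<^sup>2 * p * v
      \<le> 2 * \<zeta>1 * (G * d) + 2 * R * \<zeta>2 * (G * d) + R * \<kappa>\<^sup>2 * G + R * (G * d) + R * (G * d\<^sup>2) + chi\<^sup>2 * (G * d)"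
      by linarith
    also have "\<dots> = ?A * G" by (simp add: algebra_simps)
    finally show "V * (- 2 * \<zeta>1 * v - chi\<^sup>2 * p) + R * U * (- 2 * \<zeta>2 * u - \<kappa>\<^sup>2 * sin \<theta> - v * u * cos \<theta>)
        + R * cos \<theta> * U * V * u + chi\<^sup>2 * p * v \<le> ?A * (1 + (p\<^sup>2 + V\<^sup>2 + U\<^sup>2))"
      unfolding s_def c_def G_def .
  qed
qed

lemma tuple_derivatives:
  fixes Y :: "real \<Rightarrow> real \<times> real \<times> real \<times> real"
  assumes "(Y has_vector_derivative D) (at t within S)"
  shows "((\<lambda>t. fst (Y t)) has_real_derivative fst D) (at t within S)"
    "((\<lambda>t. fst (snd (Y t))) has_real_derivative fst (snd D)) (at t within S)"
    "((\<lambda>t. fst (snd (snd (Y t)))) has_real_derivative fst (snd (snd D))) (at t within S)"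
    "((\<lambda>t. snd (snd (snd (Y t)))) has_real_derivative snd (snd (snd D))) (at t within S)"
  unfolding has_real_derivative_iff_has_vector_derivative
  by (intro bounded_linear.has_vector_derivative[OF bounded_linear_fst]
      bounded_linear.has_vector_derivative[OF bounded_linear_snd] assms)+

text \<open>The constant must not depend on the cutoff radius. The cutoff only scales the energy
  rate by a factor in \<open>[0, 1]\<close>, and the upper bound for that rate is nonnegative, so
  Gronwall's lemma bounds position and velocities uniformly in \<open>r\<close>; the momenta are
  combinations of the velocities.\<close>

lemma cut_solution_bound:
  assumes w: "continuous_on {0..} w" and "0 \<le> T"
  shows "\<exists>C. \<forall>r Y. Y 0 = x \<longrightarrow>
    (\<forall>t\<in>{0..T}. (Y has_vector_derivative cut_field r (w t) (Y t)) (at t within {0..})) \<longrightarrow> (\<forall>t\<in>{0..T}. norm (Y t) \<le> C)"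
proof -
  obtain B where B: "0 \<le> B" "\<And>t. t \<in> {0..T} \<Longrightarrow> \<bar>w t\<bar> \<le> B" using bounded_on_compact[OF w] by metis
  obtain A where A: "0 \<le> A" "\<forall>w p y \<theta> q V U v u. \<bar>w\<bar> \<le> B \<longrightarrow>
     V = vel y \<theta> q \<longrightarrow> U = ang y \<theta> q \<longrightarrow> v = vel (y + \<nu> * w) \<theta> q \<longrightarrow> u = ang (y + \<nu> * w) \<theta> q \<longrightarrow>
     V * (- 2 * \<zeta>1 * v - chi\<^sup>2 * p) + R * U * (- 2 * \<zeta>2 * u - \<kappa>\<^sup>2 * sin \<theta> - v * u * cos \<theta>)
      + R * cos \<theta> * U * V * u + chi\<^sup>2 * p * v \<le> A * (1 + (p\<^sup>2 + V\<^sup>2 + U\<^sup>2))"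
    using energy_rate_bound[of B] by blast
  obtain a where a: "0 < a" "\<And>p m \<theta> q. a * (p\<^sup>2 + (vel m \<theta> q)\<^sup>2 + (ang m \<theta> q)\<^sup>2) \<le> lyap 0 p m \<theta> q"
    using lyap_0_lower_bound by blast
  define d where "d = \<nu> * B / (1 - R)"
  define L0 where "L0 = lyap 0 (fst x) (fst (snd x)) (fst (snd (snd x))) (snd (snd (snd x)))"
  define A' where "A' = A * (1 + 1 / a)"
  \<comment> \<open>The energy bounds the squares of \<open>p\<close>, \<open>V\<close>,
    \<open>U\<close> by the second summand, and \<open>\<bar>x\<bar> \<le> 1 + x^2\<close> passes to
    the values.\<close>
  define k where "k = 1 + (1 + L0) * exp (A' * T) / a"
  have A': "0 \<le> A'" using A a by (simp add: A'_def)
  show ?thesis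
  proof (intro exI allI impI ballI)
    fix r Y t
    assume Y0: "Y 0 = x" and Y: "\<forall>t\<in>{0..T}. (Y has_vector_derivative cut_field r (w t) (Y t)) (at t within {0..})"
      and t: "t \<in> {0..T}"
    define p y \<theta> q \<rho> where "p t = fst (Y t)" and "y t = fst (snd (Y t))" and "\<theta> t = fst (snd (snd (Y t)))"
      and "q t = snd (snd (snd (Y t)))" and "\<rho> t = cutoff r (Y t)" for t
    define V U v u where "V t = vel (y t) (\<theta> t) (q t)" and "U t = ang (y t) (\<theta> t) (q t)"
      and "v t = vel (y t + \<nu> * w t) (\<theta> t) (q t)" and "u t = ang (y t + \<nu> * w t) (\<theta> t) (q t)" for t
    have field: "cut_field r (w t) (Y t) = (\<rho> t * v t, \<rho> t * (- 2 * \<zeta>1 * v t - chi\<^sup>2 * p t), \<rho> t * u t,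
        \<rho> t * (- 2 * \<zeta>2 * u t - \<kappa>\<^sup>2 * sin (\<theta> t) - v t * u t * cos (\<theta> t)))" for t
      by (simp add: cut_field_def field_def case_prod_beta' Let_def p_def y_def \<theta>_def q_def \<rho>_def v_def u_def)
    have der: "(p has_real_derivative \<rho> t * v t) (at t within {0..})"
      "(y has_real_derivative \<rho> t * (- 2 * \<zeta>1 * v t - chi\<^sup>2 * p t)) (at t within {0..})"
      "(\<theta> has_real_derivative \<rho> t * u t) (at t within {0..})"
      "(q has_real_derivative \<rho> t * (- 2 * \<zeta>2 * u t - \<kappa>\<^sup>2 * sin (\<theta> t) - v t * u t * cos (\<theta> t))) (at t within {0..})"
      if "t \<in> {0..T}" for t
      using tuple_derivatives[OF Y[rule_format, OF that]] unfolding field fst_conv snd_conv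
      by (simp_all add: p_def[abs_def] y_def[abs_def] \<theta>_def[abs_def] q_def[abs_def])
    have \<rho>: "0 \<le> \<rho> t" "\<rho> t \<le> 1" for t by (auto simp: \<rho>_def cutoff)
    let ?l = "\<lambda>t. lyap 0 (p t) (y t) (\<theta> t) (q t)"
    let ?E = "\<lambda>t. V t * (- 2 * \<zeta>1 * v t - chi\<^sup>2 * p t) + R * U t * (- 2 * \<zeta>2 * u t - \<kappa>\<^sup>2 * sin (\<theta> t) - v t * u t * cos (\<theta> t))
      + R * cos (\<theta> t) * U t * V t * u t + chi\<^sup>2 * p t * v t"
    have S: "a * ((p t)\<^sup>2 + (V t)\<^sup>2 + (U t)\<^sup>2) \<le> ?l t" for t
      unfolding V_def U_def by (rule a(2))
    have growth: "1 + ?l t \<le> (1 + ?l 0) * exp (A' * t)" if t: "t \<in> {0..T}" for t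
    proof (rule Gronwall_growth)
      fix s assume "s \<in> {0..t}"
      then have s: "s \<in> {0..T}" using t by auto
      show "(?l has_real_derivative \<rho> s * ?E s) (at s within {0..})"
        by (rule lyap_derivative[OF der[OF s], of 0, THEN DERIV_cong]) (simp add: V_def U_def algebra_simps)
      have E: "?E s \<le> A * (1 + ((p s)\<^sup>2 + (V s)\<^sup>2 + (U s)\<^sup>2))"
        by (rule A(2)[rule_format, OF B(2)[OF s]]) (auto simp: V_def U_def v_def u_def)
      have "\<rho> s * ?E s \<le> \<rho> s * (A * (1 + ((p s)\<^sup>2 + (V s)\<^sup>2 + (U s)\<^sup>2)))"
        by (rule mult_left_mono[OF E \<rho>(1)])
      also have "\<dots> \<le> 1 * (A * (1 + ((p s)\<^sup>2 + (V s)\<^sup>2 + (U s)\<^sup>2)))"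
        using A(1) \<rho>(2) by (intro mult_right_mono) auto
      also have "\<dots> \<le> A * (1 + ?l s / a)"
        using A(1) S[of s] a(1) by (simp add: mult_left_mono pos_le_divide_eq mult.commute)
      also have "\<dots> \<le> A * ((1 + 1 / a) * (1 + ?l s))"
      proof -
        have "0 \<le> ?l s" using S[of s] a(1) by (smt (verit) mult_nonneg_nonneg zero_le_power2)
        then show ?thesis using A(1) a(1) by (intro mult_left_mono) (auto simp: field_simps)
      qed
      finally show "\<rho> s * ?E s \<le> A' * (1 + ?l s)" by (simp add: A'_def)
    qed (use t in auto)
    have L0: "?l 0 = L0" by (simp add: L0_def p_def y_def \<theta>_def q_def Y0)
    have L0_nonneg: "0 \<le> L0" using S[of 0] a(1) unfolding L0 by (smt (verit) mult_nonneg_nonneg zero_le_power2)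
    have k: "\<bar>p t\<bar> \<le> k" "\<bar>V t\<bar> \<le> k" "\<bar>U t\<bar> \<le> k" if t: "t \<in> {0..T}" for t
    proof -
      have "(1 + ?l 0) * exp (A' * t) \<le> (1 + L0) * exp (A' * T)"
        unfolding L0 using A' t L0_nonneg by (intro mult_left_mono) (auto intro: mult_left_mono)
      with growth[OF t] have "a * ((p t)\<^sup>2 + (V t)\<^sup>2 + (U t)\<^sup>2) \<le> (1 + L0) * exp (A' * T)"
        using S[of t] by linarith
      then have "(p t)\<^sup>2 + (V t)\<^sup>2 + (U t)\<^sup>2 \<le> (1 + L0) * exp (A' * T) / a"
        using a(1) by (simp add: pos_le_divide_eq mult.commute)
      then show "\<bar>p t\<bar> \<le> k" "\<bar>V t\<bar> \<le> k" "\<bar>U t\<bar> \<le> k"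
        using abs_le_1_plus_power2[of "p t"] abs_le_1_plus_power2[of "V t"] abs_le_1_plus_power2[of "U t"]
        unfolding k_def by (smt (verit) zero_le_power2)+
    qed
    have yq: "\<bar>y t\<bar> \<le> 2 * k" "\<bar>q t\<bar> \<le> 2 * k"
    proof -
      have "\<bar>R * sin (\<theta> t)\<bar> \<le> 1 * 1" using R by (intro abs_mult_le) auto
      then have 1: "\<bar>(R * sin (\<theta> t)) * U t\<bar> \<le> (1 * 1) * k" by (rule abs_mult_le) (rule k[OF t])
      have 2: "\<bar>sin (\<theta> t) * V t\<bar> \<le> 1 * k" by (rule abs_mult_le) (use k[OF t] in auto)
      have "y t = V t - (R * sin (\<theta> t)) * U t" "q t = U t - sin (\<theta> t) * V t"
        using vel_ang[of "y t" "\<theta> t" "q t"] unfolding V_def U_def by (auto simp: mult_ac)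
      then show "\<bar>y t\<bar> \<le> 2 * k" "\<bar>q t\<bar> \<le> 2 * k" using 1 2 k[OF t] by linarith+
    qed
    have u_bound: "\<bar>\<rho> s * u s\<bar> \<le> 1 * (k + 1 * d)" if s: "s \<in> {0..T}" for s
    proof (rule abs_mult_le)
      have "\<bar>sin (\<theta> s) * (\<nu> * w s / den (\<theta> s))\<bar> \<le> 1 * d"
        by (rule abs_mult_le) (use noise_bound[OF B(2)[OF s]] in \<open>auto simp: d_def\<close>)
      moreover have "u s = U s + sin (\<theta> s) * (\<nu> * w s / den (\<theta> s))"
        by (simp add: u_def U_def vel_ang_shift)
      ultimately have "\<bar>u s - U s\<bar> \<le> 1 * d" by simp
      then show "\<bar>u s\<bar> \<le> k + 1 * d" using k(3)[OF s] by linarith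
    qed (use \<rho>[of s] in auto)
    \<comment> \<open>The energy does not control the real representative of the angle, but its
      speed is bounded, so it grows at most linearly.\<close>
    have "norm (\<theta> t - \<theta> 0) \<le> (1 * (k + 1 * d)) * norm (t - 0)"
    proof (rule field_differentiable_bound[of "{0..T}"])
      fix s assume s: "s \<in> {0..T}"
      show "(\<theta> has_real_derivative \<rho> s * u s) (at s within {0..T})"
        by (rule DERIV_subset[OF der(3)[OF s]]) auto
      show "norm (\<rho> s * u s) \<le> 1 * (k + 1 * d)" using u_bound[OF s] by simp
    qed (use t in auto)
    also have "\<dots> \<le> (1 * (k + 1 * d)) * T"
      using t k[of 0] \<open>0 \<le> T\<close> pos R B(1) by (intro mult_left_mono) (auto simp: d_def intro!: add_nonneg_nonneg order_trans[OF abs_ge_zero])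
    finally have "\<bar>\<theta> t\<bar> \<le> \<bar>fst (snd (snd x))\<bar> + (k + d) * T"
      by (simp add: \<theta>_def Y0)
    then show "norm (Y t) \<le> k + (2 * k + ((\<bar>fst (snd (snd x))\<bar> + (k + d) * T) + 2 * k))"
      using norm_tuple4[of "Y t"] k(1)[OF t] yq unfolding p_def y_def \<theta>_def q_def by linarith
  qed
qed

text \<open>On each bounded time interval the sequence of cut-off solutions is eventually constant.
  Writing the global solution as a limit, and not by a choice, keeps it measurable in the
  noise.\<close>

definition pendulum_path :: "(real \<Rightarrow> real) \<Rightarrow> real \<times> real \<times> real \<times> real \<Rightarrow> real \<Rightarrow> real \<times> real \<times> real \<times> real" where
  "pendulum_path w x t = lim (\<lambda>n. picard_limit (\<lambda>t. cut_field (real n) (w t)) x t)"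

text \<open>Once the radius \<open>n\<close> exceeds the a priori bound, the cutoff equals 1 along
  the path. All these paths then solve the uncut equation from the same point, and uniqueness makes
  them agree.\<close>

lemma pendulum_path_local:
  assumes w: "continuous_on {0..} w" and "0 \<le> T"
  shows "\<exists>N. \<forall>n\<ge>N. \<forall>t\<in>{0..T}. pendulum_path w x t = picard_limit (\<lambda>t. cut_field (real n) (w t)) x t \<and>
    (picard_limit (\<lambda>t. cut_field (real n) (w t)) x has_vector_derivative
      field (w t) (picard_limit (\<lambda>t. cut_field (real n) (w t)) x t)) (at t within {0..})"
proof -
  let ?Y = "\<lambda>n. picard_limit (\<lambda>t. cut_field (real n) (w t)) x"
  obtain C where C: "\<forall>r Y. Y 0 = x \<longrightarrow>
    (\<forall>t\<in>{0..T}. (Y has_vector_derivative cut_field r (w t) (Y t)) (at t within {0..})) \<longrightarrow> (\<forall>t\<in>{0..T}. norm (Y t) \<le> C)"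
    using cut_solution_bound[OF assms, of x] ..
  define N where "N = nat \<lceil>C\<rceil>"
  have der: "(?Y n has_vector_derivative field (w t) (?Y n t)) (at t within {0..})" if n: "N \<le> n" and t: "t \<in> {0..T}" for n t
  proof -
    interpret globally_lipschitz_ode "\<lambda>t. cut_field (real n) (w t)" by (rule cut_field_ode[OF w])
    have "norm (?Y n t) \<le> C"
      by (rule C[rule_format, of "?Y n" "real n"]) (use t picard_limit_derivative in auto)
    also have "C \<le> real n" using n unfolding N_def by linarith
    finally have "cutoff (real n) (?Y n t) = 1" by (rule cutoff(3))
    then show ?thesis using picard_limit_derivative[of t x] t by (simp add: cut_field_def)
  qed
  have init: "?Y n 0 = x" for n
    by (rule globally_lipschitz_ode.picard_limit_0[OF cut_field_ode[OF w]])
  have same: "?Y n t = ?Y N t" if "N \<le> n" "t \<in> {0..T}" for n t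
    by (rule field_unique[OF w der der]) (use that init in auto)
  have "pendulum_path w x t = ?Y N t" if "t \<in> {0..T}" for t
    unfolding pendulum_path_def
  proof (rule limI, rule tendsto_eventually)
    show "\<forall>\<^sub>F n in sequentially. ?Y n t = ?Y N t"
      unfolding eventually_sequentially using same[OF _ that] by blast
  qed
  then have "pendulum_path w x t = ?Y n t" if "N \<le> n" "t \<in> {0..T}" for n t
    using same[OF that] that by metis
  then show ?thesis using der by blast
qed

lemma pendulum_path:
  assumes w: "continuous_on {0..} w"
  shows "pendulum_path w x 0 = x"
    "0 \<le> t \<Longrightarrow> (pendulum_path w x has_vector_derivative field (w t) (pendulum_path w x t)) (at t within {0..})"
proof -
  let ?Y = "\<lambda>n. picard_limit (\<lambda>t. cut_field (real n) (w t)) x"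
  have init: "?Y n 0 = x" for n
    by (rule globally_lipschitz_ode.picard_limit_0[OF cut_field_ode[OF w]])
  show "pendulum_path w x 0 = x"
    using pendulum_path_local[OF w, of 0 x] init by auto
  assume t: "0 \<le> t"
  \<comment> \<open>The horizon \<open>t + 1\<close> keeps \<open>t\<close> away from the right end,
    where the derivative within the interval would be weaker than the one within the
    half-line.\<close>
  obtain N where N: "\<And>s. s \<in> {0..t + 1} \<Longrightarrow> pendulum_path w x s = ?Y N s \<and>
      (?Y N has_vector_derivative field (w s) (?Y N s)) (at s within {0..})"
    using pendulum_path_local[OF w, of "t + 1" x] t by (metis add_nonneg_nonneg order_refl zero_le_one)
  have "(?Y N has_vector_derivative field (w t) (pendulum_path w x t)) (at t within {0..t + 1})"
    using N[of t] t by (auto intro: has_vector_derivative_within_subset)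
  then have "(pendulum_path w x has_vector_derivative field (w t) (pendulum_path w x t)) (at t within {0..t + 1})"
    by (rule has_vector_derivative_transform[rotated 2]) (use N t in auto)
  then show "(pendulum_path w x has_vector_derivative field (w t) (pendulum_path w x t)) (at t within {0..})"
    using at_within_halfline[OF t less_add_one] by simp
qed

text \<open>Integrals, Picard iterates and cut-off solutions are nested limits of measurable
  functions. Measurability of the noise is asked up to time \<open>t\<close> only, so that the
  result can be applied with \<open>N = F t\<close> to give adaptedness.\<close>

lemma pendulum_path_measurable:
  assumes t: "0 \<le> t" and w: "\<And>s. s \<in> {0..t} \<Longrightarrow> w s \<in> borel_measurable N"
    and w_cont: "\<And>\<omega>. \<omega> \<in> space N \<Longrightarrow> continuous_on {0..} (\<lambda>s. w s \<omega>)"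
  shows "(\<lambda>\<omega>. pendulum_path (\<lambda>s. w s \<omega>) x t) \<in> borel_measurable N"
proof (rule borel_measurable_LIMSEQ_metric)
  fix \<omega> assume \<omega>: "\<omega> \<in> space N"
  obtain K where "\<forall>n\<ge>K. \<forall>s\<in>{0..t}. pendulum_path (\<lambda>s. w s \<omega>) x s = picard_limit (\<lambda>t. cut_field (real n) (w t \<omega>)) x s"
    using pendulum_path_local[OF w_cont[OF \<omega>] t, of x] by blast
  then have "\<forall>n\<ge>K. picard_limit (\<lambda>t. cut_field (real n) (w t \<omega>)) x t = pendulum_path (\<lambda>s. w s \<omega>) x t"
    using t by simp
  then show "(\<lambda>n. picard_limit (\<lambda>t. cut_field (real n) (w t \<omega>)) x t) \<longlonglongrightarrow> pendulum_path (\<lambda>s. w s \<omega>) x t"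
    unfolding eventually_sequentially[symmetric] by (intro tendsto_eventually) (auto simp: eventually_sequentially)
next
  fix n :: nat
  have ode: "globally_lipschitz_ode (\<lambda>t. cut_field (real n) (w t \<omega>))" if "\<omega> \<in> space N" for \<omega>
    by (rule cut_field_ode[OF w_cont[OF that]])
  have iter: "(\<lambda>\<omega>. picard_iter (\<lambda>t. cut_field (real n) (w t \<omega>)) x i s) \<in> borel_measurable N" if "s \<in> {0..t}" for i s
    using that
  proof (induction i arbitrary: s)
    case (Suc i)
    have "(\<lambda>\<omega>. integral {0..s} (\<lambda>s. cut_field (real n) (w s \<omega>) (picard_iter (\<lambda>t. cut_field (real n) (w t \<omega>)) x i s))) \<in> borel_measurable N"
    proof (rule integral_measurable)
      fix r assume r: "r \<in> {0..s}"
      have "continuous_on UNIV (\<lambda>x. cut_field (real n) (fst x) (snd x))"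
        by (intro cut_field_continuous continuous_intros)
      then show "(\<lambda>\<omega>. cut_field (real n) (w r \<omega>) (picard_iter (\<lambda>t. cut_field (real n) (w t \<omega>)) x i r)) \<in> borel_measurable N"
        by (rule borel_measurable_continuous_Pair[rotated 2]) (use Suc r w in auto)
    next
      fix \<omega> assume \<omega>: "\<omega> \<in> space N"
      interpret globally_lipschitz_ode "\<lambda>t. cut_field (real n) (w t \<omega>)" by (rule ode[OF \<omega>])
      show "continuous_on {0..s} (\<lambda>s. cut_field (real n) (w s \<omega>) (picard_iter (\<lambda>t. cut_field (real n) (w t \<omega>)) x i s))"
        by (rule continuous_on_subset[OF cut_field_continuous[OF w_cont[OF \<omega>] picard_iter_continuous]]) auto
    qed (use Suc in auto)
    then show ?case by simp
  qed simp
  show "(\<lambda>\<omega>. picard_limit (\<lambda>t. cut_field (real n) (w t \<omega>)) x t) \<in> borel_measurable N"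
  proof (rule borel_measurable_LIMSEQ_metric)
    show "(\<lambda>\<omega>. picard_iter (\<lambda>t. cut_field (real n) (w t \<omega>)) x i t) \<in> borel_measurable N" for i
      using iter t by simp
    show "(\<lambda>i. picard_iter (\<lambda>t. cut_field (real n) (w t \<omega>)) x i t) \<longlonglongrightarrow> picard_limit (\<lambda>t. cut_field (real n) (w t \<omega>)) x t"
      if "\<omega> \<in> space N" for \<omega>
      using globally_lipschitz_ode.picard_limit_tendsto[OF ode[OF that] t] .
  qed
qed

end


section \<open>The pathwise form of the system\<close>

context pendulum
begin

section \<open>Drift and noise coefficients in terms of a real angle\<close>

lemma den_angle: "0 < 1 - R * (angle_sin c)\<^sup>2" "1 - R \<le> 1 - R * (angle_sin c)\<^sup>2"
proof -
  obtain \<theta> where "to_angle \<theta> = c" using to_angle_surj by blast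
  then show "0 < 1 - R * (angle_sin c)\<^sup>2" "1 - R \<le> 1 - R * (angle_sin c)\<^sup>2"
    using den[of \<theta>] by (auto simp: den_def)
qed

lemma noise_to_angle:
  assumes "u1 x = to_angle \<theta>"
  shows "noise_v2 R \<nu> x = \<nu> / den \<theta>" "noise_u2 R \<nu> x = \<nu> * sin \<theta> / den \<theta>"
  using assms by (simp_all add: noise_v2_def noise_u2_def den_def)

lemma noise_bounded: "\<bar>noise_v2 R \<nu> x\<bar> \<le> \<nu> / (1 - R)" "\<bar>noise_u2 R \<nu> x\<bar> \<le> \<nu> / (1 - R)"
proof -
  obtain \<theta> where \<theta>: "u1 x = to_angle \<theta>" using to_angle_surj by metis
  have "\<nu> * \<bar>sin \<theta>\<bar> \<le> \<nu> * 1" using pos by (intro mult_left_mono) auto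
  then show "\<bar>noise_v2 R \<nu> x\<bar> \<le> \<nu> / (1 - R)" "\<bar>noise_u2 R \<nu> x\<bar> \<le> \<nu> / (1 - R)"
    unfolding noise_to_angle[OF \<theta>] using den[of \<theta>] R pos
    by (auto simp: abs_mult intro!: frac_le)
qed

lemma continuous_coefficients:
  "continuous_on UNIV (drift_v2 R \<zeta>1 \<zeta>2 chi \<kappa>)" "continuous_on UNIV (drift_u2 R \<zeta>1 \<zeta>2 chi \<kappa>)"
  "continuous_on UNIV (noise_v2 R \<nu>)" "continuous_on UNIV (noise_u2 R \<nu>)"
proof -
  have nz: "\<forall>x\<in>UNIV. 1 - R * (angle_sin (u1 x))\<^sup>2 \<noteq> 0"
    using den_angle less_irrefl by metis
  note intros = continuous_on_divide continuous_on_diff continuous_on_add continuous_on_mult continuous_on_power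
    continuous_on_minus continuous_on_const continuous_on_state nz
  show "continuous_on UNIV (drift_v2 R \<zeta>1 \<zeta>2 chi \<kappa>)" "continuous_on UNIV (drift_u2 R \<zeta>1 \<zeta>2 chi \<kappa>)"
    "continuous_on UNIV (noise_v2 R \<nu>)" "continuous_on UNIV (noise_u2 R \<nu>)"
    unfolding drift_v2_def[abs_def] drift_u2_def[abs_def] noise_v2_def[abs_def] noise_u2_def[abs_def]
    by (intro intros)+
qed

lemmas coefficients_measurable [measurable] = continuous_coefficients[THEN borel_measurable_continuous_onI]

text \<open>These are the combinations of the drifts that occur in the equations of \<open>m\<close>
  and \<open>q\<close>; in both the common denominator cancels.\<close>

lemma drift_combinations:
  assumes "u1 x = to_angle \<theta>"
  shows "drift_v2 R \<zeta>1 \<zeta>2 chi \<kappa> x - R * sin \<theta> * drift_u2 R \<zeta>1 \<zeta>2 chi \<kappa> x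
      = - 2 * \<zeta>1 * v2 x - chi\<^sup>2 * v1 x + R * cos \<theta> * (u2 x)\<^sup>2"
    "drift_u2 R \<zeta>1 \<zeta>2 chi \<kappa> x - sin \<theta> * drift_v2 R \<zeta>1 \<zeta>2 chi \<kappa> x = - 2 * \<zeta>2 * u2 x - \<kappa>\<^sup>2 * sin \<theta>"
proof -
  define s c p v u where "s = sin \<theta>" and "c = cos \<theta>" and "p = v1 x" and "v = v2 x" and "u = u2 x"
  define A where "A = - 2 * \<zeta>1 * v - chi\<^sup>2 * p + R * u\<^sup>2 * c - 2 * R * \<zeta>2 * u * s - R * \<kappa>\<^sup>2 * s\<^sup>2"
  define B where "B = - 2 * \<zeta>2 * u - \<kappa>\<^sup>2 * s - 2 * \<zeta>1 * v * s - chi\<^sup>2 * p * s + R * u\<^sup>2 * s * c"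
  have D: "den \<theta> \<noteq> 0" "den \<theta> = 1 - R * s\<^sup>2" using den by (auto simp: den_def s_def)
  have dv: "drift_v2 R \<zeta>1 \<zeta>2 chi \<kappa> x = A / den \<theta>" and du: "drift_u2 R \<zeta>1 \<zeta>2 chi \<kappa> x = B / den \<theta>"
    using assms by (simp_all add: drift_v2_def drift_u2_def A_def B_def s_def c_def p_def v_def u_def den_def)
  have "A - R * s * B = (- 2 * \<zeta>1 * v - chi\<^sup>2 * p + R * c * u\<^sup>2) * den \<theta>"
    unfolding D(2) A_def B_def by (simp add: algebra_simps power2_eq_square)
  then have "A / den \<theta> - R * s * (B / den \<theta>) = - 2 * \<zeta>1 * v - chi\<^sup>2 * p + R * c * u\<^sup>2"
    using D(1) by (simp add: field_simps)
  then show "drift_v2 R \<zeta>1 \<zeta>2 chi \<kappa> x - R * sin \<theta> * drift_u2 R \<zeta>1 \<zeta>2 chi \<kappa> x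
      = - 2 * \<zeta>1 * v2 x - chi\<^sup>2 * v1 x + R * cos \<theta> * (u2 x)\<^sup>2"
    unfolding dv du by (simp add: s_def c_def p_def v_def u_def)
  have "B - s * A = (- 2 * \<zeta>2 * u - \<kappa>\<^sup>2 * s) * den \<theta>"
    unfolding D(2) A_def B_def by (simp add: algebra_simps power2_eq_square)
  then have "B / den \<theta> - s * (A / den \<theta>) = - 2 * \<zeta>2 * u - \<kappa>\<^sup>2 * s"
    using D(1) by (simp add: field_simps)
  then show "drift_u2 R \<zeta>1 \<zeta>2 chi \<kappa> x - sin \<theta> * drift_v2 R \<zeta>1 \<zeta>2 chi \<kappa> x = - 2 * \<zeta>2 * u2 x - \<kappa>\<^sup>2 * sin \<theta>"
    unfolding dv du by (simp add: s_def u_def)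
qed

text \<open>Time derivatives of the noise coefficients when the angle has velocity \<open>u\<close>.\<close>

definition noise_v2' :: "real \<Rightarrow> real \<Rightarrow> real" where
  "noise_v2' \<theta> u = 2 * R * \<nu> * sin \<theta> * cos \<theta> * u / (den \<theta>)\<^sup>2"

definition noise_u2' :: "real \<Rightarrow> real \<Rightarrow> real" where
  "noise_u2' \<theta> u = \<nu> / den \<theta> * cos \<theta> * u + sin \<theta> * noise_v2' \<theta> u"

lemma noise_derivative:
  assumes \<theta>: "(\<theta> has_real_derivative u) (at t within S)"
  shows "((\<lambda>t. \<nu> / den (\<theta> t)) has_real_derivative noise_v2' (\<theta> t) u) (at t within S)"
    "((\<lambda>t. \<nu> * sin (\<theta> t) / den (\<theta> t)) has_real_derivative noise_u2' (\<theta> t) u) (at t within S)"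
proof -
  have den': "((\<lambda>t. den (\<theta> t)) has_real_derivative - (2 * R * sin (\<theta> t) * cos (\<theta> t) * u)) (at t within S)"
    unfolding den_def by (rule derivative_eq_intros \<theta> refl | simp add: algebra_simps)+
  show a: "((\<lambda>t. \<nu> / den (\<theta> t)) has_real_derivative noise_v2' (\<theta> t) u) (at t within S)"
    by (rule DERIV_cong[OF DERIV_divide[OF DERIV_const den' den(4)]])
      (simp add: noise_v2'_def power2_eq_square)
  have s: "((\<lambda>t. sin (\<theta> t)) has_real_derivative cos (\<theta> t) * u) (at t within S)"
    by (rule derivative_eq_intros \<theta> refl)+
  show "((\<lambda>t. \<nu> * sin (\<theta> t) / den (\<theta> t)) has_real_derivative noise_u2' (\<theta> t) u) (at t within S)"
    using DERIV_cong[OF DERIV_mult[OF s a], of "noise_u2' (\<theta> t) u"]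
    by (simp add: noise_u2'_def algebra_simps)
qed

lemma continuous_on_noise':
  fixes S :: "real set"
  assumes "continuous_on S \<theta>" "continuous_on S u"
  shows "continuous_on S (\<lambda>t. noise_v2' (\<theta> t) (u t))" "continuous_on S (\<lambda>t. noise_u2' (\<theta> t) (u t))"
proof -
  show 1: "continuous_on S (\<lambda>t. noise_v2' (\<theta> t) (u t))"
    unfolding noise_v2'_def
    by (intro continuous_on_divide continuous_on_mult continuous_on_power continuous_on_const continuous_on_sin
        continuous_on_cos continuous_on_den assms) (use den in auto)
  show "continuous_on S (\<lambda>t. noise_u2' (\<theta> t) (u t))"
    unfolding noise_u2'_def
    by (intro continuous_on_divide continuous_on_mult continuous_on_add continuous_on_const continuous_on_sin
        continuous_on_cos continuous_on_den assms 1) (use den in auto)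
qed

definition state_of :: "real \<Rightarrow> real \<times> real \<times> real \<times> real \<Rightarrow> state" where
  "state_of w = (\<lambda>(p, y, \<theta>, q). (p, vel (y + \<nu> * w) \<theta> q, to_angle \<theta>, ang (y + \<nu> * w) \<theta> q))"

lemma continuous_on_state_of:
  fixes S :: "'c::t2_space set"
  assumes w: "continuous_on S w" and Y: "continuous_on S Y"
  shows "continuous_on S (\<lambda>t. state_of (w t) (Y t))"
proof -
  have c: "continuous_on S (\<lambda>t. fst (Y t))" "continuous_on S (\<lambda>t. fst (snd (Y t)))"
    "continuous_on S (\<lambda>t. fst (snd (snd (Y t))))" "continuous_on S (\<lambda>t. snd (snd (snd (Y t))))"
    by (intro continuous_on_fst continuous_on_snd Y)+
  note vu = continuous_on_vel_ang[OF continuous_on_add[OF c(2) continuous_on_mult_left[OF w, of \<nu>]] c(3,4)]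
  show ?thesis
    unfolding state_of_def case_prod_beta'
    by (intro continuous_on_Pair vu c continuous_on_compose2[OF continuous_on_to_angle]) auto
qed

text \<open>An arbitrary representative, applied only to the angle of the deterministic initial
  state. Along a solution the real angle evolves continuously from it.\<close>

definition lift_angle :: "angle \<Rightarrow> real" where
  "lift_angle c = (SOME \<theta>. to_angle \<theta> = c)"

lemma to_angle_lift [simp]: "to_angle (lift_angle c) = c"
  unfolding lift_angle_def by (rule someI_ex[OF to_angle_surj])

definition momenta :: "state \<Rightarrow> real \<times> real \<times> real \<times> real" where
  "momenta x = (let \<theta> = lift_angle (u1 x) in (v1 x, v2 x - R * u2 x * sin \<theta>, \<theta>, u2 x - v2 x * sin \<theta>))"

lemma state_of_momenta: "state_of 0 (momenta x) = x"
  by (cases x) (simp add: state_of_def momenta_def Let_def vel_ang_velocities)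

text \<open>By partial integration, \<open>dX = a dt + b dW\<close> with a differentiable \<open>b\<close> means that \<open>X - b w\<close> has the
  derivative \<open>a - b' w\<close>; it is in this form that the system is compared with the random field.\<close>

lemma field_imp_equations:
  assumes Y: "(Y has_vector_derivative field (w t) (Y t)) (at t within S)"
    and p: "p = (\<lambda>t. fst (Y t))" and y: "y = (\<lambda>t. fst (snd (Y t)))" and \<theta>: "\<theta> = (\<lambda>t. fst (snd (snd (Y t))))"
    and q: "q = (\<lambda>t. snd (snd (snd (Y t))))"
    and x: "x = state_of (w t) (Y t)"
  shows "(p has_real_derivative v2 x) (at t within S)" "(\<theta> has_real_derivative u2 x) (at t within S)"
    "((\<lambda>t. vel (y t) (\<theta> t) (q t)) has_real_derivative drift_v2 R \<zeta>1 \<zeta>2 chi \<kappa> x - noise_v2' (\<theta> t) (u2 x) * w t) (at t within S)"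
    "((\<lambda>t. ang (y t) (\<theta> t) (q t)) has_real_derivative drift_u2 R \<zeta>1 \<zeta>2 chi \<kappa> x - noise_u2' (\<theta> t) (u2 x) * w t) (at t within S)"
proof -
  define v u where "v = v2 x" and "u = u2 x"
  have v: "v = vel (y t + \<nu> * w t) (\<theta> t) (q t)" and u: "u = ang (y t + \<nu> * w t) (\<theta> t) (q t)"
    and pt: "v1 x = p t" and angle: "u1 x = to_angle (\<theta> t)"
    by (simp_all add: v_def u_def x state_of_def case_prod_beta' y \<theta> q p)
  have field: "field (w t) (Y t) = (v, - 2 * \<zeta>1 * v - chi\<^sup>2 * p t, u, - 2 * \<zeta>2 * u - \<kappa>\<^sup>2 * sin (\<theta> t) - v * u * cos (\<theta> t))"
    by (simp add: field_def case_prod_beta' Let_def v u p y \<theta> q)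
  note der = tuple_derivatives[OF Y, unfolded field fst_conv snd_conv, folded p y \<theta> q]
  show "(p has_real_derivative v2 x) (at t within S)" "(\<theta> has_real_derivative u2 x) (at t within S)"
    using der by (auto simp: v_def u_def)
  define s c D where "s = sin (\<theta> t)" and "c = cos (\<theta> t)" and "D = den (\<theta> t)"
  define dv du where "dv = drift_v2 R \<zeta>1 \<zeta>2 chi \<kappa> x" and "du = drift_u2 R \<zeta>1 \<zeta>2 chi \<kappa> x"
  have D: "D \<noteq> 0" "D = 1 - R * s\<^sup>2" using den by (auto simp: D_def den_def s_def)
  have comb: "dv - R * s * du = - 2 * \<zeta>1 * v - chi\<^sup>2 * p t + R * c * u\<^sup>2" "du - s * dv = - 2 * \<zeta>2 * u - \<kappa>\<^sup>2 * s"
    using drift_combinations[OF angle] by (simp_all add: dv_def du_def s_def c_def v_def u_def pt)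
  have m: "v - R * u * s = y t + \<nu> * w t" and qt: "u - v * s = q t"
    using vel_ang[of "y t + \<nu> * w t" "\<theta> t" "q t"] unfolding v[symmetric] u[symmetric] by (auto simp: s_def)
  have den': "((\<lambda>t. den (\<theta> t)) has_real_derivative - (2 * R * s * c * u)) (at t within S)"
    unfolding den_def s_def c_def by (rule derivative_eq_intros der refl | simp add: algebra_simps)+
  have n1: "((\<lambda>t. y t + R * sin (\<theta> t) * q t) has_real_derivative
      (- 2 * \<zeta>1 * v - chi\<^sup>2 * p t) + (R * c * u * q t + R * s * (- 2 * \<zeta>2 * u - \<kappa>\<^sup>2 * s - v * u * c))) (at t within S)"
    unfolding s_def c_def by (rule derivative_eq_intros der refl | simp add: algebra_simps)+
  have n2: "((\<lambda>t. q t + sin (\<theta> t) * y t) has_real_derivative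
      (- 2 * \<zeta>2 * u - \<kappa>\<^sup>2 * s - v * u * c) + (c * u * y t + s * (- 2 * \<zeta>1 * v - chi\<^sup>2 * p t))) (at t within S)"
    unfolding s_def c_def by (rule derivative_eq_intros der refl | simp add: algebra_simps)+
  \<comment> \<open>The numerators of \<open>vel\<close> and \<open>ang\<close> at the momentum
    without noise, in terms of the true velocities \<open>v\<close> and \<open>u\<close>. The drifts
    enter below by substituting \<open>comb\<close> into the field.\<close>
  have V: "y t + R * s * q t = v * D - \<nu> * w t" and U: "q t + s * y t = u * D - s * \<nu> * w t"
    using m qt unfolding D(2) by (simp_all add: algebra_simps power2_eq_square flip: qt)
  show "((\<lambda>t. vel (y t) (\<theta> t) (q t)) has_real_derivative drift_v2 R \<zeta>1 \<zeta>2 chi \<kappa> x - noise_v2' (\<theta> t) (u2 x) * w t) (at t within S)"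
    unfolding vel_def
  proof (rule DERIV_cong[OF DERIV_divide[OF n1 den' den(4)]])
    have "(- 2 * \<zeta>1 * v - chi\<^sup>2 * p t) + (R * c * u * q t + R * s * (- 2 * \<zeta>2 * u - \<kappa>\<^sup>2 * s - v * u * c))
      = (dv - R * s * du - R * c * u\<^sup>2) + (R * c * u * (u - v * s) + R * s * (du - s * dv - v * u * c))"
      unfolding comb qt by simp
    also have "\<dots> = dv * D - 2 * R * s * c * u * v"
      unfolding D(2) by (simp add: algebra_simps power2_eq_square)
    finally have N: "(- 2 * \<zeta>1 * v - chi\<^sup>2 * p t) + (R * c * u * q t + R * s * (- 2 * \<zeta>2 * u - \<kappa>\<^sup>2 * s - v * u * c))
      = dv * D - 2 * R * s * c * u * v" .
    have "((dv * D - 2 * R * s * c * u * v) * D - (v * D - \<nu> * w t) * - (2 * R * s * c * u)) / (D * D)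
      = dv - 2 * R * \<nu> * s * c * u / D\<^sup>2 * w t"
      using D(1) by (simp add: field_simps power2_eq_square)
    then show "(((- 2 * \<zeta>1 * v - chi\<^sup>2 * p t) + (R * c * u * q t + R * s * (- 2 * \<zeta>2 * u - \<kappa>\<^sup>2 * s - v * u * c))) * den (\<theta> t)
        - (y t + R * sin (\<theta> t) * q t) * - (2 * R * s * c * u)) / (den (\<theta> t) * den (\<theta> t))
      = drift_v2 R \<zeta>1 \<zeta>2 chi \<kappa> x - noise_v2' (\<theta> t) (u2 x) * w t"
      unfolding N unfolding D_def[symmetric] s_def[symmetric] V noise_v2'_def c_def[symmetric] dv_def u_def by simp
  qed
  show "((\<lambda>t. ang (y t) (\<theta> t) (q t)) has_real_derivative drift_u2 R \<zeta>1 \<zeta>2 chi \<kappa> x - noise_u2' (\<theta> t) (u2 x) * w t) (at t within S)"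
    unfolding ang_def
  proof (rule DERIV_cong[OF DERIV_divide[OF n2 den' den(4)]])
    have "(- 2 * \<zeta>2 * u - \<kappa>\<^sup>2 * s - v * u * c) + (c * u * y t + s * (- 2 * \<zeta>1 * v - chi\<^sup>2 * p t))
      = (du - s * dv - v * u * c) + (c * u * (v - R * u * s - \<nu> * w t) + s * (dv - R * s * du - R * c * u\<^sup>2))"
      unfolding comb m by simp
    also have "\<dots> = du * D - 2 * R * s * c * u * u - c * u * \<nu> * w t"
      unfolding D(2) by (simp add: algebra_simps power2_eq_square)
    finally have N: "(- 2 * \<zeta>2 * u - \<kappa>\<^sup>2 * s - v * u * c) + (c * u * y t + s * (- 2 * \<zeta>1 * v - chi\<^sup>2 * p t))
      = du * D - 2 * R * s * c * u * u - c * u * \<nu> * w t" .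
    have "((du * D - 2 * R * s * c * u * u - c * u * \<nu> * w t) * D - (u * D - s * \<nu> * w t) * - (2 * R * s * c * u)) / (D * D)
      = du - (\<nu> / D * c * u + s * (2 * R * \<nu> * s * c * u / D\<^sup>2)) * w t"
      using D(1) by (simp add: field_simps power2_eq_square)
    then show "(((- 2 * \<zeta>2 * u - \<kappa>\<^sup>2 * s - v * u * c) + (c * u * y t + s * (- 2 * \<zeta>1 * v - chi\<^sup>2 * p t))) * den (\<theta> t)
        - (q t + sin (\<theta> t) * y t) * - (2 * R * s * c * u)) / (den (\<theta> t) * den (\<theta> t))
      = drift_u2 R \<zeta>1 \<zeta>2 chi \<kappa> x - noise_u2' (\<theta> t) (u2 x) * w t"
      unfolding N unfolding D_def[symmetric] s_def[symmetric] U noise_u2'_def noise_v2'_def c_def[symmetric] du_def u_def by simp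
  qed
qed

text \<open>The converse passage: \<open>v'\<close> and \<open>u'\<close> are the velocities minus
  coefficient times noise. Their combinations are \<open>m - \<nu> w\<close> and \<open>q\<close>,
  and differentiating them must leave no term in \<open>w\<close>.\<close>

lemma equations_imp_field:
  fixes X :: "real \<Rightarrow> state"
  assumes p: "((\<lambda>t. v1 (X t)) has_real_derivative v2 (X t)) (at t within S)"
    and \<theta>: "(\<theta> has_real_derivative u2 (X t)) (at t within S)" and angle: "u1 (X t) = to_angle (\<theta> t)"
    and v: "(v' has_real_derivative drift_v2 R \<zeta>1 \<zeta>2 chi \<kappa> (X t) - noise_v2' (\<theta> t) (u2 (X t)) * w t) (at t within S)"
    and u: "(u' has_real_derivative drift_u2 R \<zeta>1 \<zeta>2 chi \<kappa> (X t) - noise_u2' (\<theta> t) (u2 (X t)) * w t) (at t within S)"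
    and v': "v' t = v2 (X t) - \<nu> / den (\<theta> t) * w t" and u': "u' t = u2 (X t) - \<nu> * sin (\<theta> t) / den (\<theta> t) * w t"
    and Y: "Y = (\<lambda>t. (v1 (X t), v' t - R * u' t * sin (\<theta> t), \<theta> t, u' t - v' t * sin (\<theta> t)))"
  shows "(Y has_vector_derivative field (w t) (Y t)) (at t within S)" "X t = state_of (w t) (Y t)"
proof -
  define s c D where "s = sin (\<theta> t)" and "c = cos (\<theta> t)" and "D = den (\<theta> t)"
  define dv du where "dv = drift_v2 R \<zeta>1 \<zeta>2 chi \<kappa> (X t)" and "du = drift_u2 R \<zeta>1 \<zeta>2 chi \<kappa> (X t)"
  define n where "n = noise_v2' (\<theta> t) (u2 (X t))"
  have D: "D \<noteq> 0" "D = 1 - R * s\<^sup>2" using den by (auto simp: D_def den_def s_def)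
  have comb: "dv - R * s * du = - 2 * \<zeta>1 * v2 (X t) - chi\<^sup>2 * v1 (X t) + R * c * (u2 (X t))\<^sup>2"
    "du - s * dv = - 2 * \<zeta>2 * u2 (X t) - \<kappa>\<^sup>2 * s"
    using drift_combinations[OF angle] by (simp_all add: dv_def du_def s_def c_def)
  have nu: "\<nu> * w t = \<nu> / D * w t * D" using D(1) by simp
  have m: "v' t - R * u' t * s + \<nu> * w t = v2 (X t) - R * u2 (X t) * s"
    unfolding v' u' s_def[symmetric] D_def[symmetric] nu unfolding D(2)
    using D by (simp add: algebra_simps power2_eq_square add_divide_distrib diff_divide_distrib)
  have q: "u' t - v' t * s = u2 (X t) - v2 (X t) * s"
    unfolding v' u' s_def[symmetric] D_def[symmetric] by (simp add: algebra_simps)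
  have vel: "vel (v' t - R * u' t * s + \<nu> * w t) (\<theta> t) (u' t - v' t * s) = v2 (X t)"
    and ang: "ang (v' t - R * u' t * s + \<nu> * w t) (\<theta> t) (u' t - v' t * s) = u2 (X t)"
    unfolding m q unfolding s_def by (rule vel_ang_velocities)+
  show "X t = state_of (w t) (Y t)"
    by (cases "X t") (use vel ang angle in \<open>simp add: state_of_def Y s_def\<close>)
  have field: "field (w t) (Y t) = (v2 (X t), - 2 * \<zeta>1 * v2 (X t) - chi\<^sup>2 * v1 (X t), u2 (X t),
      - 2 * \<zeta>2 * u2 (X t) - \<kappa>\<^sup>2 * s - v2 (X t) * u2 (X t) * c)"
    using vel ang by (simp add: field_def Let_def Y s_def c_def)
  have sin': "((\<lambda>t. sin (\<theta> t)) has_real_derivative c * u2 (X t)) (at t within S)"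
    unfolding c_def by (rule derivative_eq_intros \<theta> refl)+
  have y': "((\<lambda>t. v' t - R * u' t * sin (\<theta> t)) has_real_derivative - 2 * \<zeta>1 * v2 (X t) - chi\<^sup>2 * v1 (X t)) (at t within S)"
  proof (rule DERIV_cong[OF DERIV_diff[OF v DERIV_mult[OF DERIV_cmult[OF u] sin']]])
    have n': "noise_u2' (\<theta> t) (u2 (X t)) = \<nu> / D * c * u2 (X t) + s * n"
      by (simp add: noise_u2'_def n_def s_def c_def D_def)
    \<comment> \<open>The noise coefficient of \<open>v2\<close> minus \<open>R sin \<theta>\<close>
      times that of \<open>u2\<close> is the constant \<open>\<nu>\<close>. This is the derivative
      of that identity in time, and it cancels the noise terms.\<close>
    have "n - R * s * (\<nu> / D * c * u2 (X t) + s * n) = R * s * c * u2 (X t) * (\<nu> / D)"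
    proof -
      have "n - R * s * (\<nu> / D * c * u2 (X t) + s * n) = n * D - R * s * (\<nu> / D * c * u2 (X t))"
        unfolding D(2) by (simp add: algebra_simps power2_eq_square)
      also have "n * D = 2 * R * s * c * u2 (X t) * (\<nu> / D)"
        using D(1) unfolding n_def noise_v2'_def s_def[symmetric] c_def[symmetric] D_def[symmetric]
        by (simp add: field_simps power2_eq_square)
      finally show ?thesis by (simp add: algebra_simps)
    qed
    then have "(n - R * s * (\<nu> / D * c * u2 (X t) + s * n)) * w t = R * s * c * u2 (X t) * (\<nu> / D) * w t" by simp
    then have "(dv - n * w t) - (R * (du - (\<nu> / D * c * u2 (X t) + s * n) * w t) * s + c * u2 (X t) * (R * u' t))
      = (dv - R * s * du) - R * c * u2 (X t) * (u' t + \<nu> * s / D * w t)"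
      by (simp add: algebra_simps)
    also have "u' t + \<nu> * s / D * w t = u2 (X t)" by (simp add: u' s_def D_def)
    finally have "(dv - n * w t) - (R * (du - (\<nu> / D * c * u2 (X t) + s * n) * w t) * s + c * u2 (X t) * (R * u' t))
      = - 2 * \<zeta>1 * v2 (X t) - chi\<^sup>2 * v1 (X t)"
      unfolding comb by (simp add: power2_eq_square)
    then show "drift_v2 R \<zeta>1 \<zeta>2 chi \<kappa> (X t) - noise_v2' (\<theta> t) (u2 (X t)) * w t
      - (R * (drift_u2 R \<zeta>1 \<zeta>2 chi \<kappa> (X t) - noise_u2' (\<theta> t) (u2 (X t)) * w t) * sin (\<theta> t) + c * u2 (X t) * (R * u' t))
      = - 2 * \<zeta>1 * v2 (X t) - chi\<^sup>2 * v1 (X t)"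
      unfolding n' dv_def[symmetric] du_def[symmetric] n_def[symmetric] s_def[symmetric] .
  qed
  have q': "((\<lambda>t. u' t - v' t * sin (\<theta> t)) has_real_derivative - 2 * \<zeta>2 * u2 (X t) - \<kappa>\<^sup>2 * s - v2 (X t) * u2 (X t) * c) (at t within S)"
  proof (rule DERIV_cong[OF DERIV_diff[OF u DERIV_mult[OF v sin']]])
    have "(du - (\<nu> / D * c * u2 (X t) + s * n) * w t) - ((dv - n * w t) * s + c * u2 (X t) * v' t)
      = (du - s * dv) - c * u2 (X t) * (v' t + \<nu> / D * w t)"
      by (simp add: algebra_simps)
    also have "v' t + \<nu> / D * w t = v2 (X t)" by (simp add: v' D_def)
    finally show "drift_u2 R \<zeta>1 \<zeta>2 chi \<kappa> (X t) - noise_u2' (\<theta> t) (u2 (X t)) * w t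
      - ((drift_v2 R \<zeta>1 \<zeta>2 chi \<kappa> (X t) - noise_v2' (\<theta> t) (u2 (X t)) * w t) * sin (\<theta> t) + c * u2 (X t) * v' t)
      = - 2 * \<zeta>2 * u2 (X t) - \<kappa>\<^sup>2 * s - v2 (X t) * u2 (X t) * c"
      unfolding comb by (simp add: noise_u2'_def n_def s_def c_def D_def dv_def du_def mult_ac)
  qed
  show "(Y has_vector_derivative field (w t) (Y t)) (at t within S)"
    unfolding Y field[unfolded Y]
    using p y' \<theta> q' unfolding has_real_derivative_iff_has_vector_derivative
    by (intro has_vector_derivative_Pair)
qed

end


section \<open>From identities at fixed times to identities of paths\<close>

lemma continuous_on_initial: "continuous_on {0..} f \<Longrightarrow> continuous_on {0..t} f" for t :: real
  by (rule continuous_on_subset) auto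

text \<open>The countably many times \<open>i / (k + 1)\<close> share one null set. Rounding
  \<open>t\<close> up on these grids gives nonnegative times tending to \<open>t\<close>, and
  continuity does the rest.\<close>

lemma AE_eq_all_times:
  fixes f g :: "real \<Rightarrow> 'a \<Rightarrow> real"
  assumes cont: "AE \<omega> in M. continuous_on {0..} (\<lambda>t. f t \<omega>) \<and> continuous_on {0..} (\<lambda>t. g t \<omega>)"
    and eq: "\<And>t. 0 \<le> t \<Longrightarrow> AE \<omega> in M. f t \<omega> = g t \<omega>"
  shows "AE \<omega> in M. \<forall>t\<ge>0. f t \<omega> = g t \<omega>"
proof -
  have "AE \<omega> in M. \<forall>i k. f (real i / real (Suc k)) \<omega> = g (real i / real (Suc k)) \<omega>"
    unfolding AE_all_countable by (intro allI eq) simp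
  with cont show ?thesis
  proof eventually_elim
    case (elim \<omega>)
    show ?case
    proof (intro allI impI)
      fix t :: real assume t: "0 \<le> t"
      define r where "r k = real (nat \<lceil>t * real (Suc k)\<rceil>) / real (Suc k)" for k
      have "r \<longlonglongrightarrow> t"
      proof (rule tendsto_sandwich)
        have bounds: "t \<le> r k \<and> r k \<le> t + 1 / real (Suc k)" for k
        proof -
          have "real (nat \<lceil>t * real (Suc k)\<rceil>) = real_of_int \<lceil>t * real (Suc k)\<rceil>"
          proof (rule of_nat_nat)
            have "0 \<le> t * real (Suc k)" using t by simp
            then show "0 \<le> \<lceil>t * real (Suc k)\<rceil>" by linarith
          qed
          moreover have "t * real (Suc k) \<le> real_of_int \<lceil>t * real (Suc k)\<rceil>"
            "real_of_int \<lceil>t * real (Suc k)\<rceil> \<le> t * real (Suc k) + 1"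
            by linarith+
          ultimately have le: "t * real (Suc k) \<le> real (nat \<lceil>t * real (Suc k)\<rceil>)"
            "real (nat \<lceil>t * real (Suc k)\<rceil>) \<le> t * real (Suc k) + 1" by simp_all
          have K: "0 < real (Suc k)" by simp
          have "(t + 1 / real (Suc k)) * real (Suc k) = t * real (Suc k) + 1"
            using K by (simp add: distrib_right del: of_nat_Suc)
          with le show ?thesis
            unfolding r_def pos_le_divide_eq[OF K] pos_divide_le_eq[OF K] by linarith
        qed
        then show "\<forall>\<^sub>F k in sequentially. t \<le> r k" "\<forall>\<^sub>F k in sequentially. r k \<le> t + 1 / real (Suc k)"
          by auto
        show "(\<lambda>k. t + 1 / real (Suc k)) \<longlonglongrightarrow> t"
          using tendsto_add[OF tendsto_const[of t] mesh_tendsto[of 1]] by simp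
      qed simp
      moreover have "\<forall>\<^sub>F k in sequentially. r k \<in> {0..}" by (auto simp: r_def)
      ultimately have "(\<lambda>k. f (r k) \<omega>) \<longlonglongrightarrow> f t \<omega>" "(\<lambda>k. g (r k) \<omega>) \<longlonglongrightarrow> g t \<omega>"
        using elim(1) t by (auto intro: continuous_on_tendsto_compose)
      moreover have "(\<lambda>k. f (r k) \<omega>) = (\<lambda>k. g (r k) \<omega>)"
        using elim(2) by (simp add: r_def del: of_nat_Suc)
      ultimately show "f t \<omega> = g t \<omega>"
        using LIMSEQ_unique by metis
    qed
  qed
qed

locale stochastic_pendulum = pendulum R \<zeta>1 \<zeta>2 chi \<kappa> \<nu> + wiener_process M F W
  for R \<zeta>1 \<zeta>2 chi \<kappa> \<nu> :: real and M :: "'a measure" and F W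
begin

text \<open>\<open>W\<close> starts at 0 only almost surely. Subtracting \<open>W 0\<close> gives a
  path that starts at 0 for every outcome, so initial values hold without exceptions.\<close>

definition noise :: "'a \<Rightarrow> real \<Rightarrow> real" where
  "noise \<omega> t = W t \<omega> - W 0 \<omega>"

lemma noise_0 [simp]: "noise \<omega> 0 = 0"
  by (simp add: noise_def)

lemma noise_continuous: "\<omega> \<in> space M \<Longrightarrow> continuous_on {0..} (noise \<omega>)"
  unfolding noise_def by (intro continuous_intros W_continuous)

lemma noise_measurable: "0 \<le> s \<Longrightarrow> s \<le> t \<Longrightarrow> (\<lambda>\<omega>. noise \<omega> s) \<in> borel_measurable (F t)"
  unfolding noise_def by (intro borel_measurable_diff W_measurable_F) auto

text \<open>Replacing \<open>W\<close> by \<open>W - W 0\<close> changes the boundary terms and the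
  integral by the same amount, since \<open>b'\<close> integrates to the increment of
  \<open>b\<close>; the boundary term at 0 vanishes.\<close>

lemma integration_by_parts_noise:
  assumes \<omega>: "\<omega> \<in> space M" and "0 \<le> t"
    and b: "\<And>s. 0 \<le> s \<Longrightarrow> (b has_real_derivative b' s) (at s within {0..})" and b': "continuous_on {0..} b'"
  shows "b t * W t \<omega> - b 0 * W 0 \<omega> - integral {0..t} (\<lambda>s. b' s * W s \<omega>)
    = b t * noise \<omega> t - integral {0..t} (\<lambda>s. b' s * noise \<omega> s)"
proof -
  have sub: "continuous_on {0..t} b'" "continuous_on {0..t} (\<lambda>s. W s \<omega>)"
    using b' W_continuous[OF \<omega>] by (auto intro: continuous_on_initial)
  have "integral {0..t} (\<lambda>s. b' s * noise \<omega> s) = integral {0..t} (\<lambda>s. b' s * W s \<omega> - b' s * W 0 \<omega>)"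
    by (simp add: noise_def algebra_simps)
  also have "\<dots> = integral {0..t} (\<lambda>s. b' s * W s \<omega>) - integral {0..t} (\<lambda>s. b' s * W 0 \<omega>)"
    by (rule integral_diff) (intro integrable_continuous_real continuous_intros sub)+
  also have "integral {0..t} (\<lambda>s. b' s * W 0 \<omega>) = (b t - b 0) * W 0 \<omega>"
    using integral_equation_of_derivative(1)[of b b' t] b \<open>0 \<le> t\<close>
    by (simp add: has_real_derivative_iff_has_vector_derivative)
  finally show ?thesis by (simp add: noise_def algebra_simps)
qed

lemma ito_process_C1I:
  assumes b: "\<And>s. 0 \<le> s \<Longrightarrow> b s \<in> borel_measurable (F s)" "\<And>s \<omega>. \<bar>b s \<omega>\<bar> \<le> C"
    and b': "\<And>\<omega> s. \<omega> \<in> space M \<Longrightarrow> 0 \<le> s \<Longrightarrow> ((\<lambda>s. b s \<omega>) has_real_derivative b' s \<omega>) (at s within {0..})"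
      "\<And>\<omega>. \<omega> \<in> space M \<Longrightarrow> continuous_on {0..} (\<lambda>s. b' s \<omega>)"
    and a: "\<And>\<omega>. \<omega> \<in> space M \<Longrightarrow> continuous_on {0..} (\<lambda>s. a s \<omega>)"
    and X: "\<And>\<omega> s. \<omega> \<in> space M \<Longrightarrow> 0 \<le> s \<Longrightarrow>
      ((\<lambda>s. X s \<omega> - b s \<omega> * noise \<omega> s) has_real_derivative a s \<omega> - b' s \<omega> * noise \<omega> s) (at s within {0..})"
  shows "ito_process M F W X a b"
  unfolding ito_process_def
proof (intro allI impI)
  fix t :: real assume t: "0 \<le> t"
  let ?J = "\<lambda>\<omega>. b t \<omega> * W t \<omega> - b 0 \<omega> * W 0 \<omega> - integral {0..t} (\<lambda>s. b' s \<omega> * W s \<omega>)"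
  have cont_b: "continuous_on {0..} (\<lambda>s. b s \<omega>)" if "\<omega> \<in> space M" for \<omega>
    using b'(1)[OF that] by (intro DERIV_continuous_on) auto
  have "has_ito_integral M F W b t ?J"
  proof (rule ito_integral_C1_exists[OF t b(1) b(2) cont_b])
    show "((\<lambda>s. b s \<omega>) has_real_derivative b' s \<omega>) (at s within {0..t})" if "\<omega> \<in> space M" "s \<in> {0..t}" for \<omega> s
      by (rule DERIV_subset[OF b'(1)]) (use that in auto)
    show "continuous_on {0..t} (\<lambda>s. b' s \<omega>)" if "\<omega> \<in> space M" for \<omega>
      by (rule continuous_on_subset[OF b'(2)[OF that]]) auto
  qed
  moreover have "X t \<omega> = X 0 \<omega> + integral {0..t} (\<lambda>s. a s \<omega>) + ?J \<omega>" if \<omega>: "\<omega> \<in> space M" for \<omega>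
  proof -
    have sub: "continuous_on {0..t} (\<lambda>s. b' s \<omega>)" "continuous_on {0..t} (noise \<omega>)" "continuous_on {0..t} (\<lambda>s. a s \<omega>)"
      by (intro continuous_on_initial b'(2) a noise_continuous \<omega>)+
    have "integral {0..t} (\<lambda>s. a s \<omega> - b' s \<omega> * noise \<omega> s) = (X t \<omega> - b t \<omega> * noise \<omega> t) - (X 0 \<omega> - b 0 \<omega> * noise \<omega> 0)"
      by (rule integral_equation_of_derivative(1)[OF _ t])
        (use X[OF \<omega>] in \<open>simp add: has_real_derivative_iff_has_vector_derivative\<close>)
    moreover have "integral {0..t} (\<lambda>s. a s \<omega> - b' s \<omega> * noise \<omega> s)
      = integral {0..t} (\<lambda>s. a s \<omega>) - integral {0..t} (\<lambda>s. b' s \<omega> * noise \<omega> s)"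
      by (rule integral_diff) (intro integrable_continuous_real continuous_intros sub)+
    ultimately show ?thesis
      using integration_by_parts_noise[OF \<omega> t b'(1)[OF \<omega>] b'(2)[OF \<omega>]] by simp
  qed
  ultimately show "\<exists>I. has_ito_integral M F W b t I \<and> (AE \<omega> in M. X t \<omega> = X 0 \<omega> + integral {0..t} (\<lambda>s. a s \<omega>) + I \<omega>)"
    by (intro exI conjI AE_I2)
qed

text \<open>At each fixed time the Ito integral is known almost surely by partial integration, and
  continuity extends the identity to all times at once. Differentiability of \<open>b\<close> is
  assumed only almost surely, because along a given solution the equation of the angle holds only
  almost surely.\<close>

lemma ito_process_C1D:
  assumes ito: "ito_process M F W X a b"
    and b: "\<And>s. 0 \<le> s \<Longrightarrow> b s \<in> borel_measurable (F s)" "\<And>s \<omega>. \<bar>b s \<omega>\<bar> \<le> C"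
    and cont: "\<And>\<omega>. \<omega> \<in> space M \<Longrightarrow> continuous_on {0..} (\<lambda>s. b s \<omega>)"
      "\<And>\<omega>. \<omega> \<in> space M \<Longrightarrow> continuous_on {0..} (\<lambda>s. a s \<omega>)" "\<And>\<omega>. \<omega> \<in> space M \<Longrightarrow> continuous_on {0..} (\<lambda>s. X s \<omega>)"
    and b': "AE \<omega> in M. (\<forall>s\<ge>0. ((\<lambda>s. b s \<omega>) has_real_derivative b' s \<omega>) (at s within {0..})) \<and> continuous_on {0..} (\<lambda>s. b' s \<omega>)"
  shows "AE \<omega> in M. \<forall>t\<ge>0. ((\<lambda>s. X s \<omega> - b s \<omega> * noise \<omega> s) has_real_derivative a t \<omega> - b' t \<omega> * noise \<omega> t) (at t within {0..})"
proof -
  have "AE \<omega> in M. \<forall>t\<ge>0. X t \<omega> - b t \<omega> * noise \<omega> t = X 0 \<omega> + integral {0..t} (\<lambda>s. a s \<omega> - b' s \<omega> * noise \<omega> s)"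
  proof (rule AE_eq_all_times)
    show "AE \<omega> in M. continuous_on {0..} (\<lambda>t. X t \<omega> - b t \<omega> * noise \<omega> t) \<and>
        continuous_on {0..} (\<lambda>t. X 0 \<omega> + integral {0..t} (\<lambda>s. a s \<omega> - b' s \<omega> * noise \<omega> s))"
      using b' AE_space
      by eventually_elim
        (intro conjI continuous_intros integral_continuous_halfline cont noise_continuous; simp)
    fix t :: real assume t: "0 \<le> t"
    from ito t obtain I where I: "has_ito_integral M F W b t I"
      "AE \<omega> in M. X t \<omega> = X 0 \<omega> + integral {0..t} (\<lambda>s. a s \<omega>) + I \<omega>"
      unfolding ito_process_def by blast
    have "AE \<omega> in M. I \<omega> = b t \<omega> * W t \<omega> - b 0 \<omega> * W 0 \<omega> - integral {0..t} (\<lambda>s. b' s \<omega> * W s \<omega>)"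
    proof (rule ito_integral_C1_unique[OF I(1) t b(1) b(2) cont(1)])
      show "AE \<omega> in M. (\<forall>s\<in>{0..t}. ((\<lambda>s. b s \<omega>) has_real_derivative b' s \<omega>) (at s within {0..t})) \<and> continuous_on {0..t} (\<lambda>s. b' s \<omega>)"
        using b'
      proof eventually_elim
        case (elim \<omega>)
        then show ?case
          by (auto intro: DERIV_subset[where s="{0..}"] continuous_on_subset[where s="{0..}"])
      qed
    qed
    with I(2) b' AE_space show "AE \<omega> in M. X t \<omega> - b t \<omega> * noise \<omega> t = X 0 \<omega> + integral {0..t} (\<lambda>s. a s \<omega> - b' s \<omega> * noise \<omega> s)"
    proof eventually_elim
      case (elim \<omega>)
      have sub: "continuous_on {0..t} (\<lambda>s. b' s \<omega>)" "continuous_on {0..t} (noise \<omega>)" "continuous_on {0..t} (\<lambda>s. a s \<omega>)"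
        using elim by (auto intro!: continuous_on_initial cont(2) noise_continuous)
      have "integral {0..t} (\<lambda>s. a s \<omega> - b' s \<omega> * noise \<omega> s)
        = integral {0..t} (\<lambda>s. a s \<omega>) - integral {0..t} (\<lambda>s. b' s \<omega> * noise \<omega> s)"
        by (rule integral_diff) (intro integrable_continuous_real continuous_intros sub)+
      then show ?case
        using integration_by_parts_noise[OF _ t, of \<omega> "\<lambda>s. b s \<omega>" "\<lambda>s. b' s \<omega>"] elim by simp
    qed
  qed
  with b' AE_space show ?thesis
  proof eventually_elim
    case (elim \<omega>)
    show ?case
    proof (intro allI impI)
      fix t :: real assume t: "0 \<le> t"
      have "continuous_on {0..} (\<lambda>s. a s \<omega> - b' s \<omega> * noise \<omega> s)"
        using elim cont(2) noise_continuous by (intro continuous_intros) auto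
      from integral_has_vector_derivative_halfline[OF this t]
      have "((\<lambda>t. X 0 \<omega> + integral {0..t} (\<lambda>s. a s \<omega> - b' s \<omega> * noise \<omega> s)) has_vector_derivative a t \<omega> - b' t \<omega> * noise \<omega> t) (at t within {0..})"
        by (auto intro!: derivative_eq_intros)
      then show "((\<lambda>s. X s \<omega> - b s \<omega> * noise \<omega> s) has_real_derivative a t \<omega> - b' t \<omega> * noise \<omega> t) (at t within {0..})"
        unfolding has_real_derivative_iff_has_vector_derivative
        by (rule has_vector_derivative_transform[rotated 2]) (use elim t in auto)
    qed
  qed
qed

section \<open>The canonical solution\<close>

definition path :: "state \<Rightarrow> 'a \<Rightarrow> real \<Rightarrow> real \<times> real \<times> real \<times> real" where
  "path x \<omega> t = pendulum_path (noise \<omega>) (momenta x) t"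

definition canonical :: "state \<Rightarrow> real \<Rightarrow> 'a \<Rightarrow> state" where
  "canonical x t \<omega> = state_of (noise \<omega> t) (path x \<omega> t)"

lemma path_derivative:
  "\<omega> \<in> space M \<Longrightarrow> 0 \<le> t \<Longrightarrow> (path x \<omega> has_vector_derivative field (noise \<omega> t) (path x \<omega> t)) (at t within {0..})"
  using pendulum_path(2)[OF noise_continuous] unfolding path_def[abs_def] .

lemma path_0: "\<omega> \<in> space M \<Longrightarrow> path x \<omega> 0 = momenta x"
  using pendulum_path(1)[OF noise_continuous] unfolding path_def .

lemma path_continuous: "\<omega> \<in> space M \<Longrightarrow> continuous_on {0..} (path x \<omega>)"
  by (rule continuous_on_has_vector_derivative[OF path_derivative]) auto

lemma path_measurable: "0 \<le> t \<Longrightarrow> (\<lambda>\<omega>. path x \<omega> t) \<in> borel_measurable (F t)"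
  unfolding path_def by (rule pendulum_path_measurable) (auto intro: noise_measurable noise_continuous simp: space_F)

lemma canonical_measurable: "0 \<le> t \<Longrightarrow> canonical x t \<in> F t \<rightarrow>\<^sub>M borel"
  unfolding canonical_def[abs_def]
  by (rule borel_measurable_continuous_Pair[OF noise_measurable path_measurable])
    (auto intro!: continuous_on_state_of continuous_intros)

lemma canonical_continuous: "\<omega> \<in> space M \<Longrightarrow> continuous_on {0..} (\<lambda>t. canonical x t \<omega>)"
  unfolding canonical_def by (intro continuous_on_state_of noise_continuous path_continuous)

lemma canonical_0: "\<omega> \<in> space M \<Longrightarrow> canonical x 0 \<omega> = x"
  by (simp add: canonical_def path_0 state_of_momenta)

lemma continuous_on_process:
  assumes f: "continuous_on {0..} (f :: real \<Rightarrow> state)"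
  shows "continuous_on {0..} (\<lambda>t. v1 (f t))" "continuous_on {0..} (\<lambda>t. v2 (f t))" "continuous_on {0..} (\<lambda>t. u2 (f t))"
    "continuous_on {0..} (\<lambda>t. angle_sin (u1 (f t)))" "continuous_on {0..} (\<lambda>t. angle_cos (u1 (f t)))"
    "continuous_on {0..} (\<lambda>t. drift_v2 R \<zeta>1 \<zeta>2 chi \<kappa> (f t))" "continuous_on {0..} (\<lambda>t. drift_u2 R \<zeta>1 \<zeta>2 chi \<kappa> (f t))"
    "continuous_on {0..} (\<lambda>t. noise_v2 R \<nu> (f t))" "continuous_on {0..} (\<lambda>t. noise_u2 R \<nu> (f t))"
  by (rule continuous_on_compose2[OF _ f subset_UNIV], rule continuous_on_state continuous_coefficients)+

text \<open>All equations hold for every outcome. The real angle is C1 with velocity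
  \<open>u2\<close>, so the noise coefficients are C1 in time and the pathwise equations can be read
  back as Ito equations.\<close>

theorem canonical_solution: "solution R \<zeta>1 \<zeta>2 chi \<kappa> \<nu> M F W x (canonical x)"
proof -
  let ?U = "canonical x"
  define p y \<theta> q where "p \<omega> = (\<lambda>t. fst (path x \<omega> t))" and "y \<omega> = (\<lambda>t. fst (snd (path x \<omega> t)))"
    and "\<theta> \<omega> = (\<lambda>t. fst (snd (snd (path x \<omega> t))))" and "q \<omega> = (\<lambda>t. snd (snd (snd (path x \<omega> t))))" for \<omega>
  have U: "v1 (?U t \<omega>) = p \<omega> t" "u1 (?U t \<omega>) = to_angle (\<theta> \<omega> t)"
    "v2 (?U t \<omega>) = vel (y \<omega> t + \<nu> * noise \<omega> t) (\<theta> \<omega> t) (q \<omega> t)" "u2 (?U t \<omega>) = ang (y \<omega> t + \<nu> * noise \<omega> t) (\<theta> \<omega> t) (q \<omega> t)"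
    for t \<omega>
    by (simp_all add: canonical_def state_of_def case_prod_beta' p_def y_def \<theta>_def q_def)
  have eqs: "(p \<omega> has_real_derivative v2 (?U t \<omega>)) (at t within {0..})" "(\<theta> \<omega> has_real_derivative u2 (?U t \<omega>)) (at t within {0..})"
    "((\<lambda>t. vel (y \<omega> t) (\<theta> \<omega> t) (q \<omega> t)) has_real_derivative
       drift_v2 R \<zeta>1 \<zeta>2 chi \<kappa> (?U t \<omega>) - noise_v2' (\<theta> \<omega> t) (u2 (?U t \<omega>)) * noise \<omega> t) (at t within {0..})"
    "((\<lambda>t. ang (y \<omega> t) (\<theta> \<omega> t) (q \<omega> t)) has_real_derivative
       drift_u2 R \<zeta>1 \<zeta>2 chi \<kappa> (?U t \<omega>) - noise_u2' (\<theta> \<omega> t) (u2 (?U t \<omega>)) * noise \<omega> t) (at t within {0..})"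
    if "\<omega> \<in> space M" "0 \<le> t" for \<omega> t
    by (rule field_imp_equations[where Y="path x \<omega>" and w="noise \<omega>" and t=t, OF path_derivative[OF that] p_def y_def \<theta>_def q_def canonical_def])+
  note cont = continuous_on_process[OF canonical_continuous]
  have \<theta>_cont: "continuous_on {0..} (\<theta> \<omega>)" if "\<omega> \<in> space M" for \<omega>
    unfolding \<theta>_def by (intro continuous_on_fst continuous_on_snd path_continuous that)
  have int: "p \<omega> t = p \<omega> 0 + integral {0..t} (\<lambda>s. v2 (?U s \<omega>))" "\<theta> \<omega> t = \<theta> \<omega> 0 + integral {0..t} (\<lambda>s. u2 (?U s \<omega>))"
    if "\<omega> \<in> space M" "0 \<le> t" for \<omega> t
    using integral_equation_of_derivative(1)[of "p \<omega>" "\<lambda>s. v2 (?U s \<omega>)" t]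
      integral_equation_of_derivative(1)[of "\<theta> \<omega>" "\<lambda>s. u2 (?U s \<omega>)" t] eqs(1,2) that
    by (auto simp: has_real_derivative_iff_has_vector_derivative)
  have noise: "noise_v2 R \<nu> (?U t \<omega>) = \<nu> / den (\<theta> \<omega> t)" "noise_u2 R \<nu> (?U t \<omega>) = \<nu> * sin (\<theta> \<omega> t) / den (\<theta> \<omega> t)" for t \<omega>
    using noise_to_angle[OF U(2)] by auto
  show ?thesis
    unfolding solution_def
  proof (intro conjI allI impI ballI)
    show "AE \<omega> in M. ?U 0 \<omega> = x" by (rule AE_I2) (rule canonical_0)
    fix t :: real assume t: "0 \<le> t"
    show "AE \<omega> in M. v1 (?U t \<omega>) = v1 (?U 0 \<omega>) + integral {0..t} (\<lambda>s. v2 (?U s \<omega>))"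
      by (rule AE_I2) (simp only: U(1) int(1)[OF _ t])
    show "AE \<omega> in M. u1 (?U t \<omega>) = u1 (?U 0 \<omega>) + to_angle (integral {0..t} (\<lambda>s. u2 (?U s \<omega>)))"
      by (rule AE_I2) (simp only: U(2) to_angle_add int(2)[OF _ t])
  next
    show "ito_process M F W (\<lambda>t \<omega>. v2 (?U t \<omega>)) (\<lambda>t \<omega>. drift_v2 R \<zeta>1 \<zeta>2 chi \<kappa> (?U t \<omega>)) (\<lambda>t \<omega>. noise_v2 R \<nu> (?U t \<omega>))"
    proof (rule ito_process_C1I[where b'="\<lambda>t \<omega>. noise_v2' (\<theta> \<omega> t) (u2 (?U t \<omega>))"])
      fix \<omega> s assume \<omega>: "\<omega> \<in> space M" and s: "0 \<le> (s :: real)"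
      show "((\<lambda>s. noise_v2 R \<nu> (?U s \<omega>)) has_real_derivative noise_v2' (\<theta> \<omega> s) (u2 (?U s \<omega>))) (at s within {0..})"
        unfolding noise by (rule noise_derivative(1)[OF eqs(2)[OF \<omega> s]])
      \<comment> \<open>Affinity of \<open>vel\<close> in the momentum: removing the noise from the
        velocity yields \<open>vel\<close> at the momentum \<open>y\<close>, whose derivative is
        known.\<close>
      have "v2 (?U s \<omega>) - noise_v2 R \<nu> (?U s \<omega>) * noise \<omega> s = vel (y \<omega> s) (\<theta> \<omega> s) (q \<omega> s)" for s
        unfolding noise U(3) by (simp add: vel_ang_shift)
      then show "((\<lambda>s. v2 (?U s \<omega>) - noise_v2 R \<nu> (?U s \<omega>) * noise \<omega> s) has_real_derivative
          drift_v2 R \<zeta>1 \<zeta>2 chi \<kappa> (?U s \<omega>) - noise_v2' (\<theta> \<omega> s) (u2 (?U s \<omega>)) * noise \<omega> s) (at s within {0..})"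
        using eqs(3)[OF \<omega> s] by simp
    qed (auto intro: measurable_compose[OF canonical_measurable] noise_bounded cont continuous_on_noise' \<theta>_cont)
    show "ito_process M F W (\<lambda>t \<omega>. u2 (?U t \<omega>)) (\<lambda>t \<omega>. drift_u2 R \<zeta>1 \<zeta>2 chi \<kappa> (?U t \<omega>)) (\<lambda>t \<omega>. noise_u2 R \<nu> (?U t \<omega>))"
    proof (rule ito_process_C1I[where b'="\<lambda>t \<omega>. noise_u2' (\<theta> \<omega> t) (u2 (?U t \<omega>))"])
      fix \<omega> s assume \<omega>: "\<omega> \<in> space M" and s: "0 \<le> (s :: real)"
      show "((\<lambda>s. noise_u2 R \<nu> (?U s \<omega>)) has_real_derivative noise_u2' (\<theta> \<omega> s) (u2 (?U s \<omega>))) (at s within {0..})"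
        unfolding noise by (rule noise_derivative(2)[OF eqs(2)[OF \<omega> s]])
      have "u2 (?U s \<omega>) - noise_u2 R \<nu> (?U s \<omega>) * noise \<omega> s = ang (y \<omega> s) (\<theta> \<omega> s) (q \<omega> s)" for s
        unfolding noise U(4) by (simp add: vel_ang_shift)
      then show "((\<lambda>s. u2 (?U s \<omega>) - noise_u2 R \<nu> (?U s \<omega>) * noise \<omega> s) has_real_derivative
          drift_u2 R \<zeta>1 \<zeta>2 chi \<kappa> (?U s \<omega>) - noise_u2' (\<theta> \<omega> s) (u2 (?U s \<omega>)) * noise \<omega> s) (at s within {0..})"
        using eqs(4)[OF \<omega> s] by simp
    qed (auto intro: measurable_compose[OF canonical_measurable] noise_bounded cont continuous_on_noise' \<theta>_cont)
  qed (auto intro: canonical_measurable canonical_continuous)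
qed

text \<open>Outside one null set an arbitrary solution satisfies all equations in pathwise form, and
  its momenta solve the same random differential equation from the same point as
  \<open>path\<close>. Uniqueness for that equation decides.\<close>

theorem solution_unique:
  assumes V: "solution R \<zeta>1 \<zeta>2 chi \<kappa> \<nu> M F W x V"
  shows "AE \<omega> in M. \<forall>t\<ge>0. V t \<omega> = canonical x t \<omega>"
proof -
  have meas: "\<And>t. 0 \<le> t \<Longrightarrow> V t \<in> F t \<rightarrow>\<^sub>M borel"
    and cont_V: "\<And>\<omega>. \<omega> \<in> space M \<Longrightarrow> continuous_on {0..} (\<lambda>t. V t \<omega>)"
    and init: "AE \<omega> in M. V 0 \<omega> = x"
    and eq_p: "\<And>t. 0 \<le> t \<Longrightarrow> AE \<omega> in M. v1 (V t \<omega>) = v1 (V 0 \<omega>) + integral {0..t} (\<lambda>s. v2 (V s \<omega>))"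
    and eq_\<theta>: "\<And>t. 0 \<le> t \<Longrightarrow> AE \<omega> in M. u1 (V t \<omega>) = u1 (V 0 \<omega>) + to_angle (integral {0..t} (\<lambda>s. u2 (V s \<omega>)))"
    and ito_v: "ito_process M F W (\<lambda>t \<omega>. v2 (V t \<omega>)) (\<lambda>t \<omega>. drift_v2 R \<zeta>1 \<zeta>2 chi \<kappa> (V t \<omega>)) (\<lambda>t \<omega>. noise_v2 R \<nu> (V t \<omega>))"
    and ito_u: "ito_process M F W (\<lambda>t \<omega>. u2 (V t \<omega>)) (\<lambda>t \<omega>. drift_u2 R \<zeta>1 \<zeta>2 chi \<kappa> (V t \<omega>)) (\<lambda>t \<omega>. noise_u2 R \<nu> (V t \<omega>))"
    using V unfolding solution_def by blast+
  note cont = continuous_on_process[OF cont_V]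
  \<comment> \<open>A differentiable lift of the angle to the real line. It agrees with the angle of
    \<open>V\<close> a priori only at each fixed time; the identity for all times is obtained
    through sine and cosine.\<close>
  define \<theta> where "\<theta> \<omega> t = lift_angle (u1 x) + integral {0..t} (\<lambda>s. u2 (V s \<omega>))" for \<omega> t
  have \<theta>_der: "(\<theta> \<omega> has_real_derivative u2 (V t \<omega>)) (at t within {0..})" if "\<omega> \<in> space M" "0 \<le> t" for \<omega> t
    unfolding \<theta>_def[abs_def] has_real_derivative_iff_has_vector_derivative
    using integral_has_vector_derivative_halfline[OF cont(3)[OF that(1)] that(2)] by (auto intro!: derivative_eq_intros)
  have \<theta>_cont: "continuous_on {0..} (\<theta> \<omega>)" if "\<omega> \<in> space M" for \<omega>
    by (rule DERIV_continuous_on) (use \<theta>_der[OF that] in auto)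
  have p: "AE \<omega> in M. \<forall>t\<ge>0. v1 (V t \<omega>) = v1 (V 0 \<omega>) + integral {0..t} (\<lambda>s. v2 (V s \<omega>))"
    by (rule AE_eq_all_times[OF _ eq_p]) (intro AE_I2 conjI continuous_intros integral_continuous_halfline cont)
  have angle_t: "AE \<omega> in M. u1 (V t \<omega>) = to_angle (\<theta> \<omega> t)" if "0 \<le> t" for t
    using eq_\<theta>[OF that] init by eventually_elim (simp add: \<theta>_def flip: to_angle_add)
  have "AE \<omega> in M. \<forall>t\<ge>0. angle_sin (u1 (V t \<omega>)) = sin (\<theta> \<omega> t)"
  proof (rule AE_eq_all_times)
    show "AE \<omega> in M. angle_sin (u1 (V t \<omega>)) = sin (\<theta> \<omega> t)" if "0 \<le> t" for t
      using angle_t[OF that] by eventually_elim simp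
  qed (intro AE_I2 conjI continuous_on_sin cont \<theta>_cont)
  moreover have "AE \<omega> in M. \<forall>t\<ge>0. angle_cos (u1 (V t \<omega>)) = cos (\<theta> \<omega> t)"
  proof (rule AE_eq_all_times)
    show "AE \<omega> in M. angle_cos (u1 (V t \<omega>)) = cos (\<theta> \<omega> t)" if "0 \<le> t" for t
      using angle_t[OF that] by eventually_elim simp
  qed (intro AE_I2 conjI continuous_on_cos cont \<theta>_cont)
  ultimately have angle: "AE \<omega> in M. \<forall>t\<ge>0. u1 (V t \<omega>) = to_angle (\<theta> \<omega> t)"
    by eventually_elim (simp add: angle_eq_iff)
  have v: "AE \<omega> in M. \<forall>t\<ge>0. ((\<lambda>s. v2 (V s \<omega>) - noise_v2 R \<nu> (V s \<omega>) * noise \<omega> s) has_real_derivative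
      drift_v2 R \<zeta>1 \<zeta>2 chi \<kappa> (V t \<omega>) - noise_v2' (\<theta> \<omega> t) (u2 (V t \<omega>)) * noise \<omega> t) (at t within {0..})"
  proof (rule ito_process_C1D[OF ito_v])
    show "AE \<omega> in M. (\<forall>s\<ge>0. ((\<lambda>s. noise_v2 R \<nu> (V s \<omega>)) has_real_derivative noise_v2' (\<theta> \<omega> s) (u2 (V s \<omega>))) (at s within {0..}))
      \<and> continuous_on {0..} (\<lambda>s. noise_v2' (\<theta> \<omega> s) (u2 (V s \<omega>)))"
      using angle AE_space
    proof eventually_elim
      case (elim \<omega>)
      have "((\<lambda>s. noise_v2 R \<nu> (V s \<omega>)) has_real_derivative noise_v2' (\<theta> \<omega> s) (u2 (V s \<omega>))) (at s within {0..})"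
        if s: "0 \<le> s" for s
        using noise_derivative(1)[OF \<theta>_der[OF elim(2) s]]
        by (rule has_field_derivative_transform_within[OF _ zero_less_one]) (use elim s in \<open>auto simp: noise_to_angle\<close>)
      then show ?case using elim by (auto intro: continuous_on_noise' \<theta>_cont cont)
    qed
  qed (auto intro: measurable_compose[OF meas] noise_bounded cont)
  have u: "AE \<omega> in M. \<forall>t\<ge>0. ((\<lambda>s. u2 (V s \<omega>) - noise_u2 R \<nu> (V s \<omega>) * noise \<omega> s) has_real_derivative
      drift_u2 R \<zeta>1 \<zeta>2 chi \<kappa> (V t \<omega>) - noise_u2' (\<theta> \<omega> t) (u2 (V t \<omega>)) * noise \<omega> t) (at t within {0..})"
  proof (rule ito_process_C1D[OF ito_u])
    show "AE \<omega> in M. (\<forall>s\<ge>0. ((\<lambda>s. noise_u2 R \<nu> (V s \<omega>)) has_real_derivative noise_u2' (\<theta> \<omega> s) (u2 (V s \<omega>))) (at s within {0..}))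
      \<and> continuous_on {0..} (\<lambda>s. noise_u2' (\<theta> \<omega> s) (u2 (V s \<omega>)))"
      using angle AE_space
    proof eventually_elim
      case (elim \<omega>)
      have "((\<lambda>s. noise_u2 R \<nu> (V s \<omega>)) has_real_derivative noise_u2' (\<theta> \<omega> s) (u2 (V s \<omega>))) (at s within {0..})"
        if s: "0 \<le> s" for s
        using noise_derivative(2)[OF \<theta>_der[OF elim(2) s]]
        by (rule has_field_derivative_transform_within[OF _ zero_less_one]) (use elim s in \<open>auto simp: noise_to_angle\<close>)
      then show ?case using elim by (auto intro: continuous_on_noise' \<theta>_cont cont)
    qed
  qed (auto intro: measurable_compose[OF meas] noise_bounded cont)
  from init p angle v u AE_space show ?thesis
  proof eventually_elim
    case (elim \<omega>)
    define v' u' where "v' t = v2 (V t \<omega>) - noise_v2 R \<nu> (V t \<omega>) * noise \<omega> t"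
      and "u' t = u2 (V t \<omega>) - noise_u2 R \<nu> (V t \<omega>) * noise \<omega> t" for t
    define Y where "Y = (\<lambda>t. (v1 (V t \<omega>), v' t - R * u' t * sin (\<theta> \<omega> t), \<theta> \<omega> t, u' t - v' t * sin (\<theta> \<omega> t)))"
    have p_der: "((\<lambda>t. v1 (V t \<omega>)) has_real_derivative v2 (V t \<omega>)) (at t within {0..})" if t: "0 \<le> t" for t
    proof -
      have "((\<lambda>t. v1 (V 0 \<omega>) + integral {0..t} (\<lambda>s. v2 (V s \<omega>))) has_real_derivative v2 (V t \<omega>)) (at t within {0..})"
        unfolding has_real_derivative_iff_has_vector_derivative
        using integral_has_vector_derivative_halfline[OF cont(2) t] elim by (auto intro!: derivative_eq_intros)
      then show ?thesis
        by (rule has_field_derivative_transform_within[OF _ zero_less_one]) (use elim t in auto)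
    qed
    have Y: "(Y has_vector_derivative field (noise \<omega> t) (Y t)) (at t within {0..})" "V t \<omega> = state_of (noise \<omega> t) (Y t)"
      if t: "0 \<le> t" for t
      using equations_imp_field[of "\<lambda>t. V t \<omega>" t "{0..}" "\<theta> \<omega>" v' "noise \<omega>" u' Y]
        p_der[OF t] \<theta>_der[OF _ t, of \<omega>] elim t
      by (auto simp: v'_def[abs_def] u'_def[abs_def] Y_def noise_to_angle)
    have "Y 0 = momenta x"
      using elim by (simp add: Y_def momenta_def Let_def v'_def u'_def \<theta>_def)
    have "Y t = path x \<omega> t" if t: "0 \<le> t" for t
    proof (rule field_unique[where w="noise \<omega>" and T=t])
      show "continuous_on {0..} (noise \<omega>)" using elim by (intro noise_continuous)
      show "(Y has_vector_derivative field (noise \<omega> s) (Y s)) (at s within {0..})" if "s \<in> {0..t}" for s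
        using Y(1) that by simp
      show "(path x \<omega> has_vector_derivative field (noise \<omega> s) (path x \<omega> s)) (at s within {0..})" if "s \<in> {0..t}" for s
        using path_derivative that elim by simp
      show "Y 0 = path x \<omega> 0" using \<open>Y 0 = momenta x\<close> path_0 elim by simp
    qed (use t in simp)
    then show ?case using Y(2) by (simp add: canonical_def)
  qed
qed

end


section \<open>The Lyapunov function\<close>

lemma abs_mult_le_sum_squares: "\<bar>a * b\<bar> \<le> (a\<^sup>2 + b\<^sup>2) / 2" for a b :: real
proof -
  have "0 \<le> (\<bar>a\<bar> - \<bar>b\<bar>)\<^sup>2" by simp
  then show ?thesis by (simp add: power2_eq_square algebra_simps abs_mult)
qed

context pendulum
begin

text \<open>The derivative of \<open>lyap\<close> along the flow. The true velocities
  \<open>v\<close>, \<open>u\<close> are separate arguments because \<open>m\<close> will be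
  evaluated with the noise frozen at another time than the one that drives the motion.\<close>

definition lyap_rate :: "real \<Rightarrow> real \<Rightarrow> real \<Rightarrow> real \<Rightarrow> real \<Rightarrow> real \<Rightarrow> real \<Rightarrow> real" where
  "lyap_rate \<epsilon> p m \<theta> q v u =
     vel m \<theta> q * (- 2 * \<zeta>1 * v - chi\<^sup>2 * p) + R * ang m \<theta> q * (- 2 * \<zeta>2 * u - \<kappa>\<^sup>2 * sin \<theta> - v * u * cos \<theta>)
     + R * cos \<theta> * ang m \<theta> q * vel m \<theta> q * u + chi\<^sup>2 * p * v + \<epsilon> * (v * m + p * (- 2 * \<zeta>1 * v - chi\<^sup>2 * p))"

text \<open>The terms with \<beta> and with \<open>1 - R\<close> are the corrections of the
  exponential: half the squared gradient in the noise direction, and half the largest second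
  derivative in the noise. Dissipation of \<open>v\<close> and \<open>u\<close> is friction; that of
  \<open>p\<close> comes from \<open>\<epsilon> p (- chi^2 p)\<close>. The cubic terms cancel when
  \<open>v\<close> and \<open>u\<close> are the velocities of \<open>m\<close> and
  \<open>q\<close>.\<close>

lemma lyapunov_constants:
  "\<exists>\<epsilon> c \<beta> c1 c2 K. 0 < c \<and> 0 < \<beta> \<and> 0 < c1 \<and> c1 \<le> c2 \<and> 0 \<le> K \<and>
    (\<forall>p m \<theta> q v u. v = vel m \<theta> q \<longrightarrow> u = ang m \<theta> q \<longrightarrow>
       c1 * (p\<^sup>2 + v\<^sup>2 + u\<^sup>2) \<le> lyap \<epsilon> p m \<theta> q \<and> lyap \<epsilon> p m \<theta> q \<le> c2 * (p\<^sup>2 + v\<^sup>2 + u\<^sup>2) \<and>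
       c * lyap \<epsilon> p m \<theta> q + lyap_rate \<epsilon> p m \<theta> q v u + \<beta> / 2 * \<nu>\<^sup>2 * (v + \<epsilon> * p)\<^sup>2 + \<nu>\<^sup>2 / (2 * (1 - R)) \<le> K)"
proof -
  obtain a where a: "0 < a" "\<And>p m \<theta> q. a * (p\<^sup>2 + (vel m \<theta> q)\<^sup>2 + (ang m \<theta> q)\<^sup>2) \<le> lyap 0 p m \<theta> q"
    using lyap_0_lower_bound by blast
  \<comment> \<open>The multiple of \<open>\<epsilon> v^2\<close> that the cross term can cost: 1
    from \<open>v m\<close>, 1/2 from the mixed product with \<open>u\<close>, and the rest from
    splitting the product of \<open>p\<close> and \<open>v\<close>.\<close>
  define k where "k = 3 / 2 + 4 * \<zeta>1\<^sup>2 / chi\<^sup>2"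
  have k: "0 < k" using pos by (simp add: k_def add_pos_nonneg)
  \<comment> \<open>Three demands: half of the lower bound \<open>a\<close> must survive the cross
    term, half the friction in \<open>v\<close> must absorb the cost \<open>k\<close>, and half the
    friction in \<open>u\<close> must absorb its share.\<close>
  define \<epsilon> where "\<epsilon> = min (a / 2) (min (\<zeta>1 / k) (2 * R * \<zeta>2))"
  have \<epsilon>: "0 < \<epsilon>" "\<epsilon> \<le> a / 2" "\<epsilon> * k \<le> \<zeta>1" "\<epsilon> \<le> 2 * R * \<zeta>2"
  proof -
    show "0 < \<epsilon>" using a(1) k pos R by (simp add: \<epsilon>_def)
    have "\<epsilon> \<le> \<zeta>1 / k" by (simp add: \<epsilon>_def)
    then show "\<epsilon> * k \<le> \<zeta>1" using k by (simp add: pos_le_divide_eq)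
    show "\<epsilon> \<le> a / 2" "\<epsilon> \<le> 2 * R * \<zeta>2" unfolding \<epsilon>_def by linarith+
  qed
  \<comment> \<open>The dissipation rate left over in each of the three directions. Of
    \<open>d S\<close>, one quarter is spent on \<open>c\<close> times the function, one on the
    force of the angle and one on the term with \<beta>; this fixes \<open>c\<close>,
    \<open>\<beta>\<close> and \<open>K\<close>.\<close>
  define d where "d = min \<zeta>1 (min (R * \<zeta>2) (\<epsilon> * chi\<^sup>2 / 2))"
  have d: "0 < d" "d \<le> \<zeta>1" "d \<le> R * \<zeta>2" "d \<le> \<epsilon> * chi\<^sup>2 / 2"
    using \<epsilon> pos R by (auto simp: d_def)
  \<comment> \<open>\<open>1 + chi\<^sup>2 / 2\<close> bounds the energy and
    \<open>\<epsilon>\<close> the cross term; adding \<open>a\<close> makes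
    \<open>a / 2 \<le> c2\<close> immediate.\<close>
  define c2 where "c2 = 1 + chi\<^sup>2 / 2 + \<epsilon> + a"
  have c2: "0 < c2" using \<epsilon> a by (simp add: c2_def add_pos_nonneg)
  define c where "c = d / (4 * c2)"
  define \<beta> where "\<beta> = d / (4 * \<nu>\<^sup>2 * (1 + \<epsilon>\<^sup>2))"
  define K where "K = (R * \<kappa>\<^sup>2)\<^sup>2 / d + \<nu>\<^sup>2 / (2 * (1 - R))"
  have e2: "0 < 1 + \<epsilon>\<^sup>2" by (simp add: add_pos_nonneg)
  have 1: "0 < c" "0 < \<beta>" "0 < a / 2" "a / 2 \<le> c2" "0 \<le> K"
    using d c2 e2 pos R a \<epsilon> by (auto simp: c_def \<beta>_def K_def c2_def)
  have main: "c1' * (p\<^sup>2 + v\<^sup>2 + u\<^sup>2) \<le> lyap \<epsilon> p m \<theta> q \<and> lyap \<epsilon> p m \<theta> q \<le> c2 * (p\<^sup>2 + v\<^sup>2 + u\<^sup>2) \<and>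
       c * lyap \<epsilon> p m \<theta> q + lyap_rate \<epsilon> p m \<theta> q v u + \<beta> / 2 * \<nu>\<^sup>2 * (v + \<epsilon> * p)\<^sup>2 + \<nu>\<^sup>2 / (2 * (1 - R)) \<le> K"
    if v: "v = vel m \<theta> q" and u: "u = ang m \<theta> q" and c1': "c1' = a / 2" for p m \<theta> q v u c1'
  proof -
    define S where "S = p\<^sup>2 + v\<^sup>2 + u\<^sup>2"
    define s where "s = sin \<theta>"
    have S: "0 \<le> S" "v\<^sup>2 \<le> S" "u\<^sup>2 \<le> S" "p\<^sup>2 \<le> S" by (simp_all add: S_def)
    have s: "\<bar>s\<bar> \<le> 1" "\<bar>R * s\<bar> \<le> 1" using R abs_mult_le[of R 1 s 1] by (auto simp: s_def)
    have m: "m = v - R * s * u" using vel_ang(1)[of m \<theta> q] by (simp add: v u s_def algebra_simps)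
    have uv: "\<bar>R * s * (u * v)\<bar> \<le> (u\<^sup>2 + v\<^sup>2) / 2" and up: "\<bar>R * s * (u * p)\<bar> \<le> (u\<^sup>2 + p\<^sup>2) / 2"
      using abs_mult_le[OF s(2) abs_mult_le_sum_squares[of u v]] abs_mult_le[OF s(2) abs_mult_le_sum_squares[of u p]]
      by simp_all
    have pv: "\<bar>p * v\<bar> \<le> (p\<^sup>2 + v\<^sup>2) / 2" by (rule abs_mult_le_sum_squares)
    have "p * m = p * v - R * s * (u * p)" unfolding m by (simp add: algebra_simps)
    then have "\<bar>p * m\<bar> \<le> \<bar>p * v\<bar> + \<bar>R * s * (u * p)\<bar>" by linarith
    moreover have "2 * \<bar>R * s * (u * p)\<bar> \<le> u\<^sup>2 + p\<^sup>2" "2 * \<bar>p * v\<bar> \<le> p\<^sup>2 + v\<^sup>2" using up pv by simp_all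
    moreover have "0 \<le> v\<^sup>2" "0 \<le> u\<^sup>2" by simp_all
    ultimately have pm: "\<bar>p * m\<bar> \<le> S" unfolding S_def by linarith
    have V: "lyap \<epsilon> p m \<theta> q = lyap 0 p m \<theta> q + \<epsilon> * (p * m)" by (simp add: lyap_def)
    have "\<bar>\<epsilon> * (p * m)\<bar> \<le> \<epsilon> * S" by (rule abs_mult_le) (use \<epsilon> pm in auto)
    then have eps: "- (\<epsilon> * S) \<le> \<epsilon> * (p * m)" "\<epsilon> * (p * m) \<le> \<epsilon> * S" by auto
    have "\<epsilon> * S \<le> a / 2 * S" using \<epsilon>(2) S(1) by (rule mult_right_mono)
    moreover have "a * S \<le> lyap 0 p m \<theta> q" unfolding S_def v u by (rule a(2))
    moreover have "a * S = a / 2 * S + a / 2 * S" by simp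
    ultimately have lower: "a / 2 * S \<le> lyap \<epsilon> p m \<theta> q" unfolding V using eps by linarith
    have "2 * lyap 0 p m \<theta> q = v\<^sup>2 - 2 * (R * s * (u * v)) + R * u\<^sup>2 + chi\<^sup>2 * p\<^sup>2"
      unfolding lyap_def kinetic_velocities by (simp add: v u s_def field_simps)
    moreover have "R * u\<^sup>2 \<le> 1 * u\<^sup>2" using R by (intro mult_right_mono) auto
    moreover have "chi\<^sup>2 * p\<^sup>2 \<le> chi\<^sup>2 * S" using S(4) by (intro mult_left_mono) auto
    moreover have "- (2 * (R * s * (u * v))) \<le> u\<^sup>2 + v\<^sup>2" using uv by (simp add: abs_le_iff)
    moreover have "0 \<le> p\<^sup>2" "S = p\<^sup>2 + v\<^sup>2 + u\<^sup>2" by (simp_all add: S_def)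
    ultimately have "2 * lyap 0 p m \<theta> q \<le> 2 * S + chi\<^sup>2 * S" by linarith
    moreover have "2 * (c2 * S) = 2 * S + chi\<^sup>2 * S + 2 * (\<epsilon> * S) + 2 * (a * S)" by (simp add: c2_def algebra_simps)
    ultimately have upper: "lyap \<epsilon> p m \<theta> q \<le> c2 * S" unfolding V using eps a(1) S(1) by (smt (verit) mult_nonneg_nonneg)
    have "c * lyap \<epsilon> p m \<theta> q \<le> c * (c2 * S)" using upper 1(1) by (intro mult_left_mono) auto
    also have "c * (c2 * S) = d / 4 * S" using c2 by (simp add: c_def)
    finally have cV: "c * lyap \<epsilon> p m \<theta> q \<le> d / 4 * S" .
    have rate: "lyap_rate \<epsilon> p m \<theta> q v u = - 2 * \<zeta>1 * v\<^sup>2 - 2 * R * \<zeta>2 * u\<^sup>2 - R * \<kappa>\<^sup>2 * (s * u)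
        + (\<epsilon> * v\<^sup>2 - \<epsilon> * (R * s * (u * v)) - \<epsilon> * (2 * \<zeta>1 * (p * v)) - \<epsilon> * chi\<^sup>2 * p\<^sup>2)"
      unfolding lyap_rate_def v[symmetric] u[symmetric] s_def[symmetric] unfolding m
      by (simp add: algebra_simps power2_eq_square)
    \<comment> \<open>Young's inequality, weighted so that at least half of the dissipation in
      \<open>p\<close> remains.\<close>
    have "2 * \<zeta>1 * \<bar>p * v\<bar> = 2 * \<bar>(chi * p / 2) * (2 * \<zeta>1 * v / chi)\<bar>"
      using pos by (simp add: abs_mult)
    also have "\<dots> \<le> 2 * (((chi * p / 2)\<^sup>2 + (2 * \<zeta>1 * v / chi)\<^sup>2) / 2)"
      by (intro mult_left_mono abs_mult_le_sum_squares) simp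
    also have "\<dots> \<le> chi\<^sup>2 / 2 * p\<^sup>2 + 4 * \<zeta>1\<^sup>2 / chi\<^sup>2 * v\<^sup>2"
      by (simp add: power_mult_distrib power_divide)
    finally have x: "2 * \<zeta>1 * \<bar>p * v\<bar> \<le> chi\<^sup>2 / 2 * p\<^sup>2 + 4 * \<zeta>1\<^sup>2 / chi\<^sup>2 * v\<^sup>2" .
    have "\<epsilon> * - (2 * \<zeta>1 * (p * v)) \<le> \<epsilon> * (chi\<^sup>2 / 2 * p\<^sup>2 + 4 * \<zeta>1\<^sup>2 / chi\<^sup>2 * v\<^sup>2)"
    proof (rule mult_left_mono)
      have "- (2 * \<zeta>1 * (p * v)) \<le> 2 * \<zeta>1 * \<bar>p * v\<bar>"
        using pos mult_left_mono[of "- (p * v)" "\<bar>p * v\<bar>" "2 * \<zeta>1"] by simp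
      then show "- (2 * \<zeta>1 * (p * v)) \<le> chi\<^sup>2 / 2 * p\<^sup>2 + 4 * \<zeta>1\<^sup>2 / chi\<^sup>2 * v\<^sup>2" using x by simp
    qed (use \<epsilon> in simp)
    moreover have "\<epsilon> * - (R * s * (u * v)) \<le> \<epsilon> * ((u\<^sup>2 + v\<^sup>2) / 2)"
      using uv \<epsilon> by (intro mult_left_mono) auto
    moreover have "\<epsilon> * k * v\<^sup>2 \<le> \<zeta>1 * v\<^sup>2" using \<epsilon>(3) by (rule mult_right_mono) simp
    moreover have "\<epsilon> * u\<^sup>2 \<le> 2 * R * \<zeta>2 * u\<^sup>2" using \<epsilon>(4) by (rule mult_right_mono) simp
    moreover have "\<epsilon> * k * v\<^sup>2 = \<epsilon> * v\<^sup>2 + \<epsilon> * (v\<^sup>2 / 2) + \<epsilon> * (4 * \<zeta>1\<^sup>2 / chi\<^sup>2 * v\<^sup>2)"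
      by (simp add: k_def algebra_simps)
    moreover have "\<epsilon> * ((u\<^sup>2 + v\<^sup>2) / 2) = \<epsilon> * u\<^sup>2 / 2 + \<epsilon> * (v\<^sup>2 / 2)" by (simp add: field_simps)
    moreover have "\<epsilon> * (chi\<^sup>2 / 2 * p\<^sup>2 + 4 * \<zeta>1\<^sup>2 / chi\<^sup>2 * v\<^sup>2) = \<epsilon> * chi\<^sup>2 / 2 * p\<^sup>2 + \<epsilon> * (4 * \<zeta>1\<^sup>2 / chi\<^sup>2 * v\<^sup>2)"
      by (simp add: algebra_simps)
    moreover have "\<epsilon> * - (2 * \<zeta>1 * (p * v)) = - (\<epsilon> * (2 * \<zeta>1 * (p * v)))" "\<epsilon> * - (R * s * (u * v)) = - (\<epsilon> * (R * s * (u * v)))"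
      by simp_all
    moreover have "\<epsilon> * chi\<^sup>2 * p\<^sup>2 = 2 * (\<epsilon> * chi\<^sup>2 / 2 * p\<^sup>2)" "2 * \<zeta>1 * v\<^sup>2 = 2 * (\<zeta>1 * v\<^sup>2)" by simp_all
    moreover have "- 2 * \<zeta>1 * v\<^sup>2 = - (2 * \<zeta>1 * v\<^sup>2)" "2 * R * \<zeta>2 * u\<^sup>2 = 2 * (R * \<zeta>2 * u\<^sup>2)" by simp_all
    ultimately have "lyap_rate \<epsilon> p m \<theta> q v u \<le> - (\<zeta>1 * v\<^sup>2) - R * \<zeta>2 * u\<^sup>2 - \<epsilon> * chi\<^sup>2 / 2 * p\<^sup>2 - R * \<kappa>\<^sup>2 * (s * u)"
      unfolding rate by linarith
    moreover have "d * v\<^sup>2 \<le> \<zeta>1 * v\<^sup>2" "d * u\<^sup>2 \<le> R * \<zeta>2 * u\<^sup>2" "d * p\<^sup>2 \<le> \<epsilon> * chi\<^sup>2 / 2 * p\<^sup>2"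
      by (rule mult_right_mono[OF d(2)] mult_right_mono[OF d(3)] mult_right_mono[OF d(4)], simp)+
    moreover have "d * S = d * p\<^sup>2 + d * v\<^sup>2 + d * u\<^sup>2" by (simp add: S_def algebra_simps)
    moreover have "- (R * \<kappa>\<^sup>2 * (s * u)) \<le> d / 4 * S + (R * \<kappa>\<^sup>2)\<^sup>2 / d"
    proof -
      have "\<bar>s * u\<bar> \<le> 1 * \<bar>u\<bar>" by (rule abs_mult_le) (use s in auto)
      then have "R * \<kappa>\<^sup>2 * - (s * u) \<le> R * \<kappa>\<^sup>2 * \<bar>u\<bar>" using R by (intro mult_left_mono) auto
      moreover have "0 \<le> (d / 2 * \<bar>u\<bar> - R * \<kappa>\<^sup>2)\<^sup>2 / d" using d by simp
      moreover have "(d / 2 * \<bar>u\<bar> - R * \<kappa>\<^sup>2)\<^sup>2 / d = d / 4 * u\<^sup>2 - R * \<kappa>\<^sup>2 * \<bar>u\<bar> + (R * \<kappa>\<^sup>2)\<^sup>2 / d"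
        using d(1) by (simp add: power2_diff power_mult_distrib field_simps) (simp add: power2_eq_square)
      moreover have "d / 4 * u\<^sup>2 \<le> d / 4 * S" using S d by (intro mult_left_mono) auto
      ultimately show ?thesis by simp
    qed
    ultimately have LV: "lyap_rate \<epsilon> p m \<theta> q v u \<le> - (d * S) + d / 4 * S + (R * \<kappa>\<^sup>2)\<^sup>2 / d" by linarith
    have "(v + \<epsilon> * p)\<^sup>2 \<le> 2 * (1 + \<epsilon>\<^sup>2) * S"
    proof -
      have "0 \<le> (v - \<epsilon> * p)\<^sup>2" by simp
      then have "(v + \<epsilon> * p)\<^sup>2 \<le> 2 * v\<^sup>2 + 2 * \<epsilon>\<^sup>2 * p\<^sup>2" by (simp add: power2_eq_square algebra_simps)
      also have "\<dots> \<le> 2 * S + 2 * \<epsilon>\<^sup>2 * S" using S by (intro add_mono mult_left_mono) auto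
      finally show ?thesis by (simp add: algebra_simps)
    qed
    then have "\<beta> / 2 * \<nu>\<^sup>2 * (v + \<epsilon> * p)\<^sup>2 \<le> \<beta> / 2 * \<nu>\<^sup>2 * (2 * (1 + \<epsilon>\<^sup>2) * S)"
      using 1(2) by (intro mult_left_mono) auto
    also have "\<beta> / 2 * \<nu>\<^sup>2 * (2 * (1 + \<epsilon>\<^sup>2) * S) = d / 4 * S"
    proof -
      have "d / (4 * \<nu>\<^sup>2 * E) / 2 * \<nu>\<^sup>2 * (2 * E * S) = d / 4 * S" if "0 < E" for E
        using that pos by simp
      from this[OF e2] show ?thesis by (simp only: \<beta>_def)
    qed
    finally have "\<beta> / 2 * \<nu>\<^sup>2 * (v + \<epsilon> * p)\<^sup>2 \<le> d / 4 * S" .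
    moreover have "d / 4 * S + d / 4 * S + d / 4 * S \<le> d * S" using d(1) S(1) by simp
    ultimately have "c * lyap \<epsilon> p m \<theta> q + lyap_rate \<epsilon> p m \<theta> q v u + \<beta> / 2 * \<nu>\<^sup>2 * (v + \<epsilon> * p)\<^sup>2 + \<nu>\<^sup>2 / (2 * (1 - R)) \<le> K"
      using cV LV unfolding K_def by linarith
    with lower upper show ?thesis unfolding c1' S_def by simp
  qed
  show ?thesis
    by (rule exI[of _ \<epsilon>], rule exI[of _ c], rule exI[of _ \<beta>], rule exI[of _ "a / 2"], rule exI[of _ c2], rule exI[of _ K],
        intro conjI[OF 1(1)] conjI[OF 1(2)] conjI[OF 1(3)] conjI[OF 1(4)] conjI[OF 1(5)] allI impI)
      (rule main[OF _ _ refl])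
qed

end


text \<open>The cost of normalisation is linear in \<open>h\<close>, with
  \<open>(a^2 / 2 + b) h\<close> the Ito correction; \<open>- ln x \<le> 1 / x - 1\<close> handles
  the logarithm. The common bound \<open>B\<close> gives all steps the same factor, which tends to 1
  with the mesh.\<close>

lemma gauss_exponent_bound:
  assumes "0 \<le> h" "0 \<le> b" "b \<le> B" "2 * B * h < 1"
  shows "a * d + b * d\<^sup>2 \<le> gauss_exponent a b h d + (a\<^sup>2 / 2 + b) * h / (1 - 2 * B * h)"
proof -
  have bB: "2 * b * h \<le> 2 * B * h" using assms by (simp add: mult_right_mono)
  define x where "x = 1 - 2 * b * h"
  have x: "0 < x" "1 - 2 * B * h \<le> x" "0 < 1 - 2 * B * h" using bB assms by (auto simp: x_def)
  define z P P' Q where "z = 1 - 2 * B * h" and "P = a\<^sup>2 * h / (2 * z)" and "P' = a\<^sup>2 * h / (2 * x)" and "Q = 2 * b * h / z"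
  have z: "0 < z" "z \<le> x" using x by (auto simp: z_def)
  have "P' \<le> P"
    unfolding P_def P'_def using x z assms by (intro divide_left_mono) auto
  moreover have "- ln x \<le> Q"
  proof -
    have "- ln x = ln (1 / x)" using x by (simp add: ln_div)
    also have "\<dots> \<le> 1 / x - 1" using x by (intro ln_le_minus_one) simp
    also have "\<dots> = 2 * b * h / x" using x by (simp add: x_def field_simps)
    also have "\<dots> \<le> Q" unfolding Q_def using x z assms by (intro divide_left_mono) auto
    finally show ?thesis .
  qed
  moreover have "(a\<^sup>2 / 2 + b) * h / z = P + Q / 2"
    using z unfolding P_def Q_def by (simp add: field_simps)
  moreover have "gauss_exponent a b h d = a * d + b * d\<^sup>2 - P' + ln x / 2"
    by (simp add: gauss_exponent_def P'_def x_def)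
  ultimately show ?thesis unfolding z_def[symmetric] by simp
qed

context pendulum
begin

section \<open>The exponential supermartingale inequality\<close>

lemma continuous_on_lyap:
  fixes S :: "'c::t2_space set"
  assumes "continuous_on S p" "continuous_on S m" "continuous_on S \<theta>" "continuous_on S q"
  shows "continuous_on S (\<lambda>t. lyap \<epsilon> (p t) (m t) (\<theta> t) (q t))"
  unfolding lyap_def
  by (intro continuous_on_add continuous_on_divide continuous_on_mult continuous_on_power continuous_on_const
      continuous_on_sin continuous_on_den assms) (use den in auto)

lemma continuous_on_lyap_rate:
  fixes S :: "'c::t2_space set"
  assumes "continuous_on S p" "continuous_on S m" "continuous_on S \<theta>" "continuous_on S q" "continuous_on S v" "continuous_on S u"
  shows "continuous_on S (\<lambda>t. lyap_rate \<epsilon> (p t) (m t) (\<theta> t) (q t) (v t) (u t))"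
  unfolding lyap_rate_def
  by (intro continuous_on_add continuous_on_diff continuous_on_mult continuous_on_const
      continuous_on_sin continuous_on_cos continuous_on_vel_ang assms)

text \<open>An exact Taylor expansion, since the function is quadratic in the momentum.\<close>

lemma lyap_shift:
  "lyap \<epsilon> p (m + d) \<theta> q - lyap \<epsilon> p m \<theta> q = (vel m \<theta> q + \<epsilon> * p) * d + d\<^sup>2 / (2 * den \<theta>)"
proof -
  have "den \<theta> \<noteq> 0" by (rule den)
  then show ?thesis
    unfolding lyap_def vel_def by (simp add: field_simps power2_eq_square)
qed

end

context stochastic_pendulum
begin

definition energy :: "real \<Rightarrow> state \<Rightarrow> real \<Rightarrow> 'a \<Rightarrow> real" where
  "energy \<epsilon> x t \<omega> = (case path x \<omega> t of (p, y, \<theta>, q) \<Rightarrow> lyap \<epsilon> p (y + \<nu> * noise \<omega> t) \<theta> q)"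

definition energy_rate :: "real \<Rightarrow> state \<Rightarrow> real \<Rightarrow> 'a \<Rightarrow> real" where
  "energy_rate \<epsilon> x t \<omega> = (case path x \<omega> t of (p, y, \<theta>, q) \<Rightarrow>
     lyap_rate \<epsilon> p (y + \<nu> * noise \<omega> t) \<theta> q (vel (y + \<nu> * noise \<omega> t) \<theta> q) (ang (y + \<nu> * noise \<omega> t) \<theta> q))"

definition energy_noise :: "real \<Rightarrow> state \<Rightarrow> real \<Rightarrow> 'a \<Rightarrow> real" where
  "energy_noise \<epsilon> x t \<omega> = \<nu> * (v2 (canonical x t \<omega>) + \<epsilon> * v1 (canonical x t \<omega>))"

text \<open>Since the energy is a quadratic polynomial in the noise, its increment over a short interval is a
  pathwise derivative plus \<open>a d + b d\<^sup>2\<close>, where \<open>d\<close> is the increment of \<open>W\<close>; no Ito formula is needed.\<close>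

lemma energy_increments:
  fixes x :: state and \<epsilon> \<beta> l s T :: real
  assumes \<omega>: "\<omega> \<in> space M" and "0 \<le> s" "s \<le> T" "0 \<le> \<beta>" "0 \<le> l"
    and \<tau>: "\<And>k. \<tau> k 0 = s" "\<And>k. \<tau> k (n k) = T" "\<And>k i. i < n k \<Longrightarrow> \<tau> k i \<le> \<tau> k (Suc i)"
    and mesh: "\<And>k i. i < n k \<Longrightarrow> \<tau> k (Suc i) - \<tau> k i \<le> h k" and h: "h \<longlonglongrightarrow> 0"
  shows "\<exists>A. A \<longlonglongrightarrow> integral {s..T} (\<lambda>t. \<beta> * exp (l * t) * (l * energy \<epsilon> x t \<omega> + energy_rate \<epsilon> x t \<omega>)) \<and>
    (\<forall>k. \<beta> * exp (l * T) * energy \<epsilon> x T \<omega> - \<beta> * exp (l * s) * energy \<epsilon> x s \<omega> \<le>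
      A k + (\<Sum>i<n k. \<beta> * exp (l * \<tau> k i) * energy_noise \<epsilon> x (\<tau> k i) \<omega> * (W (\<tau> k (Suc i)) \<omega> - W (\<tau> k i) \<omega>)
        + \<beta> * exp (l * \<tau> k i) * \<nu>\<^sup>2 / (2 * (1 - R)) * (W (\<tau> k (Suc i)) \<omega> - W (\<tau> k i) \<omega>)\<^sup>2))"
proof -
  define p y \<theta> q w where "p t = fst (path x \<omega> t)" and "y t = fst (snd (path x \<omega> t))" and "\<theta> t = fst (snd (snd (path x \<omega> t)))"
    and "q t = snd (snd (snd (path x \<omega> t)))" and "w t = \<nu> * noise \<omega> t" for t
  define v u where "v t = vel (y t + w t) (\<theta> t) (q t)" and "u t = ang (y t + w t) (\<theta> t) (q t)" for t
  \<comment> \<open>The time \<open>t\<close> of the motion and the time \<open>r\<close> of the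
    noise are separated. Over a cell the noise is first moved to the right endpoint, at a quadratic
    cost; then time runs with the noise frozen there, and the change is the integral of
    \<open>G\<close>.\<close>
  define f where "f t r = \<beta> * exp (l * t) * lyap \<epsilon> (p t) (y t + w r) (\<theta> t) (q t)" for t r
  define G where "G t r = \<beta> * exp (l * t) * (l * lyap \<epsilon> (p t) (y t + w r) (\<theta> t) (q t)
      + lyap_rate \<epsilon> (p t) (y t + w r) (\<theta> t) (q t) (v t) (u t))" for t r
  have energy: "energy \<epsilon> x t \<omega> = lyap \<epsilon> (p t) (y t + w t) (\<theta> t) (q t)"
    and rate: "energy_rate \<epsilon> x t \<omega> = lyap_rate \<epsilon> (p t) (y t + w t) (\<theta> t) (q t) (v t) (u t)"
    and noise: "energy_noise \<epsilon> x t \<omega> = \<nu> * (v t + \<epsilon> * p t)" for t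
    by (simp_all add: energy_def energy_rate_def energy_noise_def canonical_def state_of_def case_prod_beta' p_def y_def \<theta>_def q_def w_def v_def u_def)
  have field: "field (noise \<omega> t) (path x \<omega> t) = (v t, - 2 * \<zeta>1 * v t - chi\<^sup>2 * p t, u t,
      - 2 * \<zeta>2 * u t - \<kappa>\<^sup>2 * sin (\<theta> t) - v t * u t * cos (\<theta> t))" for t
    by (simp add: field_def case_prod_beta' Let_def p_def y_def \<theta>_def q_def v_def u_def w_def)
  have der: "(p has_real_derivative v t) (at t within {0..})" "(y has_real_derivative - 2 * \<zeta>1 * v t - chi\<^sup>2 * p t) (at t within {0..})"
    "(\<theta> has_real_derivative u t) (at t within {0..})"
    "(q has_real_derivative - 2 * \<zeta>2 * u t - \<kappa>\<^sup>2 * sin (\<theta> t) - v t * u t * cos (\<theta> t)) (at t within {0..})" if "0 \<le> t" for t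
    using tuple_derivatives[OF path_derivative[OF \<omega> that, of x]] unfolding field fst_conv snd_conv
    by (simp_all add: p_def[abs_def] y_def[abs_def] \<theta>_def[abs_def] q_def[abs_def])
  have cont: "continuous_on {s..T} p" "continuous_on {s..T} y" "continuous_on {s..T} \<theta>" "continuous_on {s..T} q" "continuous_on {s..T} w"
  proof -
    have "continuous_on {0..} p" "continuous_on {0..} y" "continuous_on {0..} \<theta>" "continuous_on {0..} q"
      by (rule DERIV_continuous_on[OF der(1)] DERIV_continuous_on[OF der(2)] DERIV_continuous_on[OF der(3)] DERIV_continuous_on[OF der(4)]; simp)+
    moreover have "continuous_on {0..} w"
      unfolding w_def by (intro continuous_intros noise_continuous \<omega>)
    moreover have "{s..T} \<subseteq> {0..}" using \<open>0 \<le> s\<close> by auto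
    ultimately show "continuous_on {s..T} p" "continuous_on {s..T} y" "continuous_on {s..T} \<theta>" "continuous_on {s..T} q" "continuous_on {s..T} w"
      by (blast intro: continuous_on_subset)+
  qed
  have cont_vu: "continuous_on {s..T} v" "continuous_on {s..T} u"
    unfolding v_def u_def by (intro continuous_on_vel_ang continuous_on_add cont)+
  have G_cont: "continuous_on ({s..T} \<times> {s..T}) (\<lambda>(t, r). G t r)"
  proof -
    have 1: "continuous_on ({s..T} \<times> {s..T}) (\<lambda>z. g (fst z))" if "continuous_on {s..T} g" for g :: "real \<Rightarrow> real"
      by (rule continuous_on_compose2[OF that continuous_on_fst[OF continuous_on_id]]) auto
    have 2: "continuous_on ({s..T} \<times> {s..T}) (\<lambda>z. g (snd z))" if "continuous_on {s..T} g" for g :: "real \<Rightarrow> real"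
      by (rule continuous_on_compose2[OF that continuous_on_snd[OF continuous_on_id]]) auto
    have "continuous_on ({s..T} \<times> {s..T}) (\<lambda>z. G (fst z) (snd z))"
      unfolding G_def
      by (intro continuous_on_mult continuous_on_add continuous_on_const continuous_on_exp continuous_on_fst continuous_on_id
          continuous_on_lyap continuous_on_lyap_rate 1[OF cont(1)] 1[OF cont(2)] 1[OF cont(3)] 1[OF cont(4)] 2[OF cont(5)] 1[OF cont_vu(1)] 1[OF cont_vu(2)])
    then show ?thesis by (simp add: case_prod_beta')
  qed
  define A where "A k = (\<Sum>i<n k. integral {\<tau> k i..\<tau> k (Suc i)} (\<lambda>t. G t (\<tau> k (Suc i))))" for k
  have "A \<longlonglongrightarrow> integral {s..T} (\<lambda>t. G t t)"
    unfolding A_def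
    by (rule tagged_integral_limit[OF G_cont \<open>s \<le> T\<close> \<tau>(1,2,3) _ mesh h]) (use \<tau> in auto)
  moreover have "G t t = \<beta> * exp (l * t) * (l * energy \<epsilon> x t \<omega> + energy_rate \<epsilon> x t \<omega>)" for t
    by (simp add: G_def energy rate)
  ultimately have A: "A \<longlonglongrightarrow> integral {s..T} (\<lambda>t. \<beta> * exp (l * t) * (l * energy \<epsilon> x t \<omega> + energy_rate \<epsilon> x t \<omega>))"
    by simp
  have f_der: "((\<lambda>t. f t r) has_real_derivative G t r) (at t within {0..})" if "0 \<le> t" for t r
  proof -
    have "((\<lambda>t. y t + w r) has_real_derivative - 2 * \<zeta>1 * v t - chi\<^sup>2 * p t) (at t within {0..})"
      using DERIV_add[OF der(2)[OF that] DERIV_const[of "w r"]] by simp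
    note L = lyap_derivative[OF der(1)[OF that] this der(3,4)[OF that], of \<epsilon>]
    have e: "((\<lambda>t. \<beta> * exp (l * t)) has_real_derivative \<beta> * exp (l * t) * l) (at t within {0..})"
      by (rule derivative_eq_intros refl | simp)+
    show ?thesis
      unfolding f_def[abs_def]
      by (rule DERIV_cong[OF DERIV_mult[OF e L]]) (simp add: G_def lyap_rate_def algebra_simps)
  qed
  have "\<beta> * exp (l * T) * energy \<epsilon> x T \<omega> - \<beta> * exp (l * s) * energy \<epsilon> x s \<omega> \<le>
      A k + (\<Sum>i<n k. \<beta> * exp (l * \<tau> k i) * energy_noise \<epsilon> x (\<tau> k i) \<omega> * (W (\<tau> k (Suc i)) \<omega> - W (\<tau> k i) \<omega>)
        + \<beta> * exp (l * \<tau> k i) * \<nu>\<^sup>2 / (2 * (1 - R)) * (W (\<tau> k (Suc i)) \<omega> - W (\<tau> k i) \<omega>)\<^sup>2)" for k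
  proof -
    have "\<beta> * exp (l * T) * energy \<epsilon> x T \<omega> - \<beta> * exp (l * s) * energy \<epsilon> x s \<omega> = f T T - f s s"
      by (simp add: f_def energy)
    also have "\<dots> = (\<Sum>i<n k. f (\<tau> k (Suc i)) (\<tau> k (Suc i)) - f (\<tau> k i) (\<tau> k i))"
      using sum_lessThan_telescope[of "\<lambda>i. f (\<tau> k i) (\<tau> k i)" "n k"] \<tau> by simp
    also have "\<dots> \<le> (\<Sum>i<n k. integral {\<tau> k i..\<tau> k (Suc i)} (\<lambda>t. G t (\<tau> k (Suc i)))
       + (\<beta> * exp (l * \<tau> k i) * energy_noise \<epsilon> x (\<tau> k i) \<omega> * (W (\<tau> k (Suc i)) \<omega> - W (\<tau> k i) \<omega>)
        + \<beta> * exp (l * \<tau> k i) * \<nu>\<^sup>2 / (2 * (1 - R)) * (W (\<tau> k (Suc i)) \<omega> - W (\<tau> k i) \<omega>)\<^sup>2))"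
    proof (rule sum_mono)
      fix i assume "i \<in> {..<n k}"
      then have i: "i < n k" by simp
      have nonneg: "0 \<le> \<tau> k i"
        using partition_mono[of "n k" "\<tau> k" 0 i] \<tau> i \<open>0 \<le> s\<close> by auto
      let ?t = "\<tau> k i" and ?t' = "\<tau> k (Suc i)" and ?d = "W (\<tau> k (Suc i)) \<omega> - W (\<tau> k i) \<omega>"
      have "((\<lambda>t. G t ?t') has_integral (f ?t' ?t' - f ?t ?t')) {?t..?t'}"
      proof (rule fundamental_theorem_of_calculus[OF \<tau>(3)[OF i]])
        fix t assume "t \<in> {?t..?t'}"
        then have "0 \<le> t" using nonneg by simp
        then have "((\<lambda>t. f t ?t') has_real_derivative G t ?t') (at t within {?t..?t'})"
          by (rule DERIV_subset[OF f_der]) (use nonneg in auto)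
        then show "((\<lambda>t. f t ?t') has_vector_derivative G t ?t') (at t within {?t..?t'})"
          by (simp only: has_real_derivative_iff_has_vector_derivative)
      qed
      then have I: "integral {?t..?t'} (\<lambda>t. G t ?t') = f ?t' ?t' - f ?t ?t'" by (rule integral_unique)
      have "y ?t + w ?t' = (y ?t + w ?t) + \<nu> * ?d" by (simp add: w_def noise_def algebra_simps)
      then have yw: "lyap \<epsilon> (p ?t) (y ?t + w ?t') (\<theta> ?t) (q ?t) = lyap \<epsilon> (p ?t) ((y ?t + w ?t) + \<nu> * ?d) (\<theta> ?t) (q ?t)"
        by (rule arg_cong)
      have "f ?t ?t' - f ?t ?t = \<beta> * exp (l * ?t) * ((v ?t + \<epsilon> * p ?t) * (\<nu> * ?d) + (\<nu> * ?d)\<^sup>2 / (2 * den (\<theta> ?t)))"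
        unfolding f_def yw right_diff_distrib[symmetric] lyap_shift v_def ..
      \<comment> \<open>Replacing \<open>den\<close> by its lower bound \<open>1 - R\<close> makes
        the quadratic coefficient deterministic, as the Gaussian product formula demands.\<close>
      also have "\<dots> \<le> \<beta> * exp (l * ?t) * ((v ?t + \<epsilon> * p ?t) * (\<nu> * ?d) + (\<nu> * ?d)\<^sup>2 / (2 * (1 - R)))"
        using \<open>0 \<le> \<beta>\<close> den[of "\<theta> ?t"] R by (intro mult_left_mono add_left_mono divide_left_mono) auto
      also have "\<dots> = \<beta> * exp (l * ?t) * energy_noise \<epsilon> x ?t \<omega> * ?d + \<beta> * exp (l * ?t) * \<nu>\<^sup>2 / (2 * (1 - R)) * ?d\<^sup>2"
      proof -
        have "e * (c * (\<nu> * d) + (\<nu> * d)\<^sup>2 / (2 * (1 - R))) = e * (\<nu> * c) * d + e * \<nu>\<^sup>2 / (2 * (1 - R)) * d\<^sup>2" for e c d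
          by (simp add: power_mult_distrib algebra_simps)
        then show ?thesis unfolding noise .
      qed
      finally show "f ?t' ?t' - f ?t ?t \<le> integral {?t..?t'} (\<lambda>t. G t ?t') +
        (\<beta> * exp (l * ?t) * energy_noise \<epsilon> x ?t \<omega> * ?d + \<beta> * exp (l * ?t) * \<nu>\<^sup>2 / (2 * (1 - R)) * ?d\<^sup>2)"
        unfolding I by simp
    qed
    also have "\<dots> = A k + (\<Sum>i<n k. \<beta> * exp (l * \<tau> k i) * energy_noise \<epsilon> x (\<tau> k i) \<omega> * (W (\<tau> k (Suc i)) \<omega> - W (\<tau> k i) \<omega>)
        + \<beta> * exp (l * \<tau> k i) * \<nu>\<^sup>2 / (2 * (1 - R)) * (W (\<tau> k (Suc i)) \<omega> - W (\<tau> k i) \<omega>)\<^sup>2)"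
      by (simp add: A_def sum.distrib)
    finally show ?thesis .
  qed
  with A show ?thesis by blast
qed

text \<open>The compensator of the weighted energy in the exponent: the pathwise drift plus
  \<open>a^2 / 2 + b\<close>, where \<open>a\<close> and \<open>b\<close> are the coefficients of
  the noise increment and of its square.\<close>

definition exponent_drift :: "real \<Rightarrow> real \<Rightarrow> real \<Rightarrow> state \<Rightarrow> real \<Rightarrow> 'a \<Rightarrow> real" where
  "exponent_drift \<epsilon> \<beta> l x t \<omega> = \<beta> * exp (l * t) *
     (l * energy \<epsilon> x t \<omega> + energy_rate \<epsilon> x t \<omega> + \<beta> * exp (l * t) / 2 * (energy_noise \<epsilon> x t \<omega>)\<^sup>2 + \<nu>\<^sup>2 / (2 * (1 - R)))"

lemma energy_continuous:
  assumes "\<omega> \<in> space M"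
  shows "continuous_on {0..} (\<lambda>t. energy \<epsilon> x t \<omega>)" "continuous_on {0..} (\<lambda>t. energy_rate \<epsilon> x t \<omega>)"
    "continuous_on {0..} (\<lambda>t. energy_noise \<epsilon> x t \<omega>)"
proof -
  have c: "continuous_on {0..} (\<lambda>t. fst (path x \<omega> t))" "continuous_on {0..} (\<lambda>t. fst (snd (path x \<omega> t)) + \<nu> * noise \<omega> t)"
    "continuous_on {0..} (\<lambda>t. fst (snd (snd (path x \<omega> t))))" "continuous_on {0..} (\<lambda>t. snd (snd (snd (path x \<omega> t))))"
    by (intro continuous_on_fst continuous_on_snd continuous_on_add continuous_on_mult continuous_on_const
        path_continuous noise_continuous assms)+
  show "continuous_on {0..} (\<lambda>t. energy \<epsilon> x t \<omega>)"
    unfolding energy_def case_prod_beta' by (rule continuous_on_lyap[OF c])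
  show "continuous_on {0..} (\<lambda>t. energy_rate \<epsilon> x t \<omega>)"
    unfolding energy_rate_def case_prod_beta'
    by (rule continuous_on_lyap_rate[OF c continuous_on_vel_ang[OF c(2,3,4)]])
  show "continuous_on {0..} (\<lambda>t. energy_noise \<epsilon> x t \<omega>)"
    unfolding energy_noise_def
    by (intro continuous_on_mult continuous_on_add continuous_on_const continuous_on_process canonical_continuous assms)
qed

text \<open>Discrete exponentials of mean 1 dominate the quantity up to errors that vanish with the
  mesh, and Fatou's lemma carries the mean over. The bound is stated through a measurable majorant
  \<open>Z\<close>, which can be scaled, integrated and used to define events.\<close>

lemma exponential_supermartingale:
  fixes x :: state and \<epsilon> \<beta> l s T :: real
  assumes st: "0 \<le> s" "s \<le> T" and \<beta>: "0 \<le> \<beta>" and l: "0 \<le> l"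
  obtains Z where "Z \<in> borel_measurable M" "(\<integral>\<^sup>+\<omega>. Z \<omega> \<partial>M) \<le> 1"
    "\<And>\<omega>. \<omega> \<in> space M \<Longrightarrow> ennreal (exp (\<beta> * exp (l * T) * energy \<epsilon> x T \<omega> - \<beta> * exp (l * s) * energy \<epsilon> x s \<omega>
        - integral {s..T} (\<lambda>t. exponent_drift \<epsilon> \<beta> l x t \<omega>))) \<le> Z \<omega>"
proof -
  define B where "B = \<beta> * exp (l * T) * \<nu>\<^sup>2 / (2 * (1 - R))"
  have B: "0 \<le> B" using \<beta> R by (simp add: B_def)
  \<comment> \<open>The partitions start so fine that \<open>4 B h < 1\<close> from the first one
    on, hence every Gaussian integral is finite.\<close>
  define k0 where "k0 = nat \<lceil>4 * B * (T - s)\<rceil>"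
  define n where "n k = Suc (k + k0)" for k
  define h where "h k = (T - s) / real (n k)" for k
  define \<tau> where "\<tau> k = uniform_partition s T (n k)" for k
  have n: "0 < n k" for k by (simp add: n_def)
  note u = uniform_partition[OF st(2) n, folded \<tau>_def]
  have h: "0 \<le> h k" "2 * B * h k < 1" for k
  proof -
    show "0 \<le> h k" using st by (simp add: h_def)
    have "4 * B * (T - s) \<le> real k0" unfolding k0_def by linarith
    also have "real k0 < real (n k)" by (simp add: n_def)
    finally have "4 * B * h k < 1" using n[of k] by (simp add: h_def pos_divide_less_eq)
    moreover have "0 \<le> B * h k" using B \<open>0 \<le> h k\<close> by simp
    ultimately show "2 * B * h k < 1" by linarith
  qed
  have h_lim: "h \<longlonglongrightarrow> 0"
  proof -
    have "(\<lambda>k. (T - s) / real (Suc (k + k0))) \<longlonglongrightarrow> 0"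
      using LIMSEQ_ignore_initial_segment[OF mesh_tendsto[of "T - s"], of k0] by simp
    then show ?thesis by (simp add: h_def[abs_def] n_def del: of_nat_Suc)
  qed
  define a b where "a t \<omega> = \<beta> * exp (l * t) * energy_noise \<epsilon> x t \<omega>" and "b t = \<beta> * exp (l * t) * \<nu>\<^sup>2 / (2 * (1 - R))"
    for t \<omega>
  define \<Delta> where "\<Delta> k i \<omega> = W (\<tau> k (Suc i)) \<omega> - W (\<tau> k i) \<omega>" for k i \<omega>
  define X where "X k \<omega> = ennreal (exp (\<Sum>i<n k. gauss_exponent (a (\<tau> k i) \<omega>) (b (\<tau> k i)) (\<tau> k (Suc i) - \<tau> k i) (\<Delta> k i \<omega>)))" for k \<omega>
  have b: "0 \<le> b t" for t using \<beta> R by (simp add: b_def)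
  have bB: "b t \<le> B" if "t \<le> T" for t
    unfolding b_def B_def using that \<beta> R l by (intro divide_right_mono mult_right_mono mult_left_mono) (auto intro: mult_left_mono)
  have step: "\<tau> k (Suc i) - \<tau> k i = h k" for k i
    using u(4)[of k i] by (simp add: h_def)
  have \<tau>0: "0 \<le> \<tau> k i" for k i using u(5)[of k i] st by linarith
  have a_meas: "a t \<in> borel_measurable (F t)" if "0 \<le> t" for t
  proof -
    have [measurable]: "canonical x t \<in> F t \<rightarrow>\<^sub>M borel" by (rule canonical_measurable[OF that])
    show ?thesis unfolding a_def[abs_def] energy_noise_def by measurable
  qed
  have EX: "(\<integral>\<^sup>+\<omega>. X k \<omega> \<partial>M) = 1" for k
    unfolding X_def \<Delta>_def
  proof (rule gauss_exponent_expectation)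
    show "2 * b (\<tau> k i) * (\<tau> k (Suc i) - \<tau> k i) < 1" if "i < n k" for i
    proof -
      have "2 * b (\<tau> k i) * h k \<le> 2 * B * h k"
        using bB[of "\<tau> k i"] u(6)[of i k] that h(1) by (intro mult_right_mono) auto
      then show ?thesis using h(2)[of k] by (simp add: step)
    qed
  qed (use u(3) \<tau>0 a_meas in auto)
  have X_meas[measurable]: "X k \<in> borel_measurable M" for k
  proof -
    have [measurable]: "W (\<tau> k i) \<in> borel_measurable M" "a (\<tau> k i) \<in> borel_measurable M" for i
      using W_measurable[OF \<tau>0] measurable_F_M[OF a_meas[OF \<tau>0]] by auto
    show ?thesis unfolding X_def \<Delta>_def gauss_exponent_def by measurable
  qed
  \<comment> \<open>The sequence \<open>X k\<close> itself need not converge; only the lower bounds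
    for it do.\<close>
  define Z where "Z \<omega> = liminf (\<lambda>k. X k \<omega>)" for \<omega>
  show ?thesis
  proof (rule that)
    show "Z \<in> borel_measurable M" unfolding Z_def by measurable
    have "(\<integral>\<^sup>+\<omega>. Z \<omega> \<partial>M) \<le> liminf (\<lambda>k. \<integral>\<^sup>+\<omega>. X k \<omega> \<partial>M)"
      unfolding Z_def by (rule nn_integral_liminf) simp
    then show "(\<integral>\<^sup>+\<omega>. Z \<omega> \<partial>M) \<le> 1" by (simp add: EX Liminf_const)
    fix \<omega> assume \<omega>: "\<omega> \<in> space M"
    let ?dV = "\<beta> * exp (l * T) * energy \<epsilon> x T \<omega> - \<beta> * exp (l * s) * energy \<epsilon> x s \<omega>"
    have "\<tau> k (Suc i) - \<tau> k i \<le> h k" for k i using step by simp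
    from energy_increments[OF \<omega> st \<beta> l u(1) u(2) u(3) this h_lim, of \<epsilon> x]
    obtain A where A: "A \<longlonglongrightarrow> integral {s..T} (\<lambda>t. \<beta> * exp (l * t) * (l * energy \<epsilon> x t \<omega> + energy_rate \<epsilon> x t \<omega>))"
      "\<And>k. ?dV \<le> A k + (\<Sum>i<n k. a (\<tau> k i) \<omega> * \<Delta> k i \<omega> + b (\<tau> k i) * (\<Delta> k i \<omega>)\<^sup>2)"
      unfolding a_def b_def \<Delta>_def by blast
    define g where "g t = (a t \<omega>)\<^sup>2 / 2 + b t" for t
    have cont0: "continuous_on {s..T} (\<lambda>t. energy \<epsilon> x t \<omega>)" "continuous_on {s..T} (\<lambda>t. energy_rate \<epsilon> x t \<omega>)"
      "continuous_on {s..T} (\<lambda>t. energy_noise \<epsilon> x t \<omega>)"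
      by (rule continuous_on_subset[OF energy_continuous(1)[OF \<omega>]] continuous_on_subset[OF energy_continuous(2)[OF \<omega>]]
          continuous_on_subset[OF energy_continuous(3)[OF \<omega>]]; use st in auto)+
    have g_cont: "continuous_on {s..T} g"
      unfolding g_def a_def b_def by (intro continuous_intros cont0) (use R in auto)
    \<comment> \<open>A Riemann sum of the Ito correction, times the factor from
      \<open>gauss_exponent_bound\<close> that tends to 1.\<close>
    define D where "D k = (\<Sum>i<n k. g (\<tau> k i) * h k) / (1 - 2 * B * h k)" for k
    have D: "D \<longlonglongrightarrow> integral {s..T} g"
    proof -
      have "(\<lambda>k. \<Sum>i<n k. integral {\<tau> k i..\<tau> k (Suc i)} (\<lambda>t. (\<lambda>t r. g r) t (\<tau> k i))) \<longlonglongrightarrow> integral {s..T} (\<lambda>t. (\<lambda>t r. g r) t t)"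
      proof (rule tagged_integral_limit[OF _ st(2) u(1) u(2) u(3) _ _ h_lim])
        have "continuous_on ({s..T} \<times> {s..T}) (\<lambda>z. g (snd z))"
          by (rule continuous_on_compose2[OF g_cont continuous_on_snd[OF continuous_on_id]]) auto
        then show "continuous_on ({s..T} \<times> {s..T}) (\<lambda>(t, r). g r)" by (simp add: case_prod_beta')
      qed (use u(3) step in auto)
      moreover have "integral {\<tau> k i..\<tau> k (Suc i)} (\<lambda>t. g (\<tau> k i)) = g (\<tau> k i) * h k" for k i
        using u(3)[of k i] step[of k i] by simp
      ultimately have "(\<lambda>k. \<Sum>i<n k. g (\<tau> k i) * h k) \<longlonglongrightarrow> integral {s..T} g" by (simp only:)
      then have "D \<longlonglongrightarrow> integral {s..T} g / (1 - 2 * B * 0)"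
        unfolding D_def by (intro tendsto_divide tendsto_diff tendsto_mult tendsto_const h_lim) auto
      then show ?thesis by simp
    qed
    have le: "ennreal (exp (?dV - A k - D k)) \<le> X k \<omega>" for k
    proof -
      have "(\<Sum>i<n k. a (\<tau> k i) \<omega> * \<Delta> k i \<omega> + b (\<tau> k i) * (\<Delta> k i \<omega>)\<^sup>2)
        \<le> (\<Sum>i<n k. gauss_exponent (a (\<tau> k i) \<omega>) (b (\<tau> k i)) (\<tau> k (Suc i) - \<tau> k i) (\<Delta> k i \<omega>) + g (\<tau> k i) * h k / (1 - 2 * B * h k))"
        unfolding step g_def
        by (rule sum_mono, rule gauss_exponent_bound[OF h(1) b bB h(2)]) (use u(6) in auto)
      also have "\<dots> = (\<Sum>i<n k. gauss_exponent (a (\<tau> k i) \<omega>) (b (\<tau> k i)) (\<tau> k (Suc i) - \<tau> k i) (\<Delta> k i \<omega>)) + D k"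
        by (simp add: D_def sum.distrib sum_divide_distrib)
      finally show ?thesis
        using A(2)[of k] unfolding X_def by (intro ennreal_leI) simp
    qed
    have lim: "(\<lambda>k. ennreal (exp (?dV - A k - D k)))
      \<longlonglongrightarrow> ennreal (exp (?dV - integral {s..T} (\<lambda>t. \<beta> * exp (l * t) * (l * energy \<epsilon> x t \<omega> + energy_rate \<epsilon> x t \<omega>)) - integral {s..T} g))"
      by (intro tendsto_ennrealI tendsto_exp tendsto_diff tendsto_const A D)
    have "integral {s..T} (\<lambda>t. exponent_drift \<epsilon> \<beta> l x t \<omega>)
      = integral {s..T} (\<lambda>t. \<beta> * exp (l * t) * (l * energy \<epsilon> x t \<omega> + energy_rate \<epsilon> x t \<omega>) + g t)"
      by (simp add: exponent_drift_def g_def a_def b_def field_simps power2_eq_square)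
    also have "\<dots> = integral {s..T} (\<lambda>t. \<beta> * exp (l * t) * (l * energy \<epsilon> x t \<omega> + energy_rate \<epsilon> x t \<omega>)) + integral {s..T} g"
      by (rule Henstock_Kurzweil_Integration.integral_add) (intro integrable_continuous_real continuous_intros cont0 g_cont)+
    finally have "ennreal (exp (?dV - integral {s..T} (\<lambda>t. exponent_drift \<epsilon> \<beta> l x t \<omega>))) = liminf (\<lambda>k. ennreal (exp (?dV - A k - D k)))"
      using lim_imp_Liminf[OF _ lim] by (simp add: algebra_simps)
    also have "\<dots> \<le> Z \<omega>"
      unfolding Z_def by (rule Liminf_mono) (use le in auto)
    finally show "ennreal (exp (?dV - integral {s..T} (\<lambda>t. exponent_drift \<epsilon> \<beta> l x t \<omega>))) \<le> Z \<omega>" .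
  qed
qed

end


section \<open>Moments, recurrence and invariant probabilities\<close>

text \<open>Either the decayed exponent is at most \<open>g / c\<close>, or
  \<open>a r > g / c\<close> with \<open>r = exp (- c t)\<close>; then the amount already lost,
  \<open>a - a r = a r (1 / r - 1)\<close>, is at least \<open>g t\<close> because
  \<open>exp (c t) - 1 \<ge> c t\<close>. Thus every rate \<open>g\<close> is reached at the price
  of a constant.\<close>

lemma exp_decay_split:
  fixes a c g t :: real
  assumes "0 \<le> a" "0 < c" "0 < g" "0 \<le> t"
  shows "exp (a * exp (- c * t)) \<le> exp (- g * t) * exp a + exp (g / c)"
proof (cases "a * exp (- c * t) \<le> g / c")
  case True
  then show ?thesis by (simp add: add_increasing)
next
  case False
  define r where "r = exp (- c * t)"
  have r: "0 < r" "1 / r = exp (c * t)" by (simp_all add: r_def exp_minus field_simps)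
  have a: "g / c < a * r" using False by (simp add: r_def)
  have "g * t = g / c * (c * t)" using assms by simp
  also have "\<dots> \<le> g / c * (1 / r - 1)"
  proof (rule mult_left_mono)
    show "c * t \<le> 1 / r - 1" unfolding r(2) using exp_ge_add_one_self[of "c * t"] by linarith
  qed (use assms in simp)
  also have "\<dots> \<le> a * r * (1 / r - 1)"
  proof (rule mult_right_mono)
    show "0 \<le> 1 / r - 1" unfolding r(2) using assms by simp
  qed (use a in simp)
  also have "\<dots> = a - a * r" using r(1) by (simp add: field_simps)
  finally have "exp (a * r) \<le> exp (- g * t + a)" by simp
  then show ?thesis unfolding exp_add r_def[symmetric] by (simp add: add_increasing2)
qed

lemma state_norm_power2: "(state_norm x)\<^sup>2 = (v1 x)\<^sup>2 + (v2 x)\<^sup>2 + (u2 x)\<^sup>2"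
  by (simp add: state_norm_def)

lemma state_norm_measurable [measurable]: "state_norm \<in> borel_measurable borel"
  unfolding state_norm_def[abs_def] by measurable

context stochastic_pendulum
begin

definition lyapunov_bounds :: "real \<Rightarrow> real \<Rightarrow> real \<Rightarrow> real \<Rightarrow> real \<Rightarrow> real \<Rightarrow> bool" where
  "lyapunov_bounds \<epsilon> c \<beta> c1 c2 K \<longleftrightarrow> 0 < c \<and> 0 < \<beta> \<and> 0 < c1 \<and> c1 \<le> c2 \<and> 0 \<le> K \<and>
    (\<forall>x t \<omega>. c1 * (state_norm (canonical x t \<omega>))\<^sup>2 \<le> energy \<epsilon> x t \<omega> \<and>
       energy \<epsilon> x t \<omega> \<le> c2 * (state_norm (canonical x t \<omega>))\<^sup>2 \<and>
       c * energy \<epsilon> x t \<omega> + energy_rate \<epsilon> x t \<omega> + \<beta> / 2 * (energy_noise \<epsilon> x t \<omega>)\<^sup>2 + \<nu>\<^sup>2 / (2 * (1 - R)) \<le> K)"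

lemma lyapunov_bounds_exist: "\<exists>\<epsilon> c \<beta> c1 c2 K. lyapunov_bounds \<epsilon> c \<beta> c1 c2 K"
proof -
  obtain \<epsilon> c \<beta> c1 c2 K where *: "0 < c" "0 < \<beta>" "0 < c1" "c1 \<le> c2" "0 \<le> K"
    and L: "\<forall>p m \<theta> q v u. v = vel m \<theta> q \<longrightarrow> u = ang m \<theta> q \<longrightarrow>
       c1 * (p\<^sup>2 + v\<^sup>2 + u\<^sup>2) \<le> lyap \<epsilon> p m \<theta> q \<and> lyap \<epsilon> p m \<theta> q \<le> c2 * (p\<^sup>2 + v\<^sup>2 + u\<^sup>2) \<and>
       c * lyap \<epsilon> p m \<theta> q + lyap_rate \<epsilon> p m \<theta> q v u + \<beta> / 2 * \<nu>\<^sup>2 * (v + \<epsilon> * p)\<^sup>2 + \<nu>\<^sup>2 / (2 * (1 - R)) \<le> K"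
    using lyapunov_constants by (elim exE conjE)
  have "c1 * (state_norm (canonical x t \<omega>))\<^sup>2 \<le> energy \<epsilon> x t \<omega> \<and>
       energy \<epsilon> x t \<omega> \<le> c2 * (state_norm (canonical x t \<omega>))\<^sup>2 \<and>
       c * energy \<epsilon> x t \<omega> + energy_rate \<epsilon> x t \<omega> + \<beta> / 2 * (energy_noise \<epsilon> x t \<omega>)\<^sup>2 + \<nu>\<^sup>2 / (2 * (1 - R)) \<le> K" for x t \<omega>
  proof -
    obtain p y \<theta> q where P: "path x \<omega> t = (p, y, \<theta>, q)" by (metis prod_cases4)
    let ?m = "y + \<nu> * noise \<omega> t"
    have U: "canonical x t \<omega> = (p, vel ?m \<theta> q, to_angle \<theta>, ang ?m \<theta> q)"
      by (simp add: canonical_def P state_of_def)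
    have N: "(energy_noise \<epsilon> x t \<omega>)\<^sup>2 = \<nu>\<^sup>2 * (vel ?m \<theta> q + \<epsilon> * p)\<^sup>2"
      by (simp add: energy_noise_def U power_mult_distrib)
    show ?thesis
      using L[rule_format, OF refl refl, of p ?m \<theta> q]
      unfolding N by (simp add: state_norm_power2 U energy_def energy_rate_def P mult.assoc)
  qed
  with * show ?thesis unfolding lyapunov_bounds_def by blast
qed

text \<open>With weight growing at rate \<open>l = c\<close> the term \<open>c\<close> times the
  energy is exactly what the Lyapunov inequality pays for, so the drift is at most the weight times
  \<open>K\<close>, with integral at most \<open>\<beta> K / c\<close>.\<close>

lemma exponential_moment:
  assumes L: "lyapunov_bounds \<epsilon> c \<beta> c1 c2 K" and T: "0 \<le> T"
  shows "(\<integral>\<^sup>+\<omega>. ennreal (exp (\<beta> * energy \<epsilon> x T \<omega>)) \<partial>M)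
    \<le> ennreal (exp (\<beta> * c2 * (state_norm x)\<^sup>2 * exp (- c * T) + \<beta> * K / c))"
proof -
  note L' = L[unfolded lyapunov_bounds_def]
  have pos: "0 < c" "0 < \<beta>" "0 \<le> K"
    and bounds: "\<And>x t \<omega>. energy \<epsilon> x t \<omega> \<le> c2 * (state_norm (canonical x t \<omega>))\<^sup>2"
      "\<And>x t \<omega>. c * energy \<epsilon> x t \<omega> + energy_rate \<epsilon> x t \<omega> + \<beta> / 2 * (energy_noise \<epsilon> x t \<omega>)\<^sup>2 + \<nu>\<^sup>2 / (2 * (1 - R)) \<le> K"
    using L' by blast+
  \<comment> \<open>The weight \<open>b exp (c t)\<close> reaches \<beta> at time \<open>T\<close>
    and stays below it before, so the squared gradient term remains within the inequality, while the
    initial energy carries the factor \<open>exp (- c T)\<close>.\<close>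
  define b where "b = \<beta> * exp (- c * T)"
  have b: "0 < b" "b * exp (c * T) = \<beta>" using pos by (simp_all add: b_def flip: exp_add)
  obtain Z where Z: "Z \<in> borel_measurable M" "(\<integral>\<^sup>+\<omega>. Z \<omega> \<partial>M) \<le> 1"
    "\<And>\<omega>. \<omega> \<in> space M \<Longrightarrow> ennreal (exp (b * exp (c * T) * energy \<epsilon> x T \<omega> - b * exp (c * 0) * energy \<epsilon> x 0 \<omega>
        - integral {0..T} (\<lambda>t. exponent_drift \<epsilon> b c x t \<omega>))) \<le> Z \<omega>"
    using exponential_supermartingale[of 0 T b c \<epsilon> x] T b pos by (metis less_imp_le order_refl)
  let ?C = "\<beta> * c2 * (state_norm x)\<^sup>2 * exp (- c * T) + \<beta> * K / c"
  have "ennreal (exp (\<beta> * energy \<epsilon> x T \<omega>)) \<le> Z \<omega> * ennreal (exp ?C)" if \<omega>: "\<omega> \<in> space M" for \<omega>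
  proof -
    have cont: "continuous_on {0..T} (\<lambda>t. exponent_drift \<epsilon> b c x t \<omega>)"
      unfolding exponent_drift_def
      by (intro continuous_intros continuous_on_initial energy_continuous[OF \<omega>]) (use R in auto)
    have "integral {0..T} (\<lambda>t. exponent_drift \<epsilon> b c x t \<omega>) \<le> integral {0..T} (\<lambda>t. b * exp (c * t) * K)"
    proof (rule integral_le)
      fix t assume t: "t \<in> {0..T}"
      have "b * exp (c * t) \<le> b * exp (c * T)" using b pos t by (intro mult_left_mono) auto
      then have "b * exp (c * t) / 2 * (energy_noise \<epsilon> x t \<omega>)\<^sup>2 \<le> \<beta> / 2 * (energy_noise \<epsilon> x t \<omega>)\<^sup>2"
        unfolding b(2) by (intro mult_right_mono divide_right_mono) auto
      then have "c * energy \<epsilon> x t \<omega> + energy_rate \<epsilon> x t \<omega> + b * exp (c * t) / 2 * (energy_noise \<epsilon> x t \<omega>)\<^sup>2 + \<nu>\<^sup>2 / (2 * (1 - R)) \<le> K"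
        using bounds(2)[of x t \<omega>] by linarith
      then show "exponent_drift \<epsilon> b c x t \<omega> \<le> b * exp (c * t) * K"
        unfolding exponent_drift_def using b(1) by (intro mult_left_mono) auto
    qed (intro integrable_continuous_real cont continuous_intros)+
    also have "integral {0..T} (\<lambda>t. b * exp (c * t) * K) = b * exp (c * T) * K / c - b * exp (c * 0) * K / c"
    proof (rule integral_unique, rule fundamental_theorem_of_calculus[OF T])
      fix t
      have "((\<lambda>t. b * exp (c * t) * K / c) has_real_derivative b * exp (c * t) * K) (at t within {0..T})"
        by (rule derivative_eq_intros refl | use pos in simp)+
      then show "((\<lambda>t. b * exp (c * t) * K / c) has_vector_derivative b * exp (c * t) * K) (at t within {0..T})"
        by (simp add: has_real_derivative_iff_has_vector_derivative)
    qed
    also have "\<dots> \<le> \<beta> * K / c" unfolding b(2) using b(1) pos by simp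
    finally have I: "integral {0..T} (\<lambda>t. exponent_drift \<epsilon> b c x t \<omega>) \<le> \<beta> * K / c" .
    have "b * energy \<epsilon> x 0 \<omega> \<le> b * (c2 * (state_norm x)\<^sup>2)"
      using bounds(1)[of x 0 \<omega>] b(1) canonical_0[OF \<omega>] by (intro mult_left_mono) auto
    also have "\<dots> = \<beta> * c2 * (state_norm x)\<^sup>2 * exp (- c * T)" by (simp add: b_def mult_ac)
    finally have "\<beta> * energy \<epsilon> x T \<omega> \<le> (\<beta> * energy \<epsilon> x T \<omega> - b * energy \<epsilon> x 0 \<omega> - integral {0..T} (\<lambda>t. exponent_drift \<epsilon> b c x t \<omega>)) + ?C"
      using I by linarith
    then have "exp (\<beta> * energy \<epsilon> x T \<omega>) \<le> exp (\<beta> * energy \<epsilon> x T \<omega> - b * energy \<epsilon> x 0 \<omega> - integral {0..T} (\<lambda>t. exponent_drift \<epsilon> b c x t \<omega>)) * exp ?C"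
      unfolding exp_add[symmetric] by simp
    then have "ennreal (exp (\<beta> * energy \<epsilon> x T \<omega>)) \<le>
        ennreal (exp (\<beta> * energy \<epsilon> x T \<omega> - b * energy \<epsilon> x 0 \<omega> - integral {0..T} (\<lambda>t. exponent_drift \<epsilon> b c x t \<omega>))) * ennreal (exp ?C)"
      by (simp add: ennreal_leI flip: ennreal_mult')
    also have "\<dots> \<le> Z \<omega> * ennreal (exp ?C)"
      using Z(3)[OF \<omega>] unfolding b(2) by (intro mult_right_mono) auto
    finally show ?thesis .
  qed
  then have "(\<integral>\<^sup>+\<omega>. ennreal (exp (\<beta> * energy \<epsilon> x T \<omega>)) \<partial>M) \<le> (\<integral>\<^sup>+\<omega>. Z \<omega> * ennreal (exp ?C) \<partial>M)"
    by (intro nn_integral_mono)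
  also have "\<dots> = (\<integral>\<^sup>+\<omega>. Z \<omega> \<partial>M) * ennreal (exp ?C)" by (rule nn_integral_multc[OF Z(1)])
  also have "\<dots> \<le> 1 * ennreal (exp ?C)" by (rule mult_right_mono[OF Z(2)]) simp
  finally show ?thesis by simp
qed

lemma norm_moment:
  assumes L: "lyapunov_bounds \<epsilon> c \<beta> c1 c2 K" and T: "0 \<le> T"
  shows "(\<integral>\<^sup>+\<omega>. ennreal (exp (\<beta> * c1 * (state_norm (canonical x T \<omega>))\<^sup>2)) \<partial>M)
    \<le> ennreal (exp (\<beta> * c2 * (state_norm x)\<^sup>2 * exp (- c * T) + \<beta> * K / c))"
proof -
  have "c1 * (state_norm (canonical x T \<omega>))\<^sup>2 \<le> energy \<epsilon> x T \<omega>" "0 < \<beta>" for \<omega>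
    using L unfolding lyapunov_bounds_def by blast+
  then have "\<beta> * c1 * (state_norm (canonical x T \<omega>))\<^sup>2 \<le> \<beta> * energy \<epsilon> x T \<omega>" for \<omega>
    unfolding mult.assoc by (intro mult_left_mono) auto
  then have "(\<integral>\<^sup>+\<omega>. ennreal (exp (\<beta> * c1 * (state_norm (canonical x T \<omega>))\<^sup>2)) \<partial>M) \<le> (\<integral>\<^sup>+\<omega>. ennreal (exp (\<beta> * energy \<epsilon> x T \<omega>)) \<partial>M)"
    by (intro nn_integral_mono ennreal_leI) simp
  also note exponential_moment[OF L T]
  finally show ?thesis .
qed

theorem moment_bound:
  "\<exists>\<beta> \<beta>1 K1. 0 < \<beta> \<and> \<beta> \<le> \<beta>1 \<and>
     (\<forall>\<gamma>>0. \<exists>K2. \<forall>x U t. solution R \<zeta>1 \<zeta>2 chi \<kappa> \<nu> M F W x U \<longrightarrow> 0 \<le> t \<longrightarrow>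
        (\<integral>\<^sup>+ \<omega>. ennreal (exp (\<beta> * (state_norm (U t \<omega>))\<^sup>2)) \<partial>M)
          \<le> ennreal (K1 * exp (- \<gamma> * t) * exp (\<beta>1 * (state_norm x)\<^sup>2) + K2))"
proof -
  obtain \<epsilon> c \<beta> c1 c2 K where L: "lyapunov_bounds \<epsilon> c \<beta> c1 c2 K" using lyapunov_bounds_exist by blast
  then have pos: "0 < c" "0 < \<beta>" "0 < c1" "c1 \<le> c2" by (auto simp: lyapunov_bounds_def)
  define C where "C = exp (\<beta> * K / c)"
  have main: "(\<integral>\<^sup>+ \<omega>. ennreal (exp (\<beta> * c1 * (state_norm (U t \<omega>))\<^sup>2)) \<partial>M)
      \<le> ennreal (C * exp (- \<gamma> * t) * exp (\<beta> * c2 * (state_norm x)\<^sup>2) + C * exp (\<gamma> / c))"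
    if "0 < \<gamma>" and U: "solution R \<zeta>1 \<zeta>2 chi \<kappa> \<nu> M F W x U" and t: "0 \<le> t" for \<gamma> x U t
  proof -
    have "(\<integral>\<^sup>+ \<omega>. ennreal (exp (\<beta> * c1 * (state_norm (U t \<omega>))\<^sup>2)) \<partial>M)
      = (\<integral>\<^sup>+ \<omega>. ennreal (exp (\<beta> * c1 * (state_norm (canonical x t \<omega>))\<^sup>2)) \<partial>M)"
    proof (rule nn_integral_cong_AE)
      show "AE \<omega> in M. ennreal (exp (\<beta> * c1 * (state_norm (U t \<omega>))\<^sup>2)) = ennreal (exp (\<beta> * c1 * (state_norm (canonical x t \<omega>))\<^sup>2))"
        using solution_unique[OF U] by eventually_elim (use t in simp)
    qed
    also note norm_moment[OF L t]
    also have "exp (\<beta> * c2 * (state_norm x)\<^sup>2 * exp (- c * t) + \<beta> * K / c)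
      = C * exp (\<beta> * c2 * (state_norm x)\<^sup>2 * exp (- c * t))" by (simp add: C_def exp_add)
    also have "ennreal \<dots> \<le> ennreal (C * (exp (- \<gamma> * t) * exp (\<beta> * c2 * (state_norm x)\<^sup>2) + exp (\<gamma> / c)))"
      using exp_decay_split[of "\<beta> * c2 * (state_norm x)\<^sup>2" c \<gamma> t] pos that
      by (intro ennreal_leI mult_left_mono) (auto simp: C_def)
    finally show ?thesis by (simp add: algebra_simps)
  qed
  show ?thesis
  proof (rule exI[of _ "\<beta> * c1"], rule exI[of _ "\<beta> * c2"], rule exI[of _ C], intro conjI allI impI)
    fix \<gamma> :: real assume "0 < \<gamma>"
    then show "\<exists>K2. \<forall>x U t. solution R \<zeta>1 \<zeta>2 chi \<kappa> \<nu> M F W x U \<longrightarrow> 0 \<le> t \<longrightarrow>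
        (\<integral>\<^sup>+ \<omega>. ennreal (exp (\<beta> * c1 * (state_norm (U t \<omega>))\<^sup>2)) \<partial>M)
          \<le> ennreal (C * exp (- \<gamma> * t) * exp (\<beta> * c2 * (state_norm x)\<^sup>2) + K2)"
      by (intro exI[of _ "C * exp (\<gamma> / c)"] allI impI main)
  qed (use pos in simp_all)
qed

text \<open>While the norm exceeds \<open>b\<close> the unweighted exponent gains at least \<beta>
  per unit of time. Staying above \<open>b\<close> for time \<open>j\<close> from bounded energy
  would make \<open>Z j\<close> exponentially large, which has probability at most
  \<open>exp (l - \<beta> j)\<close> because its mean is at most 1.\<close>

theorem recurrent:
  "\<exists>b>0. \<forall>x U. solution R \<zeta>1 \<zeta>2 chi \<kappa> \<nu> M F W x U \<longrightarrow>
     (AE \<omega> in M. \<not> bdd_above {t. 0 \<le> t \<and> state_norm (U t \<omega>) \<le> b})"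
proof -
  obtain \<epsilon> c \<beta> c1 c2 K where L: "lyapunov_bounds \<epsilon> c \<beta> c1 c2 K" using lyapunov_bounds_exist by blast
  then have pos: "0 < c" "0 < \<beta>" "0 < c1" "0 \<le> K"
    and bounds: "\<And>x t \<omega>. c1 * (state_norm (canonical x t \<omega>))\<^sup>2 \<le> energy \<epsilon> x t \<omega>"
      "\<And>x t \<omega>. c * energy \<epsilon> x t \<omega> + energy_rate \<epsilon> x t \<omega> + \<beta> / 2 * (energy_noise \<epsilon> x t \<omega>)\<^sup>2 + \<nu>\<^sup>2 / (2 * (1 - R)) \<le> K"
    unfolding lyapunov_bounds_def by blast+
  \<comment> \<open>Beyond this level \<open>c\<close> times the energy is at least
    \<open>K + 1\<close>, which pushes the remaining drift below -1.\<close>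
  define b where "b = sqrt ((K + 1) / (c * c1))"
  have b: "0 < b" "c * (c1 * b\<^sup>2) = K + 1" using pos by (auto simp: b_def)
  have main: "AE \<omega> in M. \<not> bdd_above {t. 0 \<le> t \<and> state_norm (canonical x t \<omega>) \<le> b}" for x
  proof -
    have "AE \<omega> in M. \<exists>j. \<not> (\<forall>t\<in>{real s..real s + real j}. b < state_norm (canonical x t \<omega>)) \<or> real l < \<beta> * energy \<epsilon> x (real s) \<omega>" for s l :: nat
    proof -
      have "\<exists>Z. Z \<in> borel_measurable M \<and> (\<integral>\<^sup>+\<omega>. Z \<omega> \<partial>M) \<le> 1 \<and> (\<forall>\<omega>\<in>space M.
          ennreal (exp (\<beta> * exp (0 * (real s + real j)) * energy \<epsilon> x (real s + real j) \<omega> - \<beta> * exp (0 * real s) * energy \<epsilon> x (real s) \<omega>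
        - integral {real s..real s + real j} (\<lambda>t. exponent_drift \<epsilon> \<beta> 0 x t \<omega>))) \<le> Z \<omega>)" for j :: nat
        by (rule exponential_supermartingale[of "real s" "real s + real j" \<beta> 0 \<epsilon> x]) (use pos in auto)
      then obtain Z where Z: "\<And>j. Z j \<in> borel_measurable M" "\<And>j. (\<integral>\<^sup>+\<omega>. Z j \<omega> \<partial>M) \<le> 1"
        "\<And>j \<omega>. \<omega> \<in> space M \<Longrightarrow> ennreal (exp (\<beta> * energy \<epsilon> x (real s + real j) \<omega> - \<beta> * energy \<epsilon> x (real s) \<omega>
        - integral {real s..real s + real j} (\<lambda>t. exponent_drift \<epsilon> \<beta> 0 x t \<omega>))) \<le> Z j \<omega>" for j :: nat
        by (simp, metis)
      \<comment> \<open>The exceptional event is defined through the measurable \<open>Z j\<close>.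
        The natural numbers \<open>s\<close> and \<open>l\<close> range over starting times and
        bounds for the energy there, so countably many null sets suffice.\<close>
      define A where "A = {\<omega>\<in>space M. \<forall>j. ennreal (exp (\<beta> * real j - real l)) \<le> Z j \<omega>}"
      have A: "A \<in> sets M" unfolding A_def using Z(1) by measurable
      have "emeasure M A \<le> ennreal (exp (real l - \<beta> * real j))" for j
      proof -
        have "emeasure M A = (\<integral>\<^sup>+\<omega>. indicator A \<omega> \<partial>M)" using A by simp
        also have "\<dots> \<le> (\<integral>\<^sup>+\<omega>. Z j \<omega> * ennreal (exp (real l - \<beta> * real j)) \<partial>M)"
        proof (rule nn_integral_mono)
          fix \<omega>
          show "indicator A \<omega> \<le> Z j \<omega> * ennreal (exp (real l - \<beta> * real j))"
          proof (cases "\<omega> \<in> A")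
            case True
            then have "ennreal (exp (\<beta> * real j - real l)) * ennreal (exp (real l - \<beta> * real j)) \<le> Z j \<omega> * ennreal (exp (real l - \<beta> * real j))"
              by (intro mult_right_mono) (auto simp: A_def)
            then show ?thesis using True by (simp flip: ennreal_mult' exp_add)
          qed simp
        qed
        also have "\<dots> = (\<integral>\<^sup>+\<omega>. Z j \<omega> \<partial>M) * ennreal (exp (real l - \<beta> * real j))" by (rule nn_integral_multc[OF Z(1)])
        also have "\<dots> \<le> 1 * ennreal (exp (real l - \<beta> * real j))" by (rule mult_right_mono[OF Z(2)]) simp
        finally show ?thesis by simp
      qed
      moreover have "(\<lambda>j. ennreal (exp (real l - \<beta> * real j))) \<longlonglongrightarrow> ennreal 0"
      proof (rule tendsto_ennrealI)
        have "(\<lambda>j. exp (real l) * exp (- \<beta>) ^ j) \<longlonglongrightarrow> exp (real l) * 0"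
          using pos by (intro tendsto_mult tendsto_const LIMSEQ_power_zero) simp
        moreover have "exp (real l) * exp (- \<beta>) ^ j = exp (real l - \<beta> * real j)" for j
          by (simp add: exp_diff exp_minus field_simps flip: exp_of_nat_mult)
        ultimately show "(\<lambda>j. exp (real l - \<beta> * real j)) \<longlonglongrightarrow> 0" by simp
      qed
      ultimately have "emeasure M A \<le> ennreal 0"
        by (intro LIMSEQ_le_const[where X="\<lambda>j. ennreal (exp (real l - \<beta> * real j))"]) auto
      then have "AE \<omega> in M. \<omega> \<notin> A" using A by (intro AE_not_in) (auto simp: null_sets_def)
      then show ?thesis using AE_space
      proof eventually_elim
        case (elim \<omega>)
        then obtain j where j: "\<not> ennreal (exp (\<beta> * real j - real l)) \<le> Z j \<omega>" by (auto simp: A_def)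
        have "\<not> (\<forall>t\<in>{real s..real s + real j}. b < state_norm (canonical x t \<omega>)) \<or> real l < \<beta> * energy \<epsilon> x (real s) \<omega>"
        proof (rule ccontr)
          assume "\<not> ?thesis"
          then have large: "\<And>t. t \<in> {real s..real s + real j} \<Longrightarrow> b < state_norm (canonical x t \<omega>)"
            and start: "\<beta> * energy \<epsilon> x (real s) \<omega> \<le> real l" by auto
          have drift: "exponent_drift \<epsilon> \<beta> 0 x t \<omega> \<le> - \<beta>" if t: "t \<in> {real s..real s + real j}" for t
          proof -
            have "b\<^sup>2 \<le> (state_norm (canonical x t \<omega>))\<^sup>2" using large[OF t] b(1) by (intro power_mono) auto
            then have "c1 * b\<^sup>2 \<le> energy \<epsilon> x t \<omega>"
              using bounds(1)[of x t \<omega>] pos(3) by (meson less_imp_le mult_left_mono order_trans)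
            then have "K + 1 \<le> c * energy \<epsilon> x t \<omega>" using pos(1) unfolding b(2)[symmetric] by (intro mult_left_mono) auto
            then have "energy_rate \<epsilon> x t \<omega> + \<beta> / 2 * (energy_noise \<epsilon> x t \<omega>)\<^sup>2 + \<nu>\<^sup>2 / (2 * (1 - R)) \<le> - 1"
              using bounds(2)[of x t \<omega>] by linarith
            then have "\<beta> * (energy_rate \<epsilon> x t \<omega> + \<beta> / 2 * (energy_noise \<epsilon> x t \<omega>)\<^sup>2 + \<nu>\<^sup>2 / (2 * (1 - R))) \<le> \<beta> * (- 1)"
              using pos(2) by (intro mult_left_mono) auto
            then show ?thesis by (simp add: exponent_drift_def)
          qed
          have "continuous_on {0..} (\<lambda>t. exponent_drift \<epsilon> \<beta> 0 x t \<omega>)"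
            unfolding exponent_drift_def using elim
            by (intro continuous_intros energy_continuous) (use R in auto)
          then have "continuous_on {real s..real s + real j} (\<lambda>t. exponent_drift \<epsilon> \<beta> 0 x t \<omega>)"
            by (rule continuous_on_subset) auto
          then have "integral {real s..real s + real j} (\<lambda>t. exponent_drift \<epsilon> \<beta> 0 x t \<omega>) \<le> integral {real s..real s + real j} (\<lambda>t. - \<beta>)"
            using drift by (intro integral_le integrable_continuous_real continuous_intros) auto
          then have "integral {real s..real s + real j} (\<lambda>t. exponent_drift \<epsilon> \<beta> 0 x t \<omega>) \<le> - (\<beta> * real j)"
            by (simp add: mult.commute)
          moreover have "0 \<le> \<beta> * energy \<epsilon> x (real s + real j) \<omega>"
            using bounds(1)[of x "real s + real j" \<omega>] pos by (meson less_imp_le mult_nonneg_nonneg order_trans zero_le_power2)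
          ultimately have "\<beta> * real j - real l \<le> \<beta> * energy \<epsilon> x (real s + real j) \<omega> - \<beta> * energy \<epsilon> x (real s) \<omega>
              - integral {real s..real s + real j} (\<lambda>t. exponent_drift \<epsilon> \<beta> 0 x t \<omega>)"
            using start by linarith
          then have "ennreal (exp (\<beta> * real j - real l)) \<le> ennreal (exp (\<beta> * energy \<epsilon> x (real s + real j) \<omega> - \<beta> * energy \<epsilon> x (real s) \<omega>
              - integral {real s..real s + real j} (\<lambda>t. exponent_drift \<epsilon> \<beta> 0 x t \<omega>)))"
            by (intro ennreal_leI) simp
          also have "\<dots> \<le> Z j \<omega>" using Z(3) elim by blast
          finally show False using j by simp
        qed
        then show ?case by blast
      qed
    qed
    then have "AE \<omega> in M. \<forall>s l :: nat. \<exists>j. \<not> (\<forall>t\<in>{real s..real s + real j}. b < state_norm (canonical x t \<omega>)) \<or> real l < \<beta> * energy \<epsilon> x (real s) \<omega>"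
      unfolding AE_all_countable by blast
    then show ?thesis
    proof eventually_elim
      case (elim \<omega>)
      show ?case
      proof
        assume "bdd_above {t. 0 \<le> t \<and> state_norm (canonical x t \<omega>) \<le> b}"
        then obtain B where B: "\<And>t. 0 \<le> t \<Longrightarrow> state_norm (canonical x t \<omega>) \<le> b \<Longrightarrow> t \<le> B"
          by (auto simp: bdd_above_def)
        obtain s :: nat where s: "B < real s" using reals_Archimedean2 by blast
        obtain l :: nat where l: "\<beta> * energy \<epsilon> x (real s) \<omega> < real l" using reals_Archimedean2 by blast
        have "b < state_norm (canonical x t \<omega>)" if "real s \<le> t" for t
          using B[of t] s that of_nat_0_le_iff[of s, where 'a=real] by (smt (verit))
        then show False using elim[rule_format, of s l] l by auto
      qed
    qed
  qed
  show ?thesis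
  proof (intro exI[of _ b] conjI allI impI b(1))
    fix x U assume U: "solution R \<zeta>1 \<zeta>2 chi \<kappa> \<nu> M F W x U"
    show "AE \<omega> in M. \<not> bdd_above {t. 0 \<le> t \<and> state_norm (U t \<omega>) \<le> b}"
      using main[of x] solution_unique[OF U]
    proof eventually_elim
      case (elim \<omega>)
      then have "{t. 0 \<le> t \<and> state_norm (U t \<omega>) \<le> b} = {t. 0 \<le> t \<and> state_norm (canonical x t \<omega>) \<le> b}" by auto
      with elim(1) show ?case by simp
    qed
  qed
qed

section \<open>Invariant probabilities\<close>

lemma transition_law_canonical:
  assumes t: "0 \<le> t"
  shows "transition_law R \<zeta>1 \<zeta>2 chi \<kappa> \<nu> M F W t x = distr M borel (canonical x t)"
  unfolding transition_law_def
proof (rule the_equality)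
  show "\<exists>U. solution R \<zeta>1 \<zeta>2 chi \<kappa> \<nu> M F W x U \<and> distr M borel (canonical x t) = distr M borel (U t)"
    using canonical_solution by blast
  fix \<mu> assume "\<exists>U. solution R \<zeta>1 \<zeta>2 chi \<kappa> \<nu> M F W x U \<and> \<mu> = distr M borel (U t)"
  then obtain U where U: "solution R \<zeta>1 \<zeta>2 chi \<kappa> \<nu> M F W x U" "\<mu> = distr M borel (U t)" by blast
  have "U t \<in> F t \<rightarrow>\<^sub>M borel" using U(1) t unfolding solution_def by blast
  moreover have "AE \<omega> in M. U t \<omega> = canonical x t \<omega>"
    using solution_unique[OF U(1)] by eventually_elim (use t in simp)
  ultimately show "\<mu> = distr M borel (canonical x t)"
    unfolding U(2) using measurable_F_M canonical_measurable[OF t, of x]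
    by (intro distr_cong_AE) auto
qed

text \<open>The kernel \<open>x \<mapsto> P\<^sub>t(x, A)\<close> is not known to be measurable, so only its bounds that are uniform in \<open>x\<close>
  up to a vanishing term are integrated.\<close>

lemma invariant_tail:
  assumes L: "lyapunov_bounds \<epsilon> c \<beta> c1 c2 K" and p: "invariant_probability R \<zeta>1 \<zeta>2 chi \<kappa> \<nu> M F W p"
  shows "emeasure p {x. r \<le> (state_norm x)\<^sup>2} \<le> ennreal (exp (\<beta> * K / c - \<beta> * c1 * r))"
proof -
  have pos: "0 < c" "0 < \<beta>" "0 < c1" using L by (auto simp: lyapunov_bounds_def)
  have p': "prob_space p" "sets p = sets borel" and inv: "\<And>t A. 0 \<le> t \<Longrightarrow> A \<in> sets borel \<Longrightarrow>
      emeasure p A = (\<integral>\<^sup>+ x. emeasure (transition_law R \<zeta>1 \<zeta>2 chi \<kappa> \<nu> M F W t x) A \<partial>p)"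
    using p unfolding invariant_probability_def by blast+
  interpret p: prob_space p by (rule p')
  let ?A = "{x. r \<le> (state_norm x)\<^sup>2}"
  \<comment> \<open>The minimum with 1 gives an integrable dominating function, as no moment of
    \<open>p\<close> is known yet.\<close>
  let ?b = "\<lambda>t x. min 1 (ennreal (exp (\<beta> * c2 * (state_norm x)\<^sup>2 * exp (- c * t) + \<beta> * K / c - \<beta> * c1 * r)))"
  have [measurable_cong]: "sets p = sets borel" by (rule p')
  have A: "?A \<in> sets borel" by measurable
  have kernel: "emeasure (transition_law R \<zeta>1 \<zeta>2 chi \<kappa> \<nu> M F W t x) ?A \<le> ?b t x" if t: "0 \<le> t" for t x
  proof -
    have [measurable]: "canonical x t \<in> M \<rightarrow>\<^sub>M borel" by (rule measurable_F_M[OF canonical_measurable[OF t]])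
    let ?E = "\<lambda>\<omega>. ennreal (exp (\<beta> * c1 * (state_norm (canonical x t \<omega>))\<^sup>2))"
    have eq: "emeasure (transition_law R \<zeta>1 \<zeta>2 chi \<kappa> \<nu> M F W t x) ?A = emeasure M {\<omega>\<in>space M. r \<le> (state_norm (canonical x t \<omega>))\<^sup>2}"
      unfolding transition_law_canonical[OF t] using A
      by (subst emeasure_distr) (auto intro!: arg_cong[where f="emeasure M"])
    also have "\<dots> = (\<integral>\<^sup>+\<omega>. indicator {\<omega>\<in>space M. r \<le> (state_norm (canonical x t \<omega>))\<^sup>2} \<omega> \<partial>M)" by simp
    also have "\<dots> \<le> (\<integral>\<^sup>+\<omega>. ?E \<omega> * ennreal (exp (- (\<beta> * c1 * r))) \<partial>M)"
    proof (rule nn_integral_mono)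
      fix \<omega>
      show "indicator {\<omega>\<in>space M. r \<le> (state_norm (canonical x t \<omega>))\<^sup>2} \<omega> \<le> ?E \<omega> * ennreal (exp (- (\<beta> * c1 * r)))"
      proof (cases "r \<le> (state_norm (canonical x t \<omega>))\<^sup>2")
        case True
        then have "0 \<le> \<beta> * c1 * (state_norm (canonical x t \<omega>))\<^sup>2 - \<beta> * c1 * r"
          using pos by (simp add: mult_left_mono)
        then have "1 \<le> ?E \<omega> * ennreal (exp (- (\<beta> * c1 * r)))" by (simp flip: ennreal_mult' exp_add)
        then show ?thesis by (auto simp: indicator_def)
      qed simp
    qed
    also have "\<dots> = (\<integral>\<^sup>+\<omega>. ?E \<omega> \<partial>M) * ennreal (exp (- (\<beta> * c1 * r)))" by (rule nn_integral_multc) measurable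
    also have "\<dots> \<le> ennreal (exp (\<beta> * c2 * (state_norm x)\<^sup>2 * exp (- c * t) + \<beta> * K / c)) * ennreal (exp (- (\<beta> * c1 * r)))"
      by (rule mult_right_mono[OF norm_moment[OF L t]]) simp
    also have "\<dots> = ennreal (exp (\<beta> * c2 * (state_norm x)\<^sup>2 * exp (- c * t) + \<beta> * K / c - \<beta> * c1 * r))"
      by (simp flip: ennreal_mult' exp_add)
    finally show ?thesis
      unfolding eq by (auto simp: emeasure_le_1)
  qed
  have "emeasure p ?A \<le> (\<integral>\<^sup>+x. ?b (real n) x \<partial>p)" for n
    unfolding inv[OF of_nat_0_le_iff A, of n] by (intro nn_integral_mono kernel) simp
  \<comment> \<open>By invariance the left-hand side is the same for all times; letting time grow
    removes the dependence on the starting point.\<close>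
  moreover have "(\<lambda>n. \<integral>\<^sup>+x. ?b (real n) x \<partial>p) \<longlonglongrightarrow> (\<integral>\<^sup>+x. min 1 (ennreal (exp (\<beta> * K / c - \<beta> * c1 * r))) \<partial>p)"
  proof (rule nn_integral_dominated_convergence[where w="\<lambda>_. 1"])
    show "AE x in p. (\<lambda>n. ?b (real n) x) \<longlonglongrightarrow> min 1 (ennreal (exp (\<beta> * K / c - \<beta> * c1 * r)))"
    proof (rule AE_I2)
      fix x
      have "(\<lambda>n. exp (- c) ^ n) \<longlonglongrightarrow> 0" using pos by (intro LIMSEQ_power_zero) simp
      then have "(\<lambda>n. exp (- c * real n)) \<longlonglongrightarrow> 0" by (simp add: mult.commute flip: exp_of_nat_mult)
      then have "(\<lambda>n. \<beta> * c2 * (state_norm x)\<^sup>2 * exp (- c * real n) + \<beta> * K / c - \<beta> * c1 * r)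
          \<longlonglongrightarrow> \<beta> * c2 * (state_norm x)\<^sup>2 * 0 + \<beta> * K / c - \<beta> * c1 * r"
        by (intro tendsto_intros)
      then show "(\<lambda>n. ?b (real n) x) \<longlonglongrightarrow> min 1 (ennreal (exp (\<beta> * K / c - \<beta> * c1 * r)))"
        by (intro tendsto_min tendsto_const tendsto_ennrealI tendsto_exp) simp
    qed
    show "(\<integral>\<^sup>+x. 1 \<partial>p) < \<infinity>" by (simp add: p.emeasure_space_1)
  qed auto
  ultimately have "emeasure p ?A \<le> (\<integral>\<^sup>+x. min 1 (ennreal (exp (\<beta> * K / c - \<beta> * c1 * r))) \<partial>p)"
    by (intro LIMSEQ_le_const) auto
  also have "\<dots> \<le> ennreal (exp (\<beta> * K / c - \<beta> * c1 * r))"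
    by (simp add: p.emeasure_space_1)
  finally show ?thesis .
qed

text \<open>The tails decay at rate \<open>\<beta> c1\<close> in the squared norm, uniformly over
  all invariant probabilities. Summing over layers of unit width gives the exponential
  moment.\<close>

theorem invariant_moment:
  "\<exists>\<beta>>0. \<exists>K. \<forall>p. invariant_probability R \<zeta>1 \<zeta>2 chi \<kappa> \<nu> M F W p \<longrightarrow>
     (\<integral>\<^sup>+ x. ennreal (exp (\<beta> * (state_norm x)\<^sup>2)) \<partial>p) \<le> ennreal K"
proof -
  obtain \<epsilon> c \<beta> c1 c2 K where L: "lyapunov_bounds \<epsilon> c \<beta> c1 c2 K" using lyapunov_bounds_exist by blast
  then have pos: "0 < c" "0 < \<beta>" "0 < c1" by (auto simp: lyapunov_bounds_def)
  \<comment> \<open>Half the tail rate: the other half makes the series over the layers geometric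
    with ratio \<open>exp (- a)\<close>.\<close>
  define a where "a = \<beta> * c1 / 2"
  have a: "0 < a" "\<beta> * c1 = 2 * a" using pos by (auto simp: a_def)
  define S where "S = (\<Sum>n. exp (a + \<beta> * K / c) * exp (- a) ^ n)"
  have summable: "summable (\<lambda>n. exp (a + \<beta> * K / c) * exp (- a) ^ n)"
    using a by (intro summable_mult summable_geometric) simp
  have "(\<integral>\<^sup>+ x. ennreal (exp (a * (state_norm x)\<^sup>2)) \<partial>p) \<le> ennreal S"
    if p: "invariant_probability R \<zeta>1 \<zeta>2 chi \<kappa> \<nu> M F W p" for p
  proof -
    have [measurable_cong]: "sets p = sets borel" using p by (simp add: invariant_probability_def)
    let ?A = "\<lambda>n. {x. real n \<le> (state_norm x)\<^sup>2}"
    have A: "?A n \<in> sets p" for n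
    proof -
      have "?A n \<in> sets borel" by measurable
      then show ?thesis using p by (simp add: invariant_probability_def)
    qed
    have "(\<integral>\<^sup>+ x. ennreal (exp (a * (state_norm x)\<^sup>2)) \<partial>p) \<le> (\<integral>\<^sup>+ x. (\<Sum>n. ennreal (exp (a * (real n + 1))) * indicator (?A n) x) \<partial>p)"
    proof (rule nn_integral_mono)
      fix x
      define m where "m = nat \<lfloor>(state_norm x)\<^sup>2\<rfloor>"
      have m: "real m \<le> (state_norm x)\<^sup>2" "(state_norm x)\<^sup>2 \<le> real m + 1"
        unfolding m_def by (auto simp: of_nat_nat)
      have "ennreal (exp (a * (state_norm x)\<^sup>2)) \<le> ennreal (exp (a * (real m + 1))) * indicator (?A m) x"
        using m a(1) by (auto intro!: ennreal_leI mult_left_mono)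
      also have "\<dots> = (\<Sum>n\<in>{m}. ennreal (exp (a * (real n + 1))) * indicator (?A n) x)"
        by (subst sum.insert) (simp_all only: finite.emptyI empty_iff not_False_eq_True sum.empty add_0_right)
      also have "\<dots> \<le> (\<Sum>n. ennreal (exp (a * (real n + 1))) * indicator (?A n) x)"
        by (rule sum_le_suminf) auto
      finally show "ennreal (exp (a * (state_norm x)\<^sup>2)) \<le> (\<Sum>n. ennreal (exp (a * (real n + 1))) * indicator (?A n) x)" .
    qed
    also have "\<dots> = (\<Sum>n. ennreal (exp (a * (real n + 1))) * emeasure p (?A n))"
      by (subst nn_integral_suminf) (auto simp: nn_integral_cmult_indicator A)
    also have "\<dots> \<le> (\<Sum>n. ennreal (exp (a + \<beta> * K / c) * exp (- a) ^ n))"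
    proof (rule suminf_le)
      fix n
      have "ennreal (exp (a * (real n + 1))) * emeasure p (?A n)
        \<le> ennreal (exp (a * (real n + 1))) * ennreal (exp (\<beta> * K / c - \<beta> * c1 * real n))"
        by (rule mult_left_mono[OF invariant_tail[OF L p]]) simp
      also have "\<dots> = ennreal (exp (a * (real n + 1) + (\<beta> * K / c - \<beta> * c1 * real n)))"
        by (simp add: exp_add ennreal_mult')
      also have "a * (real n + 1) + (\<beta> * K / c - \<beta> * c1 * real n) = (a + \<beta> * K / c) + real n * (- a)"
        unfolding a(2) by (simp add: algebra_simps)
      also have "exp \<dots> = exp (a + \<beta> * K / c) * exp (- a) ^ n"
        by (simp only: exp_add[of "a + \<beta> * K / c"] exp_of_nat_mult)
      finally show "ennreal (exp (a * (real n + 1))) * emeasure p (?A n) \<le> ennreal (exp (a + \<beta> * K / c) * exp (- a) ^ n)" .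
    qed auto
    also have "\<dots> = ennreal S"
      unfolding S_def by (rule suminf_ennreal2[OF _ summable]) simp
    finally show ?thesis .
  qed
  then show ?thesis using a(1) by blast
qed

end

theorem theorem2p1:
  fixes R \<zeta>1 \<zeta>2 chi \<kappa> \<nu> :: real
    and M :: "'a measure" and F :: "real \<Rightarrow> 'a measure" and W :: "real \<Rightarrow> 'a \<Rightarrow> real"
  assumes "0 < R" "R < 1" "0 < \<zeta>1" "0 < \<zeta>2" "0 < chi" "0 < \<kappa>" "0 < \<nu>"
    and "wiener_process M F W"
  shows
    "(\<forall>x. \<exists>U. solution R \<zeta>1 \<zeta>2 chi \<kappa> \<nu> M F W x U \<and>
        (\<forall>V. solution R \<zeta>1 \<zeta>2 chi \<kappa> \<nu> M F W x V \<longrightarrow> (AE \<omega> in M. \<forall>t\<ge>0. V t \<omega> = U t \<omega>)))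
     \<and>
     (\<exists>b>0. \<forall>x U. solution R \<zeta>1 \<zeta>2 chi \<kappa> \<nu> M F W x U \<longrightarrow>
        (AE \<omega> in M. \<not> bdd_above {t. 0 \<le> t \<and> state_norm (U t \<omega>) \<le> b}))
     \<and>
     (\<exists>\<beta>>0. \<exists>K. \<forall>p. invariant_probability R \<zeta>1 \<zeta>2 chi \<kappa> \<nu> M F W p \<longrightarrow>
        (\<integral>\<^sup>+ x. ennreal (exp (\<beta> * (state_norm x)\<^sup>2)) \<partial>p) \<le> ennreal K)
     \<and>
     (\<exists>\<beta> \<beta>1 K1. 0 < \<beta> \<and> \<beta> \<le> \<beta>1 \<and>
        (\<forall>\<gamma>>0. \<exists>K2. \<forall>x U t. solution R \<zeta>1 \<zeta>2 chi \<kappa> \<nu> M F W x U \<longrightarrow> 0 \<le> t \<longrightarrow>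
           (\<integral>\<^sup>+ \<omega>. ennreal (exp (\<beta> * (state_norm (U t \<omega>))\<^sup>2)) \<partial>M)
             \<le> ennreal (K1 * exp (- \<gamma> * t) * exp (\<beta>1 * (state_norm x)\<^sup>2) + K2)))"
proof -
  interpret wiener_process M F W by fact
  interpret stochastic_pendulum R \<zeta>1 \<zeta>2 chi \<kappa> \<nu> M F W
    by unfold_locales (use assms in auto)
  have "\<exists>U. solution R \<zeta>1 \<zeta>2 chi \<kappa> \<nu> M F W x U \<and>
      (\<forall>V. solution R \<zeta>1 \<zeta>2 chi \<kappa> \<nu> M F W x V \<longrightarrow> (AE \<omega> in M. \<forall>t\<ge>0. V t \<omega> = U t \<omega>))" for x
    using canonical_solution[of x] solution_unique[of x] by blast
  then show ?thesis
    using recurrent invariant_moment moment_bound by (intro conjI allI)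
qed


end
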